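(* For every $\varepsilon>0$ there exists $d_0$ such that the following holds. Let $d=d(n)$ be any function with $d_0\le d(n)$ for all $n$ and $d(n)=o(n)$, and let $p=d/n$. Then with high probability the random graph $G(n,p)$ contains an induced path of length at least $(2-\varepsilon)\frac{n}{d}\log d$.
   Context: $G(n,p)$ is the binomial random graph on vertex set $[n]=\{1,\dots,n\}$ in which each pair is an edge independently with probability $p$. "With high probability" means with probability $1-o_n(1)$ as $n\to\infty$. $\log$ denotes the natural logarithm. A path is induced if the subgraph spanned by its vertex set contains no edges other than the path edges. *)

theory Defs
  imports "HOL-Probability.Probability" "HOL-Probability.Product_PMF" "HOL-Library.Landau_Symbols"
begin

definition vertex_pairs :: "nat \<Rightarrow> nat set set" where
  "vertex_pairs n = {e. e \<subseteq> {1..n} \<and> card e = 2}"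

text \<open>A graph on the vertex set \<open>{1..n}\<close> is represented by its set of edges, a subset of
  \<open>vertex_pairs n\<close>. Note that \<open>bernoulli_pmf p\<close> clamps \<open>p\<close> to the unit interval.\<close>

definition gnp :: "nat \<Rightarrow> real \<Rightarrow> nat set set pmf" where
  "gnp n p = map_pmf (\<lambda>f. {e \<in> vertex_pairs n. f e})
     (Pi_pmf (vertex_pairs n) False (\<lambda>_. bernoulli_pmf p))"

text \<open>A path is the list of its vertices in order; its length is its number of edges.\<close>

definition path_edges :: "'a list \<Rightarrow> 'a set set" where
  "path_edges vs = {{vs ! i, vs ! Suc i} | i. Suc i < length vs}"

definition path_length :: "'a list \<Rightarrow> nat" where
  "path_length vs = length vs - 1"

definition is_path :: "'a set \<Rightarrow> 'a set set \<Rightarrow> 'a list \<Rightarrow> bool" where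
  "is_path V E vs \<longleftrightarrow> vs \<noteq> [] \<and> distinct vs \<and> set vs \<subseteq> V \<and> path_edges vs \<subseteq> E"

definition is_induced_path :: "'a set \<Rightarrow> 'a set set \<Rightarrow> 'a list \<Rightarrow> bool" where
  "is_induced_path V E vs \<longleftrightarrow> is_path V E vs \<and> {e \<in> E. e \<subseteq> set vs} = path_edges vs"

end

theory Submission
  imports Defs "HOL-Real_Asymp.Real_Asymp"
begin

text \<open>A second moment computation shows that \<open>G(n, d/n)\<close> contains an induced path on
  \<open>k = (2 - \<epsilon>/2) (n/d) log d\<close> vertices with probability at least about \<open>exp(- n / d^(3 - o(1)))\<close>.
  To boost this small probability, the potential paths are restricted to those that meet each block
  of a fixed partition of half of the vertices into \<open>2k\<close> blocks at most once. The least number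
  of defective vertices of a potential path is then a Lipschitz function of only \<open>2k\<close> independent
  variables, so by McDiarmid's inequality it is at most \<open>n / d^(2 - o(1))\<close> with high probability.
  Deleting the defects leaves an induced collection of paths, each with \<open>d^(1 - o(1))\<close> vertices,
  which covers almost all of the \<open>k\<close> vertices. Single vertices of the other half link almost all
  of these paths to one long induced path, which is found by depth-first search. For \<open>d\<close> above
  roughly the cube root of \<open>n\<close>, the second moment bound already tends to 1.\<close>

section \<open>Products of discrete distributions\<close>

text \<open>All exponents below ignore \<open>d\<close> to the power o(1). Two random potential
  paths share about n/d^2 vertices. The pairs inside the common part have to be non-edges only once,
  which inflates the second moment by up to exp((n/d^2)^2 d/n) = exp(n/d^3); so for small
  \<open>d\<close> the second moment bound is exponentially small. McDiarmid's inequality with about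
  n/d independent variables turns such a probability into a deviation of sqrt((n/d) (n/d^3)) =
  n/d^2. This dictates the size of the pieces: pieces of nearly \<open>d\<close> vertices are just
  slightly more numerous than the defects, each of which spoils at most one piece. The margin
  \<epsilon> is also what makes linking possible: an outside vertex misses all but two prescribed
  ones of the k path vertices with probability about (1-p)^k, which exceeds d^(-2) by a small power
  of \<open>d\<close>. So the expected number of usable connectors outgrows the entropy, about n/d^2
  with a smaller power to spare, of the union bound over all states of the search.\<close>

lemma finite_set_Pi_pmf:
  fixes p :: "'a \<Rightarrow> 'b::finite pmf"
  assumes "finite A"
  shows "finite (set_pmf (Pi_pmf A d p))"
proof (rule finite_subset)
  show "set_pmf (Pi_pmf A d p) \<subseteq> PiE_dflt A d (\<lambda>_. UNIV)"
    using set_Pi_pmf_subset[OF assms, of d p] by (auto simp: PiE_dflt_def)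
qed (use assms in auto)

lemma expectation_pair_pmf:
  fixes g :: "'a \<times> 'b \<Rightarrow> real"
  assumes "finite (set_pmf P)" "finite (set_pmf Q)"
  shows "measure_pmf.expectation (pair_pmf P Q) g =
    measure_pmf.expectation P (\<lambda>x. measure_pmf.expectation Q (\<lambda>y. g (x, y)))"
proof -
  have "measure_pmf.expectation (pair_pmf P Q) g =
     (\<Sum>a\<in>set_pmf P. pmf P a *\<^sub>R measure_pmf.expectation (Q \<bind> (\<lambda>y. return_pmf (a, y))) g)"
    unfolding pair_pmf_def by (rule pmf_expectation_bind) (use assms in auto)
  also have "\<dots> = (\<Sum>a\<in>set_pmf P. pmf P a *\<^sub>R measure_pmf.expectation Q (\<lambda>y. g (a, y)))"
    by (simp flip: map_pmf_def)
  also have "\<dots> = measure_pmf.expectation P (\<lambda>x. measure_pmf.expectation Q (\<lambda>y. g (x, y)))"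
    using assms by (subst integral_measure_pmf[of "set_pmf P"]) auto
  finally show ?thesis .
qed

text \<open>Exposure in two rounds: \<open>x\<close> is the outcome revealed on \<open>K\<close>,
  \<open>y\<close> the outcome drawn afterwards on the remaining coordinates.\<close>

definition glue :: "'a set \<Rightarrow> ('a \<Rightarrow> 'b) \<Rightarrow> ('a \<Rightarrow> 'b) \<Rightarrow> 'a \<Rightarrow> 'b" where
  "glue K x y = (\<lambda>e. if e \<in> K then x e else y e)"

lemma glue_in [simp]: "e \<in> K \<Longrightarrow> glue K x y e = x e"
  and glue_out [simp]: "e \<notin> K \<Longrightarrow> glue K x y e = y e"
  by (simp_all add: glue_def)

lemma expectation_Pi_pmf_split:
  fixes p :: "'a \<Rightarrow> 'b::finite pmf" and g :: "('a \<Rightarrow> 'b) \<Rightarrow> real"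
  assumes "finite I" "K \<subseteq> I"
  shows "measure_pmf.expectation (Pi_pmf I d p) g =
    measure_pmf.expectation (Pi_pmf K d p) (\<lambda>x.
      measure_pmf.expectation (Pi_pmf (I - K) d p) (\<lambda>y. g (glue K x y)))"
proof -
  have fin: "finite K" "finite (I - K)" using assms finite_subset by auto
  have "Pi_pmf I d p = Pi_pmf (K \<union> (I - K)) d p" using assms by (simp add: Un_absorb1)
  also have "\<dots> = map_pmf (\<lambda>(x, y). glue K x y) (pair_pmf (Pi_pmf K d p) (Pi_pmf (I - K) d p))"
    unfolding glue_def by (rule Pi_pmf_union) (use fin in auto)
  finally show ?thesis
    by (simp add: expectation_pair_pmf finite_set_Pi_pmf fin case_prod_unfold)
qed

definition depends_on :: "'a set \<Rightarrow> (('a \<Rightarrow> 'b) \<Rightarrow> 'c) \<Rightarrow> bool" where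
  "depends_on K g \<longleftrightarrow> (\<forall>x y. (\<forall>e\<in>K. x e = y e) \<longrightarrow> g x = g y)"

lemma depends_onD: "depends_on K g \<Longrightarrow> (\<And>e. e \<in> K \<Longrightarrow> x e = y e) \<Longrightarrow> g x = g y"
  by (auto simp: depends_on_def)

lemma prob_eq_expectation_of_bool:
  "measure_pmf.prob P {x. A x} = measure_pmf.expectation P (\<lambda>x. of_bool (A x))"
proof -
  have "(\<lambda>x. of_bool (A x) :: real) = indicator {x. A x}"
    by (auto simp: fun_eq_iff indicator_def)
  then show ?thesis by simp
qed

text \<open>A bound that holds for every outcome of the first round survives averaging over that
  round.\<close>

lemma prob_Pi_pmf_split_le:
  fixes p :: "'a \<Rightarrow> 'b::finite pmf"
  assumes "finite I" "K \<subseteq> I"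
    and le: "\<And>x. measure_pmf.prob (Pi_pmf (I - K) d p) {y. A (glue K x y)} \<le> c"
  shows "measure_pmf.prob (Pi_pmf I d p) {x. A x} \<le> c"
proof -
  have "measure_pmf.prob (Pi_pmf I d p) {x. A x} =
    measure_pmf.expectation (Pi_pmf K d p) (\<lambda>x.
      measure_pmf.prob (Pi_pmf (I - K) d p) {y. A (glue K x y)})"
    unfolding prob_eq_expectation_of_bool by (rule expectation_Pi_pmf_split) fact+
  also have "\<dots> \<le> measure_pmf.expectation (Pi_pmf K d p) (\<lambda>_. c)"
    using assms finite_subset
    by (intro integral_mono integrable_measure_pmf_finite finite_set_Pi_pmf) auto
  finally show ?thesis by simp
qed

lemma prob_Pi_pmf_restrict:
  fixes p :: "'a \<Rightarrow> 'b::finite pmf"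
  assumes "finite I" "K \<subseteq> I" "depends_on K A"
  shows "measure_pmf.prob (Pi_pmf I d p) {x. A x} = measure_pmf.prob (Pi_pmf K d p) {x. A x}"
proof -
  have "A (glue K x y) = A x" for x y
    by (rule depends_onD[OF assms(3)]) simp
  then show ?thesis
    unfolding prob_eq_expectation_of_bool expectation_Pi_pmf_split[OF assms(1,2)] by simp
qed

lemma prob_Pi_pmf_indep:
  fixes p :: "'a \<Rightarrow> 'b::finite pmf"
  assumes "finite I" "depends_on K A" "depends_on L B" "K \<inter> L = {}"
  shows "measure_pmf.prob (Pi_pmf I d p) {x. A x \<and> B x} =
    measure_pmf.prob (Pi_pmf I d p) {x. A x} * measure_pmf.prob (Pi_pmf I d p) {x. B x}"
proof -
  have I: "finite I" "K \<inter> I \<subseteq> I" using assms by auto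
  \<comment> \<open>\<open>K\<close> and \<open>L\<close> need not lie inside \<open>I\<close>.
    Resetting all coordinates outside \<open>I\<close> to the default \<open>d\<close> changes
    nothing on the support and makes the events depend on coordinates in \<open>I\<close>
    only.\<close>
  define A' where "A' x = A (\<lambda>e. if e \<in> I then x e else d)" for x
  define B' where "B' x = B (\<lambda>e. if e \<in> I then x e else d)" for x
  have supp: "(\<lambda>e. if e \<in> I then x e else d) = x" if "x \<in> set_pmf (Pi_pmf I d p)" for x
    using set_Pi_pmf_subset[OF I(1), of d p] that by (auto simp: fun_eq_iff)
  have cong: "measure_pmf.prob (Pi_pmf I d p) {x. P x} = measure_pmf.prob (Pi_pmf I d p) {x. Q x}"
    if "\<And>x. x \<in> set_pmf (Pi_pmf I d p) \<Longrightarrow> P x = Q x" for P Q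
    by (rule measure_pmf.finite_measure_eq_AE) (use that in \<open>auto simp: AE_measure_pmf_iff\<close>)
  have A': "A' (glue (K \<inter> I) x y) = A' x" for x y
    unfolding A'_def by (rule depends_onD[OF assms(2)]) auto
  have B': "B' (glue (K \<inter> I) x y) = B' y" for x y
    unfolding B'_def by (rule depends_onD[OF assms(3)]) (use assms(4) in \<open>auto simp: glue_def\<close>)
  have "measure_pmf.prob (Pi_pmf I d p) {x. A' x \<and> B' x} =
    measure_pmf.prob (Pi_pmf I d p) {x. A' x} * measure_pmf.prob (Pi_pmf I d p) {x. B' x}"
    unfolding prob_eq_expectation_of_bool expectation_Pi_pmf_split[OF I]
    by (simp add: A' B' of_bool_conj)
  moreover have "measure_pmf.prob (Pi_pmf I d p) {x. A' x \<and> B' x} =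
     measure_pmf.prob (Pi_pmf I d p) {x. A x \<and> B x}"
    by (rule cong) (simp add: A'_def B'_def supp)
  moreover have "measure_pmf.prob (Pi_pmf I d p) {x. A' x} =
     measure_pmf.prob (Pi_pmf I d p) {x. A x}"
    by (rule cong) (simp add: A'_def supp)
  moreover have "measure_pmf.prob (Pi_pmf I d p) {x. B' x} =
     measure_pmf.prob (Pi_pmf I d p) {x. B x}"
    by (rule cong) (simp add: B'_def supp)
  ultimately show ?thesis by simp
qed

lemma prob_Pi_pmf_indep_ball:
  fixes p :: "'a \<Rightarrow> 'b::finite pmf"
  assumes "finite I" "finite J" "\<And>j. j \<in> J \<Longrightarrow> depends_on (K j) (A j)" "disjoint_family_on K J"
  shows "measure_pmf.prob (Pi_pmf I d p) {x. \<forall>j\<in>J. A j x} =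
    (\<Prod>j\<in>J. measure_pmf.prob (Pi_pmf I d p) {x. A j x})"
  using assms(2-4)
proof (induction J rule: finite_induct)
  case (insert i J)
  have "depends_on (\<Union>j\<in>J. K j) (\<lambda>x. \<forall>j\<in>J. A j x)"
    unfolding depends_on_def
  proof (intro allI impI ball_cong refl)
    fix x y :: "'a \<Rightarrow> 'b" and j assume *: "\<forall>e\<in>\<Union> (K ` J). x e = y e" "j \<in> J"
    have "depends_on (K j) (A j)" using * by (intro insert.prems(1)) simp
    then show "A j x = A j y" by (rule depends_onD) (use * in blast)
  qed
  moreover have "K i \<inter> (\<Union>j\<in>J. K j) = {}"
    using insert.prems(2) insert.hyps by (fastforce simp: disjoint_family_on_def)
  ultimately have "measure_pmf.prob (Pi_pmf I d p) {x. A i x \<and> (\<forall>j\<in>J. A j x)} =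
    measure_pmf.prob (Pi_pmf I d p) {x. A i x} * measure_pmf.prob (Pi_pmf I d p) {x. \<forall>j\<in>J. A j x}"
    using insert.prems(1)[of i] by (intro prob_Pi_pmf_indep[OF assms(1)]) simp_all
  moreover have "measure_pmf.prob (Pi_pmf I d p) {x. \<forall>j\<in>J. A j x} =
    (\<Prod>j\<in>J. measure_pmf.prob (Pi_pmf I d p) {x. A j x})"
    using insert.prems(2) by (intro insert.IH insert.prems(1)) (simp_all add: disjoint_family_on_def)
  ultimately show ?case using insert.hyps by simp
qed simp

text \<open>Every probability of a concrete graph event reduces to this one: the pairs in
  \<open>H\<close> are edges, those in \<open>A - H\<close> are non-edges, and the rest is
  free.\<close>

lemma prob_pattern:
  fixes p :: real
  assumes "finite I" "A \<subseteq> I" "H \<subseteq> A" "0 \<le> p" "p \<le> 1"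
  shows "measure_pmf.prob (Pi_pmf I False (\<lambda>_. bernoulli_pmf p)) {x. \<forall>e\<in>A. x e \<longleftrightarrow> e \<in> H} =
    p ^ card H * (1 - p) ^ (card A - card H)"
proof -
  have fA: "finite A" "finite H" using assms by (meson finite_subset)+
  have "{x. \<forall>e\<in>A. x e \<longleftrightarrow> e \<in> H} = Pi I (\<lambda>e. if e \<in> A then {e \<in> H} else UNIV)"
    using assms(2) by (auto simp: Pi_def split: if_splits)
  then have "measure_pmf.prob (Pi_pmf I False (\<lambda>_. bernoulli_pmf p)) {x. \<forall>e\<in>A. x e \<longleftrightarrow> e \<in> H} =
    (\<Prod>e\<in>I. measure_pmf.prob (bernoulli_pmf p) (if e \<in> A then {e \<in> H} else UNIV))"
    by (simp add: measure_Pi_pmf_Pi assms(1))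
  also have "\<dots> = (\<Prod>e\<in>A. measure_pmf.prob (bernoulli_pmf p) {e \<in> H})"
    by (rule prod.mono_neutral_cong_right) (use assms in auto)
  also have "\<dots> = (\<Prod>e\<in>A. if e \<in> H then p else 1 - p)"
    by (rule prod.cong) (use assms in \<open>auto simp: measure_pmf_single\<close>)
  also have "\<dots> = (\<Prod>e\<in>H. p) * (\<Prod>e\<in>A - H. 1 - p)"
    using fA assms(3) by (subst prod.If_cases) (auto simp: Int_absorb1 Diff_eq Int_commute)
  also have "\<dots> = p ^ card H * (1 - p) ^ (card A - card H)"
    using fA assms(3) by (simp add: card_Diff_subset)
  finally show ?thesis .
qed

section \<open>Exponential moments and McDiarmid's inequality\<close>

lemma Hoeffding_exp_bound:
  fixes g :: "'a \<Rightarrow> real"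
  assumes fin: "finite (set_pmf M)"
    and osc: "\<And>x y. \<bar>g x - g y\<bar> \<le> 1"
  shows "measure_pmf.expectation M (\<lambda>x. exp (l * g x))
     \<le> exp (l * measure_pmf.expectation M g + l\<^sup>2 / 8)"
proof -
  have pos: "measure_pmf.expectation M (\<lambda>x. exp (l * g x))
     \<le> exp (l * measure_pmf.expectation M g + l\<^sup>2 / 8)"
    if l: "l > 0" and osc: "\<And>x y. \<bar>g x - g y\<bar> \<le> 1" for l and g :: "'a \<Rightarrow> real"
  proof -
    define a where "a = Min (g ` set_pmf M)"
    have nonempty: "g ` set_pmf M \<noteq> {}" by (simp add: set_pmf_not_empty)
    have a: "a \<in> g ` set_pmf M" "\<And>x. x \<in> set_pmf M \<Longrightarrow> a \<le> g x"
      unfolding a_def using fin nonempty by (auto intro: Min_in simp del: image_is_empty)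
    have ub: "g x \<le> a + 1" for x 
    proof -
      from a(1) obtain y where "a = g y" by auto
      then show ?thesis using osc[of x y] by (simp add: abs_le_iff)
    qed
    interpret interval_bounded_random_variable "measure_pmf M" g a "a + 1"
      by unfold_locales (use a ub in \<open>auto simp: AE_measure_pmf_iff\<close>)
    define \<mu> where "\<mu> = measure_pmf.expectation M g"
    have "(\<integral>\<^sup>+ x. ennreal (exp (l * (g x - \<mu>))) \<partial>measure_pmf M)
       = ennreal (measure_pmf.expectation M (\<lambda>x. exp (l * (g x - \<mu>))))"
      by (rule nn_integral_eq_integral) (auto intro: integrable_measure_pmf_finite fin)
    with Hoeffdings_lemma_nn_integral[OF l]
    have "measure_pmf.expectation M (\<lambda>x. exp (l * (g x - \<mu>))) \<le> exp (l\<^sup>2 / 8)"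
      by (simp add: \<mu>_def)
    then have "exp (l * \<mu>) * measure_pmf.expectation M (\<lambda>x. exp (l * (g x - \<mu>)))
       \<le> exp (l * \<mu>) * exp (l\<^sup>2 / 8)"
      by (intro mult_left_mono) auto
    then show ?thesis
      by (simp add: \<mu>_def right_diff_distrib exp_add flip: integral_mult_right_zero)
         (simp add: exp_diff)
  qed
  show ?thesis
  proof (cases l "0 :: real" rule: linorder_cases)
    case less
    \<comment> \<open>The oscillation is the same for \<open>- g\<close>, so a negative
      \<open>l\<close> reduces to the positive case.\<close>
    have "\<bar>- g x - - g y\<bar> \<le> 1" for x y using osc[of y x] by simp
    from pos[of "- l" "\<lambda>x. - g x", OF _ this] less show ?thesis by simp
  next
    case greater
    then show ?thesis using osc by (rule pos)
  qed simp
qed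

text \<open>The usual martingale argument as an induction on the number of groups: average over the
  remaining groups for a fixed outcome on \<open>K i\<close>, then apply Hoeffding's lemma to this
  conditional mean, which inherits oscillation at most 1. The independent variables are whole groups
  of coordinates, because one block of the graph controls many pairs at once.\<close>

lemma McDiarmid_exp_bound:
  fixes p :: "'a \<Rightarrow> 'b::finite pmf" and f :: "('a \<Rightarrow> 'b) \<Rightarrow> real"
  assumes "finite J" "finite (\<Union>j\<in>J. K j)" "disjoint_family_on K J"
    and "\<And>j x y. j \<in> J \<Longrightarrow> (\<And>e. e \<notin> K j \<Longrightarrow> x e = y e) \<Longrightarrow> \<bar>f x - f y\<bar> \<le> 1"
  shows "measure_pmf.expectation (Pi_pmf (\<Union>j\<in>J. K j) d p) (\<lambda>x. exp (l * f x))
     \<le> exp (l * measure_pmf.expectation (Pi_pmf (\<Union>j\<in>J. K j) d p) f + l\<^sup>2 * card J / 8)"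
  using assms
proof (induction J arbitrary: f rule: finite_induct)
  case (insert i J)
  let ?L = "\<Union>j\<in>J. K j" and ?I = "\<Union>j\<in>insert i J. K j"
  have disj: "K i \<inter> ?L = {}"
    using insert.prems(2) insert.hyps by (fastforce simp: disjoint_family_on_def)
  then have diff: "?I - K i = ?L" by auto
  have fin: "finite ?I" "finite (K i)" "finite ?L" "K i \<subseteq> ?I" using insert.prems(1) by auto
  note split = expectation_Pi_pmf_split[OF fin(1,4), of d p, unfolded diff]
  let ?E = "measure_pmf.expectation (Pi_pmf ?L d p)"
  define g where "g x = ?E (\<lambda>y. f (glue (K i) x y))" for x
  have int: "integrable (measure_pmf (Pi_pmf ?L d p)) h" for h :: "_ \<Rightarrow> real"
    by (intro integrable_measure_pmf_finite finite_set_Pi_pmf fin)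
  have int': "integrable (measure_pmf (Pi_pmf (K i) d p)) h" for h :: "_ \<Rightarrow> real"
    by (intro integrable_measure_pmf_finite finite_set_Pi_pmf fin)
  have IH: "?E (\<lambda>y. exp (l * f (glue (K i) x y))) \<le> exp (l * g x + l\<^sup>2 * card J / 8)" for x
    unfolding g_def
  proof (rule insert.IH)
    show "disjoint_family_on K J" using insert.prems(2) by (auto simp: disjoint_family_on_def)
    show "\<bar>f (glue (K i) x y) - f (glue (K i) x z)\<bar> \<le> 1"
      if "j \<in> J" "\<And>e. e \<notin> K j \<Longrightarrow> y e = z e" for j y z
      using that by (intro insert.prems(3)[of j]) (auto simp: glue_def)
  qed fact
  have Eg: "measure_pmf.expectation (Pi_pmf ?I d p) f = measure_pmf.expectation (Pi_pmf (K i) d p) g"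
    unfolding g_def by (rule split)
  have osc: "\<bar>g x - g x'\<bar> \<le> 1" for x x'
  proof -
    have "g x - g x' = ?E (\<lambda>y. f (glue (K i) x y) - f (glue (K i) x' y))"
      by (simp add: g_def int)
    also have "\<bar>\<dots>\<bar> \<le> ?E (\<lambda>y. \<bar>f (glue (K i) x y) - f (glue (K i) x' y)\<bar>)"
      by (rule integral_abs_bound)
    also have "\<dots> \<le> ?E (\<lambda>_. 1)"
      by (intro integral_mono int insert.prems(3)[of i]) auto
    finally show ?thesis by simp
  qed
  have "measure_pmf.expectation (Pi_pmf ?I d p) (\<lambda>x. exp (l * f x))
    \<le> measure_pmf.expectation (Pi_pmf (K i) d p) (\<lambda>x. exp (l * g x + l\<^sup>2 * card J / 8))"
    unfolding split by (intro integral_mono int' IH)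
  also have "\<dots> = measure_pmf.expectation (Pi_pmf (K i) d p) (\<lambda>x. exp (l * g x)) * exp (l\<^sup>2 * card J / 8)"
    by (simp add: exp_add)
  also have "\<dots> \<le> exp (l * measure_pmf.expectation (Pi_pmf (K i) d p) g + l\<^sup>2 / 8) * exp (l\<^sup>2 * card J / 8)"
    by (intro mult_right_mono Hoeffding_exp_bound finite_set_Pi_pmf fin osc) auto
  also have "\<dots> = exp (l * measure_pmf.expectation (Pi_pmf ?I d p) f + l\<^sup>2 * card (insert i J) / 8)"
    using insert.hyps by (simp only: Eg) (simp add: exp_add[symmetric] field_simps)
  finally show ?case .
qed simp

lemma prob_le_exp_markov:
  fixes g :: "'a \<Rightarrow> real"
  assumes "finite (set_pmf P)" "\<And>x. A x \<Longrightarrow> c \<le> g x"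
  shows "measure_pmf.prob P {x. A x} \<le> exp (- c) * measure_pmf.expectation P (\<lambda>x. exp (g x))"
proof -
  have "of_bool (A x) \<le> exp (- c) * exp (g x)" for x
    using assms(2)[of x] by (auto simp flip: exp_add)
  then have "measure_pmf.prob P {x. A x} \<le> measure_pmf.expectation P (\<lambda>x. exp (- c) * exp (g x))"
    unfolding prob_eq_expectation_of_bool
    by (intro integral_mono integrable_measure_pmf_finite assms) auto
  then show ?thesis by simp
qed

text \<open>The exponential moments at \<open>l\<close> and \<open>- l\<close> are multiplied, so
  the unknown mean of \<open>f\<close> cancels. In this form a lower bound on the probability of
  \<open>f x \<le> 0\<close>, however small, yields an upper bound on the probability of
  \<open>f x \<ge> t\<close>.\<close>

lemma McDiarmid_two_sided:
  fixes p :: "'a \<Rightarrow> 'b::finite pmf" and f :: "('a \<Rightarrow> 'b) \<Rightarrow> real" and d :: 'b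
  assumes "finite J" "J \<noteq> {}" "finite (\<Union>j\<in>J. K j)" "disjoint_family_on K J"
    and "\<And>j x y. j \<in> J \<Longrightarrow> (\<And>e. e \<notin> K j \<Longrightarrow> x e = y e) \<Longrightarrow> \<bar>f x - f y\<bar> \<le> 1"
    and "t \<ge> 0"
  defines "P \<equiv> Pi_pmf (\<Union>j\<in>J. K j) d p"
  shows "measure_pmf.prob P {x. f x \<ge> t} * measure_pmf.prob P {x. f x \<le> 0} \<le> exp (- t\<^sup>2 / card J)"
proof -
  have fin: "finite (set_pmf P)" unfolding P_def by (rule finite_set_Pi_pmf) fact
  define n where "n = real (card J)"
  have n: "n > 0" using assms(1,2) by (simp add: n_def card_gt_0_iff)
  \<comment> \<open>The minimizer of the final exponent - l t + l^2 n / 4.\<close>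
  define l where "l = 2 * t / n"
  have l: "l \<ge> 0" using n assms(6) by (simp add: l_def)
  let ?E = "measure_pmf.expectation P"
  have E: "?E (\<lambda>x. exp (l * f x)) \<le> exp (l * ?E f + l\<^sup>2 * n / 8)" for l
    unfolding P_def n_def by (rule McDiarmid_exp_bound) (use assms in auto)
  have "measure_pmf.prob P {x. f x \<ge> t} \<le> exp (- (l * t)) * ?E (\<lambda>x. exp (l * f x))"
    by (rule prob_le_exp_markov[OF fin]) (use l in \<open>auto intro: mult_left_mono\<close>)
  also have "\<dots> \<le> exp (- (l * t)) * exp (l * ?E f + l\<^sup>2 * n / 8)"
    by (intro mult_left_mono E) auto
  finally have 1: "measure_pmf.prob P {x. f x \<ge> t} \<le> exp (- (l * t)) * exp (l * ?E f + l\<^sup>2 * n / 8)" .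
  have "measure_pmf.prob P {x. f x \<le> 0} \<le> exp (- 0) * ?E (\<lambda>x. exp (- l * f x))"
    by (rule prob_le_exp_markov[OF fin]) (use l in \<open>auto intro: mult_nonneg_nonpos\<close>)
  also have "\<dots> \<le> exp (- l * ?E f + (- l)\<^sup>2 * n / 8)" using E[of "- l"] by simp
  finally have 2: "measure_pmf.prob P {x. f x \<le> 0} \<le> exp (- l * ?E f + (- l)\<^sup>2 * n / 8)" .
  have "measure_pmf.prob P {x. f x \<ge> t} * measure_pmf.prob P {x. f x \<le> 0} \<le>
    (exp (- (l * t)) * exp (l * ?E f + l\<^sup>2 * n / 8)) * exp (- l * ?E f + (- l)\<^sup>2 * n / 8)"
    by (intro mult_mono 1 2) auto
  also have "\<dots> = exp (- (l * t) + l\<^sup>2 * n / 4)"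
    by (simp flip: exp_add)
  also have "- (l * t) + l\<^sup>2 * n / 4 = - t\<^sup>2 / n"
    using n by (simp add: l_def power2_eq_square field_simps)
  finally show ?thesis by (simp add: n_def)
qed

text \<open>Cauchy-Schwarz for the number X of successes and its indicator Z: from X = X Z follows
  (E X)^2 \<le> E X^2 * E Z. It is derived from the nonnegativity of E (X - c Z)^2 for all c.
  Bounding the correlations for each fixed \<open>r\<close> suffices, since E X^2 sums them over
  \<open>r\<close>.\<close>

lemma second_moment:
  fixes A :: "'q \<Rightarrow> 'a \<Rightarrow> bool" and R \<pi> :: real
  assumes P: "finite (set_pmf P)" and F: "finite F" "F \<noteq> {}"
    and pr: "\<And>q. q \<in> F \<Longrightarrow> measure_pmf.prob P {x. A q x} = \<pi>" and \<pi>: "\<pi> > 0"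
    and corr: "\<And>r. r \<in> F \<Longrightarrow>
      (\<Sum>q\<in>F. measure_pmf.prob P {x. A q x \<and> A r x}) \<le> R * (card F * \<pi>\<^sup>2)"
  shows "1 \<le> R * measure_pmf.prob P {x. \<exists>q\<in>F. A q x}"
proof -
  let ?E = "measure_pmf.expectation P"
  have int: "integrable (measure_pmf P) h" for h :: "_ \<Rightarrow> real"
    by (intro integrable_measure_pmf_finite P)
  define X where "X x = (\<Sum>q\<in>F. of_bool (A q x) :: real)" for x
  define Z where "Z x = (of_bool (\<exists>q\<in>F. A q x) :: real)" for x
  define \<mu> where "\<mu> = card F * \<pi>"
  have \<mu>: "\<mu> > 0" using F \<pi> by (simp add: \<mu>_def card_gt_0_iff)
  have EX: "?E X = \<mu>"
    unfolding X_def by (subst Bochner_Integration.integral_sum)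
      (auto simp: int pr \<mu>_def simp flip: prob_eq_expectation_of_bool)
  have "?E (\<lambda>x. (X x)\<^sup>2) = (\<Sum>r\<in>F. \<Sum>q\<in>F. measure_pmf.prob P {x. A q x \<and> A r x})"
    unfolding X_def power2_eq_square sum_product
    by (subst sum.swap) (simp add: int prob_eq_expectation_of_bool of_bool_conj)
  also have "\<dots> \<le> (\<Sum>r\<in>F. R * (real (card F) * \<pi>\<^sup>2))" by (intro sum_mono corr)
  finally have EX2: "?E (\<lambda>x. (X x)\<^sup>2) \<le> R * \<mu>\<^sup>2" by (simp add: \<mu>_def power2_eq_square mult_ac)
  define z where "z = ?E Z"
  have Z: "X x * Z x = X x" "(Z x)\<^sup>2 = Z x" for x by (auto simp: X_def Z_def)
  have quad: "0 \<le> R * \<mu>\<^sup>2 - 2 * c * \<mu> + c\<^sup>2 * z" for c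
  proof -
    have sq: "(X x - c * Z x)\<^sup>2 = (X x)\<^sup>2 - 2 * c * X x + c\<^sup>2 * Z x" for x
    proof -
      have "(X x - c * Z x)\<^sup>2 = (X x)\<^sup>2 - 2 * c * (X x * Z x) + c\<^sup>2 * (Z x)\<^sup>2"
        by (simp add: power2_eq_square algebra_simps)
      then show ?thesis by (simp only: Z)
    qed
    have "0 \<le> ?E (\<lambda>x. (X x - c * Z x)\<^sup>2)" by simp
    also have "\<dots> = ?E (\<lambda>x. (X x)\<^sup>2 - 2 * c * X x + c\<^sup>2 * Z x)" by (simp only: sq)
    also have "\<dots> = ?E (\<lambda>x. (X x)\<^sup>2) - 2 * c * \<mu> + c\<^sup>2 * z"
      by (simp add: int EX z_def)
    finally show ?thesis using EX2 by simp
  qed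
  have "z > 0"
  proof (rule ccontr)
    assume "\<not> z > 0"
    moreover have "z \<ge> 0" by (simp add: z_def Z_def)
    ultimately have "z = 0" by simp
    \<comment> \<open>If \<open>z\<close> vanished, the quadratic in \<open>c\<close> would be
      linear, and at this \<open>c\<close> its value would be -1.\<close>
    with quad[of "(R * \<mu>\<^sup>2 + 1) / (2 * \<mu>)"] \<mu> show False by (simp add: field_simps)
  qed
  \<comment> \<open>The minimum of the quadratic is attained at \<open>\<mu> / z\<close>.\<close>
  with quad[of "\<mu> / z"] have "0 \<le> \<mu>\<^sup>2 * (R - 1 / z)"
    by (simp add: power2_eq_square field_simps)
  then have "1 / z \<le> R" using \<mu> by (simp add: zero_le_mult_iff)
  then show ?thesis
    using \<open>z > 0\<close> by (simp only: prob_eq_expectation_of_bool) (simp add: field_simps z_def flip: Z_def)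
qed

section \<open>The second moment\<close>

lemma path_edges_Nil [simp]: "path_edges [] = {}"
  and path_edges_single [simp]: "path_edges [x] = {}"
  by (auto simp: path_edges_def)

lemma path_edges_Cons_Cons [simp]:
  "path_edges (x # y # ys) = insert {x, y} (path_edges (y # ys))"
proof
  show "path_edges (x # y # ys) \<subseteq> insert {x, y} (path_edges (y # ys))"
  proof
    fix e assume "e \<in> path_edges (x # y # ys)"
    then obtain i where i: "e = {(x # y # ys) ! i, (x # y # ys) ! Suc i}" "Suc i < length (x # y # ys)"
      by (auto simp only: path_edges_def)
    show "e \<in> insert {x, y} (path_edges (y # ys))"
    proof (cases i)
      case 0
      then show ?thesis using i by simp
    next
      case (Suc j)
      then have "e = {(y # ys) ! j, (y # ys) ! Suc j}" "Suc j < length (y # ys)" using i by auto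
      then show ?thesis by (auto simp only: path_edges_def)
    qed
  qed
  have "{x, y} \<in> path_edges (x # y # ys)"
    unfolding path_edges_def by (intro CollectI exI[of _ 0]) simp
  moreover have "{(y # ys) ! i, (y # ys) ! Suc i} \<in> path_edges (x # y # ys)"
    if "Suc i < length (y # ys)" for i
    unfolding path_edges_def using that by (intro CollectI exI[of _ "Suc i"]) simp
  ultimately show "insert {x, y} (path_edges (y # ys)) \<subseteq> path_edges (x # y # ys)"
    by (auto simp: path_edges_def[of "y # ys"])
qed

lemma finite_path_edges [simp]: "finite (path_edges xs)"
  by (induction xs rule: induct_list012) auto

lemma path_edges_subset: "e \<in> path_edges xs \<Longrightarrow> e \<subseteq> set xs"
  by (auto simp: path_edges_def)

lemma card_of_path_edge: "distinct xs \<Longrightarrow> e \<in> path_edges xs \<Longrightarrow> card e = 2"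
  by (auto simp: path_edges_def card_insert_if nth_eq_iff_index_eq)

lemma Cons_edge_notin: "x \<notin> set ys \<Longrightarrow> {x, y} \<notin> path_edges ys"
  using path_edges_subset[of "{x, y}" ys] by auto

lemma card_path_edges: "distinct xs \<Longrightarrow> card (path_edges xs) = length xs - 1"
proof (induction xs rule: induct_list012)
  case (3 x y zs)
  then show ?case using Cons_edge_notin[of x "y # zs" y] by simp
qed auto

lemma card_path_neighbours_le:
  assumes "distinct xs"
  shows "card {x. {x, y} \<in> path_edges xs} \<le> 2"
proof (cases "y \<in> set xs")
  case True
  then obtain i where i: "i < length xs" "y = xs ! i" by (auto simp: in_set_conv_nth)
  have "{x. {x, y} \<in> path_edges xs} \<subseteq> {xs ! (i - 1), xs ! Suc i}"
  proof
    fix x assume "x \<in> {x. {x, y} \<in> path_edges xs}"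
    then obtain j where j: "{x, y} = {xs ! j, xs ! Suc j}" "Suc j < length xs"
      by (auto simp: path_edges_def)
    then consider "x = xs ! j" "y = xs ! Suc j" | "x = xs ! Suc j" "y = xs ! j"
      by (auto simp: doubleton_eq_iff)
    then show "x \<in> {xs ! (i - 1), xs ! Suc i}"
    proof cases
      case 1
      then have "i = Suc j" using i j assms by (simp add: nth_eq_iff_index_eq)
      then show ?thesis using 1 by simp
    next
      case 2
      then have "i = j" using i j assms by (simp add: nth_eq_iff_index_eq)
      then show ?thesis using 2 by simp
    qed
  qed
  then have "card {x. {x, y} \<in> path_edges xs} \<le> card {xs ! (i - 1), xs ! Suc i}"
    by (intro card_mono) auto
  also have "\<dots> \<le> 2" by (simp add: card_insert_if)
  finally show ?thesis .
next
  case False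
  then have "{x. {x, y} \<in> path_edges xs} = {}" using path_edges_subset by force
  then show ?thesis by simp
qed

definition pairs :: "'a set \<Rightarrow> 'a set set" where
  "pairs X = {e. e \<subseteq> X \<and> card e = 2}"

lemma finite_pairs [simp]: "finite X \<Longrightarrow> finite (pairs X)"
  unfolding pairs_def by (rule finite_subset[of _ "Pow X"]) auto

lemma card_pairs: "finite X \<Longrightarrow> card (pairs X) = card X choose 2"
  unfolding pairs_def by (rule n_subsets)

lemma pairs_Int: "pairs (X \<inter> Y) = pairs X \<inter> pairs Y"
  by (auto simp: pairs_def)

lemma path_edges_subset_pairs: "distinct xs \<Longrightarrow> path_edges xs \<subseteq> pairs (set xs)"
  using path_edges_subset card_of_path_edge by (fastforce simp: pairs_def)

definition induces :: "('a set \<Rightarrow> bool) \<Rightarrow> 'a list \<Rightarrow> bool" where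
  "induces \<omega> xs \<longleftrightarrow> (\<forall>e\<in>pairs (set xs). \<omega> e \<longleftrightarrow> e \<in> path_edges xs)"

text \<open>The joint weight of common vertices and common edges, read off along the list.
  Prepending a vertex multiplies it by a factor that depends only on that vertex and the old head,
  so the sum over all lists can be taken one vertex at a time.\<close>

fun overlap_weight :: "real \<Rightarrow> real \<Rightarrow> 'a set \<Rightarrow> 'a set set \<Rightarrow> 'a list \<Rightarrow> real" where
  "overlap_weight z p V E [] = 1"
| "overlap_weight z p V E (x # ys) = (if x \<in> V then z else 1) *
     (if ys \<noteq> [] \<and> {x, hd ys} \<in> E then 1 / p else 1) * overlap_weight z p V E ys"

lemma overlap_weight_eq:
  "distinct xs \<Longrightarrow>
    overlap_weight z p V E xs = z ^ card (set xs \<inter> V) * (1 / p) ^ card (path_edges xs \<inter> E)"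
proof (induction xs rule: induct_list012)
  case (3 x y zs)
  have "{x, y} \<notin> path_edges (y # zs)" using "3.prems" by (intro Cons_edge_notin) simp
  then have 1: "card (path_edges (x # y # zs) \<inter> E)
    = card (path_edges (y # zs) \<inter> E) + of_bool ({x, y} \<in> E)"
    by (simp add: Int_insert_left)
  have 2: "card (set (x # y # zs) \<inter> V) = card (set (y # zs) \<inter> V) + of_bool (x \<in> V)"
    using "3.prems" by (auto simp: Int_insert_left)
  have "overlap_weight z p V E (y # zs)
    = z ^ card (set (y # zs) \<inter> V) * (1 / p) ^ card (path_edges (y # zs) \<inter> E)"
    using "3.prems" by (intro "3.IH"(2)) simp
  then show ?case unfolding 1 2 by (subst overlap_weight.simps) (simp add: power_add)
qed auto

lemma overlap_weight_nonneg: "z \<ge> 0 \<Longrightarrow> p \<ge> 0 \<Longrightarrow> overlap_weight z p V E xs \<ge> 0"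
  by (induction xs) auto

section \<open>Lists that meet each block at most once, and the generating function of their
  overlap\<close>

locale blocks =
  fixes U :: "'a set" and blk :: "'a \<Rightarrow> nat" and B b :: nat
  assumes finite_U: "finite U"
    and blk_less: "x \<in> U \<Longrightarrow> blk x < B"
    and card_block: "j < B \<Longrightarrow> card {x \<in> U. blk x = j} = b"
    and b_pos: "b > 0"
begin

definition spread :: "nat \<Rightarrow> 'a list set" where
  "spread k = {xs. length xs = k \<and> set xs \<subseteq> U \<and> distinct (map blk xs)}"

definition avail :: "'a list \<Rightarrow> 'a set" where
  "avail ys = {x \<in> U. blk x \<notin> blk ` set ys}"

lemma finite_spread [simp]: "finite (spread k)"
  by (rule finite_subset[OF _ finite_lists_length_eq[OF finite_U, of k]]) (auto simp: spread_def)

lemma spread_0 [simp]: "spread 0 = {[]}"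
  by (auto simp: spread_def)

lemma distinct_spread: "xs \<in> spread k \<Longrightarrow> distinct xs"
  by (simp add: spread_def distinct_map)

lemma finite_avail [simp]: "finite (avail ys)"
  using finite_U by (simp add: avail_def)

lemma card_blk_image: "ys \<in> spread j \<Longrightarrow> card (blk ` set ys) = j"
  using distinct_card[of "map blk ys"] by (simp add: spread_def)

lemma blk_image_less: "ys \<in> spread j \<Longrightarrow> blk ` set ys \<subseteq> {..<B}"
  using blk_less by (auto simp: spread_def)

lemma card_free_blocks: "ys \<in> spread j \<Longrightarrow> card ({..<B} - blk ` set ys) = B - j"
  using blk_image_less by (subst card_Diff_subset) (auto simp: card_blk_image)

lemma card_avail:
  assumes "ys \<in> spread j"
  shows "card (avail ys) = (B - j) * b"
proof -
  have "avail ys = (\<Union>i\<in>{..<B} - blk ` set ys. {x \<in> U. blk x = i})"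
    using blk_less by (auto simp: avail_def)
  also have "card \<dots> = (\<Sum>i\<in>{..<B} - blk ` set ys. card {x \<in> U. blk x = i})"
    using finite_U by (intro card_UN_disjoint) auto
  also have "\<dots> = (\<Sum>i\<in>{..<B} - blk ` set ys. b)"
    by (intro sum.cong refl card_block) auto
  finally show ?thesis using card_free_blocks[OF assms] by simp
qed

text \<open>Since \<open>r\<close> also meets every block at most once, it has at most one vertex in
  each of the \<open>B - j\<close> free blocks. So at most a fraction 1/b of the possible next
  vertices lies on \<open>r\<close>, whatever was chosen before.\<close>

lemma card_avail_Int:
  assumes "ys \<in> spread j" "r \<in> spread k"
  shows "card (avail ys \<inter> set r) \<le> B - j"
proof -
  have inj: "inj_on blk (avail ys \<inter> set r)"
    using assms(2) by (auto simp: spread_def distinct_map intro: inj_on_subset)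
  have "blk ` (avail ys \<inter> set r) \<subseteq> {..<B} - blk ` set ys"
    using blk_less by (auto simp: avail_def)
  from card_inj_on_le[OF inj this] show ?thesis using card_free_blocks[OF assms(1)] by simp
qed

lemma spread_Suc: "spread (Suc j) = (\<lambda>(ys, x). x # ys) ` (SIGMA ys:spread j. avail ys)"
  by (fastforce simp: spread_def avail_def length_Suc_conv image_iff)

lemma sum_spread_Suc: "(\<Sum>xs\<in>spread (Suc j). f xs) = (\<Sum>ys\<in>spread j. \<Sum>x\<in>avail ys. f (x # ys))"
  unfolding spread_Suc
  by (subst sum.reindex) (auto simp: inj_on_def sum.Sigma case_prod_unfold)

lemma card_spread_Suc: "card (spread (Suc j)) = card (spread j) * ((B - j) * b)"
proof -
  have "card (spread (Suc j)) = (\<Sum>xs\<in>spread (Suc j). 1)" by simp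
  also have "\<dots> = (\<Sum>ys\<in>spread j. (B - j) * b)"
    unfolding sum_spread_Suc by (intro sum.cong refl) (simp add: card_avail)
  finally show ?thesis by simp
qed

lemma card_spread_pos: "k \<le> B \<Longrightarrow> card (spread k) > 0"
  using b_pos by (induction k) (auto simp: card_spread_Suc)

text \<open>The extra factor \<open>\<theta>\<close> for lists that start in \<open>r\<close> pays for the possibility that the next
  vertex prolongs a common segment; with it, no case distinction is needed in the induction.\<close>

lemma sum_overlap_weight_aux:
  fixes z p \<theta> :: real
  assumes r: "r \<in> spread k" and jk: "j \<le> k" "k \<le> B"
    and z: "z \<ge> 1" and p: "p > 0" and \<theta>: "\<theta> \<ge> 1" "2 * z * \<theta> / p \<le> (\<theta> - 1) * ((B - k) * b)"
  shows "(\<Sum>ys\<in>spread j. overlap_weight z p (set r) (path_edges r) ys *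
     (if ys \<noteq> [] \<and> hd ys \<in> set r then \<theta> else 1)) \<le> card (spread j) * (1 + (z * \<theta> - 1) / b) ^ j"
  using jk(1)
proof (induction j)
  case (Suc j)
  let ?w = "overlap_weight z p (set r) (path_edges r)"
  let ?h = "\<lambda>ys. if ys \<noteq> [] \<and> hd ys \<in> set r then \<theta> else 1"
  define N where "N = real ((B - j) * b)"
  define c where "c = 1 + (z * \<theta> - 1) / b"
  have z\<theta>: "z * \<theta> \<ge> 1" using mult_mono[of 1 z 1 \<theta>] z \<theta> by simp
  have c: "c \<ge> 1" using z\<theta> b_pos by (simp add: c_def)
  have step: "(\<Sum>x\<in>avail ys. ?w (x # ys) * ?h (x # ys)) \<le> (N * c) * (?w ys * ?h ys)"
    if ys: "ys \<in> spread j" for ys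
  proof -
    define link where "link x \<longleftrightarrow> ys \<noteq> [] \<and> {x, hd ys} \<in> path_edges r" for x
    have sumb: "(\<Sum>x\<in>avail ys. c * of_bool (Q x)) = c * card (avail ys \<inter> Collect Q)" for c :: real and Q
      by (simp add: Int_def flip: sum_distrib_left)
    have w: "?w ys \<ge> 0" by (rule overlap_weight_nonneg) (use z p in auto)
    have link_in: "x \<in> set r" "hd ys \<in> set r" if "link x" for x
      using that path_edges_subset[of "{x, hd ys}" r] by (auto simp: link_def)
    \<comment> \<open>A link puts \<open>x\<close> on \<open>r\<close>, so only the values 1,
      \<open>z * \<theta>\<close> and \<open>z * \<theta> / p\<close> occur.\<close>
    have "(if x \<in> set r then z else 1) * (if link x then 1 / p else 1) * ?h (x # ys)
       \<le> 1 + (z * \<theta> - 1) * of_bool (x \<in> set r) + z * \<theta> / p * of_bool (link x)" for x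
      using link_in[of x] p z\<theta> mult_nonneg_nonneg[of p "z * \<theta>"] by (auto simp: field_simps)
    then have "(\<Sum>x\<in>avail ys. (if x \<in> set r then z else 1) * (if link x then 1 / p else 1) * ?h (x # ys))
       \<le> (\<Sum>x\<in>avail ys. 1 + (z * \<theta> - 1) * of_bool (x \<in> set r) + z * \<theta> / p * of_bool (link x))"
      by (intro sum_mono)
    also have "\<dots> = N + (z * \<theta> - 1) * card (avail ys \<inter> set r) + z * \<theta> / p * card (avail ys \<inter> Collect link)"
      by (simp only: sum.distrib sumb) (simp add: card_avail[OF ys] N_def)
    \<comment> \<open>At most two vertices are neighbours of \<open>hd ys\<close> on the path
      \<open>r\<close>, so the links contribute at most \<open>2 * z * \<theta> / p\<close>. This
      occurs only if \<open>ys\<close> starts on \<open>r\<close>, and then the surplus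
      \<open>(\<theta> - 1) * N\<close> of its weight covers it.\<close>
    also have "\<dots> \<le> N + (z * \<theta> - 1) * (B - j) + (\<theta> - 1) * N * of_bool (ys \<noteq> [] \<and> hd ys \<in> set r)"
    proof (intro add_mono order_refl)
      show "(z * \<theta> - 1) * card (avail ys \<inter> set r) \<le> (z * \<theta> - 1) * (B - j)"
        using z\<theta> card_avail_Int[OF ys r] by (intro mult_left_mono) auto
      show "z * \<theta> / p * card (avail ys \<inter> Collect link) \<le> (\<theta> - 1) * N * of_bool (ys \<noteq> [] \<and> hd ys \<in> set r)"
      proof (cases "ys \<noteq> [] \<and> hd ys \<in> set r")
        case True
        have sub: "Collect link \<subseteq> {x. {x, hd ys} \<in> path_edges r}" by (auto simp: link_def)
        have "{x. {x, hd ys} \<in> path_edges r} \<subseteq> set r" using path_edges_subset[of _ r] by auto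
        then have "finite {x. {x, hd ys} \<in> path_edges r}" by (rule finite_subset) simp
        with sub have "card (avail ys \<inter> Collect link) \<le> card {x. {x, hd ys} \<in> path_edges r}"
          by (intro card_mono) auto
        also have "\<dots> \<le> 2" by (rule card_path_neighbours_le) (use distinct_spread[OF r] in simp)
        finally have "z * \<theta> / p * card (avail ys \<inter> Collect link) \<le> z * \<theta> / p * 2"
          using z\<theta> p by (intro mult_left_mono) auto
        also have "\<dots> \<le> (\<theta> - 1) * ((B - k) * b)" using \<theta>(2) by (simp add: mult_ac)
        also have "\<dots> \<le> (\<theta> - 1) * N"
          unfolding N_def using \<theta> Suc.prems by (intro mult_left_mono of_nat_mono mult_right_mono) auto
        finally show ?thesis using True by simp
      next
        case False
        then have "Collect link = {}" using link_in(2) by (auto simp: link_def)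
        then show ?thesis using False unfolding \<open>Collect link = {}\<close> by auto
      qed
    qed
    also have "N + (z * \<theta> - 1) * (B - j) = N * c"
    proof -
      have "N = n * b" if "n = real (B - j)" for n using that by (simp add: N_def)
      then show ?thesis using b_pos by (simp add: c_def distrib_left)
    qed
    \<comment> \<open>Giving away the factor \<open>c \<ge> 1\<close> makes the bound a multiple of
      the weight of \<open>ys\<close>, which is what the induction needs.\<close>
    also have "(\<theta> - 1) * N * of_bool (ys \<noteq> [] \<and> hd ys \<in> set r) \<le> (\<theta> - 1) * (N * c) * of_bool (ys \<noteq> [] \<and> hd ys \<in> set r)"
      using mult_left_mono[OF c, of "(\<theta> - 1) * N"] \<theta>(1) by (simp add: N_def mult_ac)
    finally have "(\<Sum>x\<in>avail ys. (if x \<in> set r then z else 1) * (if link x then 1 / p else 1) * ?h (x # ys))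
      \<le> N * c + (\<theta> - 1) * (N * c) * of_bool (ys \<noteq> [] \<and> hd ys \<in> set r)" by simp
    also have "\<dots> = N * c * ?h ys" by (simp add: algebra_simps)
    finally have "?w ys * (\<Sum>x\<in>avail ys. (if x \<in> set r then z else 1) * (if link x then 1 / p else 1) * ?h (x # ys))
      \<le> ?w ys * (N * c * ?h ys)" using w by (rule mult_left_mono)
    moreover have "(\<Sum>x\<in>avail ys. ?w (x # ys) * ?h (x # ys))
      = ?w ys * (\<Sum>x\<in>avail ys. (if x \<in> set r then z else 1) * (if link x then 1 / p else 1) * ?h (x # ys))"
      unfolding sum_distrib_left by (intro sum.cong refl) (simp add: link_def)
    ultimately show ?thesis by (simp only: mult_ac)
  qed
  have "(\<Sum>xs\<in>spread (Suc j). ?w xs * ?h xs) \<le> (\<Sum>ys\<in>spread j. (N * c) * (?w ys * ?h ys))"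
    unfolding sum_spread_Suc by (intro sum_mono step)
  also have "\<dots> = N * c * (\<Sum>ys\<in>spread j. ?w ys * ?h ys)" by (simp only: sum_distrib_left)
  also have "\<dots> \<le> N * c * (card (spread j) * c ^ j)"
    using Suc c by (intro mult_left_mono) (auto simp: c_def N_def)
  also have "\<dots> = card (spread (Suc j)) * c ^ Suc j"
    by (simp add: card_spread_Suc N_def mult_ac)
  finally show ?case unfolding c_def .
qed simp

lemma sum_overlap_weight:
  fixes z p \<theta> :: real
  assumes r: "r \<in> spread k" and k: "k \<le> B"
    and z: "z \<ge> 1" and p: "p > 0" and \<theta>: "\<theta> \<ge> 1" "2 * z * \<theta> / p \<le> (\<theta> - 1) * ((B - k) * b)"
  shows "(\<Sum>q\<in>spread k. z ^ card (set q \<inter> set r) * (1 / p) ^ card (path_edges q \<inter> path_edges r))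
    \<le> card (spread k) * exp (k * (z * \<theta> - 1) / b)"
proof -
  have z\<theta>: "z * \<theta> \<ge> 1" using mult_mono[of 1 z 1 \<theta>] z \<theta> by simp
  have "(\<Sum>q\<in>spread k. z ^ card (set q \<inter> set r) * (1 / p) ^ card (path_edges q \<inter> path_edges r))
    \<le> (\<Sum>q\<in>spread k. overlap_weight z p (set r) (path_edges r) q *
     (if q \<noteq> [] \<and> hd q \<in> set r then \<theta> else 1))"
  proof (intro sum_mono)
    fix q assume q: "q \<in> spread k"
    have w: "overlap_weight z p (set r) (path_edges r) q \<ge> 0"
      by (rule overlap_weight_nonneg) (use z p in auto)
    then show "z ^ card (set q \<inter> set r) * (1 / p) ^ card (path_edges q \<inter> path_edges r)
      \<le> overlap_weight z p (set r) (path_edges r) q * (if q \<noteq> [] \<and> hd q \<in> set r then \<theta> else 1)"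
      using mult_left_mono[OF \<theta>(1) w] by (simp add: overlap_weight_eq[OF distinct_spread[OF q]])
  qed
  also have "\<dots> \<le> card (spread k) * (1 + (z * \<theta> - 1) / b) ^ k"
    by (rule sum_overlap_weight_aux) (use assms in auto)
  also have "\<dots> \<le> card (spread k) * exp ((z * \<theta> - 1) / b) ^ k"
    using z\<theta> by (intro mult_left_mono power_mono exp_ge_add_one_self) auto
  finally show ?thesis by (simp add: exp_of_nat_mult[symmetric])
qed

end

lemma prob_induces:
  assumes "finite I" "pairs (set q) \<subseteq> I" "distinct q" "0 \<le> p" "p \<le> 1"
  shows "measure_pmf.prob (Pi_pmf I False (\<lambda>_. bernoulli_pmf p)) {\<omega>. induces \<omega> q}
    = p ^ (length q - 1) * (1 - p) ^ ((length q choose 2) - (length q - 1))"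
  unfolding induces_def using assms path_edges_subset_pairs[OF assms(3)]
  by (subst prob_pattern) (auto simp: card_path_edges card_pairs distinct_card)

text \<open>If the two requirements contradict each other, the probability is 0. Otherwise they
  prescribe one pattern on the union of the pairs, and inclusion-exclusion counts it: each common
  edge saves a factor \<open>p\<close>, and each common non-edge a factor \<open>1 - p\<close>. The
  common non-edges are overestimated by all pairs inside the common vertex set.\<close>

lemma prob_induces_both:
  fixes p :: real
  assumes I: "finite I" "pairs (set q) \<subseteq> I" "pairs (set r) \<subseteq> I"
    and d: "distinct q" "distinct r" "length q = k" "length r = k"
    and p: "0 < p" "p < 1"
  defines "P \<equiv> Pi_pmf I False (\<lambda>_. bernoulli_pmf p)"
  shows "measure_pmf.prob P {\<omega>. induces \<omega> q \<and> induces \<omega> r} \<le>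
    (p ^ (k - 1) * (1 - p) ^ ((k choose 2) - (k - 1)))\<^sup>2 *
    ((1 / p) ^ card (path_edges q \<inter> path_edges r) * (1 / (1 - p)) ^ (card (set q \<inter> set r) choose 2))"
proof (cases "\<exists>\<omega>. induces \<omega> q \<and> induces \<omega> r")
  case False
  then have "{\<omega>. induces \<omega> q \<and> induces \<omega> r} = {}" by auto
  show ?thesis using p unfolding \<open>_ = {}\<close> by simp
next
  case True
  then obtain \<omega>0 where \<omega>0: "induces \<omega>0 q" "induces \<omega>0 r" by auto
  define A where "A = pairs (set q) \<union> pairs (set r)"
  define H where "H = path_edges q \<union> path_edges r"
  define e where "e = card (path_edges q \<inter> path_edges r)"
  define l where "l = card (set q \<inter> set r) choose 2"
  have pe: "path_edges q \<subseteq> pairs (set q)" "path_edges r \<subseteq> pairs (set r)"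
    using d path_edges_subset_pairs by auto
  have HA: "H \<subseteq> A" using pe by (auto simp: H_def A_def)
  have ev: "{\<omega>. induces \<omega> q \<and> induces \<omega> r} = {\<omega>. \<forall>e\<in>A. \<omega> e \<longleftrightarrow> e \<in> H}"
    using \<omega>0 pe unfolding induces_def A_def H_def by blast
  have cH: "card H + e = 2 * (k - 1)"
    using card_Un_Int[of "path_edges q" "path_edges r"] d
    by (simp add: H_def e_def card_path_edges)
  have cA: "card A + l = 2 * (k choose 2)"
    using card_Un_Int[of "pairs (set q)" "pairs (set r)"] d
    by (simp add: A_def l_def card_pairs distinct_card flip: pairs_Int)
  have le: "k - 1 \<le> k choose 2"
    using card_mono[OF _ pe(1)] d by (simp add: card_pairs distinct_card card_path_edges)
  have HA': "card H \<le> card A" using HA by (intro card_mono) (auto simp: A_def)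
  have "measure_pmf.prob P {\<omega>. induces \<omega> q \<and> induces \<omega> r}
     = p ^ card H * (1 - p) ^ (card A - card H)"
    unfolding ev P_def by (rule prob_pattern) (use I HA p in \<open>auto simp: A_def\<close>)
  moreover have "p ^ card H = (p ^ (k - 1))\<^sup>2 * (1 / p) ^ e"
    using cH p by (simp add: power_mult[symmetric] mult.commute power_add[symmetric] field_simps power_one_over)
  moreover have "(1 - p) ^ (card A - card H) \<le> ((1 - p) ^ ((k choose 2) - (k - 1)))\<^sup>2 * (1 / (1 - p)) ^ l"
  proof -
    have "(card A - card H) + l \<ge> 2 * ((k choose 2) - (k - 1))" using cH cA le HA' by simp
    then have "(1 - p) ^ (card A - card H + l) \<le> (1 - p) ^ (2 * ((k choose 2) - (k - 1)))"
      using p by (intro power_decreasing) auto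
    then show ?thesis using p
      by (simp add: power_mult[symmetric] mult.commute power_add field_simps power_one_over)
  qed
  ultimately have "measure_pmf.prob P {\<omega>. induces \<omega> q \<and> induces \<omega> r}
    \<le> ((p ^ (k - 1))\<^sup>2 * (1 / p) ^ e) * (((1 - p) ^ ((k choose 2) - (k - 1)))\<^sup>2 * (1 / (1 - p)) ^ l)"
    using p by (simp only:) (intro mult_left_mono, auto)
  then show ?thesis by (simp add: e_def l_def power_mult_distrib mult_ac)
qed

context blocks
begin

text \<open>Overlaps of at most \<open>m\<close> vertices are bounded by the worst case among them. For larger
  overlaps \<open>l\<close>, Markov's inequality is applied to the generating function of the overlap size
  at a point \<open>z l\<close> of our choice.\<close>

lemma second_moment_paths:
  fixes p :: real and z \<theta> :: "nat \<Rightarrow> real" and m :: nat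
  assumes I: "finite I" "pairs U \<subseteq> I" and p: "0 < p" "p < 1" and k: "k \<le> B"
    and z: "\<And>l. z l \<ge> 1" "z 0 = 1"
    and \<theta>: "\<And>l. l \<le> k \<Longrightarrow> \<theta> l \<ge> 1" "\<And>l. l \<le> k \<Longrightarrow> 2 * z l * \<theta> l / p \<le> (\<theta> l - 1) * ((B - k) * b)"
  defines "P \<equiv> Pi_pmf I False (\<lambda>_. bernoulli_pmf p)"
    and "R \<equiv> (1 / (1 - p)) ^ (m choose 2) * exp (k * (\<theta> 0 - 1) / b) +
      (\<Sum>l\<in>{m<..k}. (1 / (1 - p)) ^ (l choose 2) * (1 / z l) ^ l * exp (k * (z l * \<theta> l - 1) / b))"
  shows "1 \<le> R * measure_pmf.prob P {\<omega>. \<exists>q\<in>spread k. induces \<omega> q}"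
proof (rule second_moment)
  show "finite (set_pmf P)" unfolding P_def by (rule finite_set_Pi_pmf) fact
  show "spread k \<noteq> {}" using card_spread_pos[OF k] by auto
  define \<pi> where "\<pi> = p ^ (k - 1) * (1 - p) ^ ((k choose 2) - (k - 1))"
  show "\<pi> > 0" using p by (simp add: \<pi>_def)
  have sub: "pairs (set q) \<subseteq> I" if "q \<in> spread k" for q
    using that I(2) by (auto simp: spread_def pairs_def)
  show "measure_pmf.prob P {\<omega>. induces \<omega> q} = \<pi>" if "q \<in> spread k" for q
    using that sub[OF that] p I distinct_spread[OF that] unfolding P_def \<pi>_def
    by (subst prob_induces) (auto simp: spread_def)
  fix r assume r: "r \<in> spread k"
  define c where "c l = (1 / (1 - p)) ^ (l choose 2)" for l
  define g where "g q = (1 / p) ^ card (path_edges q \<inter> path_edges r)" for q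
  define L where "L q = card (set q \<inter> set r)" for q
  have c0: "c l \<ge> 0" for l using p by (simp add: c_def)
  have g0: "g q \<ge> 0" for q using p by (simp add: g_def)
  have L: "L q \<le> k" if "q \<in> spread k" for q
    using that card_length[of q] card_mono[of "set q" "set q \<inter> set r"] by (simp add: L_def spread_def)
  have cmono: "c l \<le> c m" if "l \<le> m" for l
    unfolding c_def using p that
    by (intro power_increasing) (auto simp: field_simps choose_two intro!: div_le_mono mult_le_mono)
  have z0: "z l > 0" for l using z(1)[of l] by simp
  have le: "g q * c (L q) \<le> c m * g q + (\<Sum>l\<in>{m<..k}. c l * (1 / z l) ^ l * (z l ^ L q * g q))"
    if "q \<in> spread k" for q
  proof (cases "L q \<le> m")
    case True
    have "0 \<le> (\<Sum>l\<in>{m<..k}. c l * (1 / z l) ^ l * (z l ^ L q * g q))"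
      by (intro sum_nonneg mult_nonneg_nonneg c0 g0) (use z0 in \<open>auto simp: less_imp_le\<close>)
    moreover have "g q * c (L q) \<le> c m * g q" using cmono[OF True] g0[of q] by (metis mult.commute mult_left_mono)
    ultimately show ?thesis by linarith
  next
    case False
    \<comment> \<open>Of the sum over \<open>l\<close>, only the summand at the true overlap
      \<open>L q\<close> is used for this \<open>q\<close>; the weight 1 is rewritten with the point
      \<open>z\<close> belonging to that overlap.\<close>
    have "g q * c (L q) = c (L q) * (1 / z (L q)) ^ L q * (z (L q) ^ L q * g q)"
      using z0[of "L q"] by (simp add: power_one_over field_simps)
    also have "\<dots> \<le> (\<Sum>l\<in>{m<..k}. c l * (1 / z l) ^ l * (z l ^ L q * g q))"
      by (rule member_le_sum)
        (use False L[OF that] in \<open>auto intro!: mult_nonneg_nonneg c0 g0 simp: less_imp_le[OF z0]\<close>)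
    finally show ?thesis using c0[of m] g0[of q] by (simp add: add_increasing)
  qed
  have sum: "(\<Sum>q\<in>spread k. z l ^ L q * g q) \<le> card (spread k) * exp (k * (z l * \<theta> l - 1) / b)"
    if "l \<le> k" for l
    unfolding L_def g_def by (rule sum_overlap_weight) (use r k z \<theta> p that in auto)
  have "(\<Sum>q\<in>spread k. g q * c (L q)) \<le>
     (\<Sum>q\<in>spread k. c m * g q + (\<Sum>l\<in>{m<..k}. c l * (1 / z l) ^ l * (z l ^ L q * g q)))"
    by (intro sum_mono le)
  also have "\<dots> = c m * (\<Sum>q\<in>spread k. z 0 ^ L q * g q) +
     (\<Sum>l\<in>{m<..k}. c l * (1 / z l) ^ l * (\<Sum>q\<in>spread k. z l ^ L q * g q))"
    by (subst sum.distrib, subst sum.swap) (simp add: sum_distrib_left z(2))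
  also have "\<dots> \<le> c m * (card (spread k) * exp (k * (z 0 * \<theta> 0 - 1) / b)) +
     (\<Sum>l\<in>{m<..k}. c l * (1 / z l) ^ l * (card (spread k) * exp (k * (z l * \<theta> l - 1) / b)))"
    by (intro add_mono mult_left_mono sum_mono sum mult_nonneg_nonneg c0)
      (auto simp: less_imp_le[OF z0])
  also have "\<dots> = R * card (spread k)"
    by (simp add: R_def c_def z(2) distrib_right distrib_left sum_distrib_right sum_distrib_left mult_ac)
  finally have key: "(\<Sum>q\<in>spread k. g q * c (L q)) \<le> R * card (spread k)" .
  have "(\<Sum>q\<in>spread k. measure_pmf.prob P {\<omega>. induces \<omega> q \<and> induces \<omega> r})
    \<le> (\<Sum>q\<in>spread k. \<pi>\<^sup>2 * (g q * c (L q)))"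
  proof (intro sum_mono)
    fix q assume q: "q \<in> spread k"
    show "measure_pmf.prob P {\<omega>. induces \<omega> q \<and> induces \<omega> r} \<le> \<pi>\<^sup>2 * (g q * c (L q))"
      unfolding P_def \<pi>_def g_def c_def L_def
      by (rule prob_induces_both) (use q r sub I p distinct_spread in \<open>auto simp: spread_def\<close>)
  qed
  also have "\<dots> = \<pi>\<^sup>2 * (\<Sum>q\<in>spread k. g q * c (L q))" by (simp add: sum_distrib_left)
  also have "\<dots> \<le> \<pi>\<^sup>2 * (R * card (spread k))" by (intro mult_left_mono key) simp
  finally show "(\<Sum>q\<in>spread k. measure_pmf.prob P {\<omega>. induces \<omega> q \<and> induces \<omega> r})
      \<le> R * (card (spread k) * \<pi>\<^sup>2)"
    by (simp only: mult_ac)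
qed simp

end

section \<open>Depth-first search for a long chain of pieces\<close>

text \<open>The newest piece and the newest connector come first, and \<open>w\<close> leads from
  the older piece \<open>i\<close> to the newer piece \<open>j\<close>; a nonempty chain has one
  connector less than pieces. A connector is compared with all older connectors, so they form an
  independent set when \<open>adj\<close> is symmetric.\<close>

fun valid_chain :: "('i \<Rightarrow> 'a \<Rightarrow> 'i \<Rightarrow> bool) \<Rightarrow> ('a \<Rightarrow> 'a \<Rightarrow> bool) \<Rightarrow> 'i list \<Rightarrow> 'a list \<Rightarrow> bool" where
  "valid_chain conn adj (j # i # js) (w # ws) \<longleftrightarrow>
     conn i w j \<and> w \<notin> set ws \<and> (\<forall>c\<in>set ws. \<not> adj w c) \<and> valid_chain conn adj (i # js) ws"
| "valid_chain conn adj [i] [] \<longleftrightarrow> True"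
| "valid_chain conn adj [] [] \<longleftrightarrow> True"
| "valid_chain conn adj _ _ \<longleftrightarrow> False"

lemma valid_chain_tl: "valid_chain conn adj (i # js) ws \<Longrightarrow> valid_chain conn adj js (tl ws)"
  by (cases "(conn, adj, i # js, ws)" rule: valid_chain.cases) auto

text \<open>\<open>D\<close> holds the abandoned pieces, \<open>js\<close> and \<open>ws\<close> the
  current stack, \<open>T\<close> the untouched pieces and \<open>C\<close> every connector ever
  used. Each new connector removes a piece from \<open>T\<close>, so \<open>card C + card T\<close>
  cannot grow; this keeps the number of possible sets \<open>C\<close> small for the union bound.
  The last clause persists because \<open>T\<close> only shrinks and \<open>C\<close> only
  grows.\<close>

definition dfs_state ::
  "('i \<Rightarrow> 'a \<Rightarrow> 'i \<Rightarrow> bool) \<Rightarrow> ('a \<Rightarrow> 'a \<Rightarrow> bool) \<Rightarrow> 'i set \<Rightarrow> 'a set \<Rightarrow>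
    'i set \<Rightarrow> 'i list \<Rightarrow> 'a list \<Rightarrow> 'i set \<Rightarrow> 'a set \<Rightarrow> bool" where
  "dfs_state conn adj M W D js ws T C \<longleftrightarrow>
     valid_chain conn adj js ws \<and> set ws \<subseteq> C \<and> C \<subseteq> W \<and> finite C \<and> distinct js \<and>
     D \<union> set js \<union> T = M \<and> D \<inter> set js = {} \<and> D \<inter> T = {} \<and> set js \<inter> T = {} \<and>
     card C + card T \<le> card M \<and>
     (\<forall>i\<in>D. \<forall>j\<in>T. \<forall>w\<in>W - C. conn i w j \<longrightarrow> (\<exists>c\<in>C. adj w c))"

text \<open>The moves are: open a new stack, push a piece, or abandon the top piece. Each lowers the
  difference of \<open>card T\<close> and \<open>card D\<close> by exactly one, so the search cannot
  jump over the balanced state.\<close>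

lemma dfs_step:
  assumes st: "dfs_state conn adj M W D js ws T C" and M: "finite M" and less: "card D < card T"
  shows "\<exists>D' js' ws' T' C'. dfs_state conn adj M W D' js' ws' T' C' \<and> card D' \<le> card T' \<and>
    card T' - card D' < card T - card D"
proof -
  have fin: "finite D" "finite T" using st M finite_subset[of _ M] by (auto simp: dfs_state_def)
  have ne: "T \<noteq> {}" using less by auto
  show ?thesis
  proof (cases js)
    case Nil
    obtain t where t: "t \<in> T" using ne by auto
    have "ws = []" using st Nil by (cases ws) (auto simp: dfs_state_def)
    then have "dfs_state conn adj M W D [t] [] (T - {t}) C"
      using st t fin Nil unfolding dfs_state_def by (auto simp: card_Diff_singleton)
    moreover have "card (T - {t}) = card T - 1" using t fin by simp
    ultimately show ?thesis using less
      by (intro exI[of _ D] exI[of _ "[t]"] exI[of _ "[]"] exI[of _ "T - {t}"] exI[of _ C]) auto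
  next
    case (Cons i rest)
    show ?thesis
    proof (cases "\<exists>j\<in>T. \<exists>w\<in>W - C. conn i w j \<and> (\<forall>c\<in>C. \<not> adj w c)")
      case True
      then obtain j w where jw: "j \<in> T" "w \<in> W - C" "conn i w j" "\<forall>c\<in>C. \<not> adj w c" by auto
      have "card (insert w C) = Suc (card C)" "card (T - {j}) = card T - 1" "card T > 0"
        using jw st fin ne by (auto simp: dfs_state_def card_gt_0_iff)
      then have "dfs_state conn adj M W D (j # js) (w # ws) (T - {j}) (insert w C)"
        using st jw Cons unfolding dfs_state_def by auto
      moreover have "card (T - {j}) = card T - 1" using jw fin by simp
      ultimately show ?thesis using less
        by (intro exI[of _ D] exI[of _ "j # js"] exI[of _ "w # ws"] exI[of _ "T - {j}"]
            exI[of _ "insert w C"]) auto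
    next
      case False
      have "set (tl ws) \<subseteq> C" using st list.set_sel(2)[of ws] by (cases ws) (auto simp: dfs_state_def)
      then have "dfs_state conn adj M W (insert i D) rest (tl ws) T C"
        using st Cons False valid_chain_tl[of conn adj i rest ws] unfolding dfs_state_def by auto
      moreover have "card (insert i D) = Suc (card D)"
        using st Cons fin by (auto simp: dfs_state_def)
      ultimately show ?thesis using less
        by (intro exI[of _ "insert i D"] exI[of _ rest] exI[of _ "tl ws"] exI[of _ T] exI[of _ C]) auto
    qed
  qed
qed

lemma dfs_balanced:
  assumes "dfs_state conn adj M W D js ws T C" "finite M" "card D \<le> card T"
  shows "\<exists>D' js' ws' T' C'. dfs_state conn adj M W D' js' ws' T' C' \<and> card D' = card T'"
  using assms
proof (induction "card T - card D" arbitrary: D js ws T C rule: less_induct)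
  case less
  show ?case
  proof (cases "card D = card T")
    case True
    then show ?thesis using less.prems by blast
  next
    case False
    then have "card D < card T" using less.prems by simp
    from dfs_step[OF less.prems(1,2) this] less.hyps less.prems(2) show ?thesis by blast
  qed
qed

text \<open>Depth-first search, where a fresh connector has to avoid all connectors ever used, including
  those of abandoned branches. When as many pieces are finished as are untouched, no connector
  leads from a finished to an untouched piece, so there are few of either.\<close>

lemma long_chain_exists:
  assumes M: "finite M"
    and H: "\<And>S T C. \<lbrakk>S \<subseteq> M; T \<subseteq> M; S \<inter> T = {}; card S = s; card T = s; C \<subseteq> W; finite C; card C \<le> card M\<rbrakk>
      \<Longrightarrow> \<exists>i\<in>S. \<exists>j\<in>T. \<exists>w\<in>W - C. conn i w j \<and> (\<forall>c\<in>C. \<not> adj w c)"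
  shows "\<exists>js ws. valid_chain conn adj js ws \<and> distinct js \<and> set js \<subseteq> M \<and> set ws \<subseteq> W \<and>
    card M \<le> length js + 2 * s"
proof -
  have "dfs_state conn adj M W {} [] [] M {}" by (auto simp: dfs_state_def)
  from dfs_balanced[OF this M] obtain D js ws T C
    where st: "dfs_state conn adj M W D js ws T C" and eq: "card D = card T" by auto
  have fin: "finite D" "finite T" using st M finite_subset[of _ M] by (auto simp: dfs_state_def)
  have "card D \<le> s"
  proof (rule ccontr)
    assume "\<not> card D \<le> s"
    then have "s \<le> card D" "s \<le> card T" using eq by auto
    then obtain S' T' where "S' \<subseteq> D" "card S' = s" "T' \<subseteq> T" "card T' = s"
      by (meson obtain_subset_with_card_n)
    moreover have "card C \<le> card M" using st by (simp add: dfs_state_def)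
    ultimately have "\<exists>i\<in>S'. \<exists>j\<in>T'. \<exists>w\<in>W - C. conn i w j \<and> (\<forall>c\<in>C. \<not> adj w c)"
      using st by (intro H) (auto simp: dfs_state_def)
    then show False using st \<open>S' \<subseteq> D\<close> \<open>T' \<subseteq> T\<close> unfolding dfs_state_def by blast
  qed
  moreover have "card M = card D + length js + card T"
  proof -
    have "M = (D \<union> set js) \<union> T" using st by (simp add: dfs_state_def)
    then have "card M = card (D \<union> set js) + card T"
      using st fin by (simp only:) (rule card_Un_disjoint, auto simp: dfs_state_def)
    also have "card (D \<union> set js) = card D + length js"
      using st fin by (subst card_Un_disjoint) (auto simp: dfs_state_def distinct_card)
    finally show ?thesis .
  qed
  ultimately have "card M \<le> length js + 2 * s" using eq by simp
  then show ?thesis using st by (intro exI[of _ js] exI[of _ ws]) (auto simp: dfs_state_def)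
qed

section \<open>Assembling a chain of pieces into one induced path\<close>

fun induced_list :: "('a \<Rightarrow> 'a \<Rightarrow> bool) \<Rightarrow> 'a list \<Rightarrow> bool" where
  "induced_list adj [] \<longleftrightarrow> True"
| "induced_list adj (x # xs) \<longleftrightarrow> x \<notin> set xs \<and> (\<forall>v\<in>set xs. adj x v \<longleftrightarrow> v = hd xs) \<and> induced_list adj xs"

text \<open>\<open>induced_list\<close> compares the head with the later vertices only, which fits a
  path that grows at its head. As the edges have two elements, every edge that contains the head
  arises from such a comparison.\<close>

lemma induced_list_path_edges:
  assumes "\<And>e. e \<in> E \<Longrightarrow> card e = 2" "induced_list (\<lambda>x y. {x, y} \<in> E) xs"
  shows "distinct xs \<and> {e \<in> E. e \<subseteq> set xs} = path_edges xs"
  using assms(2)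
proof (induction xs rule: induct_list012)
  case 1
  then show ?case using assms(1) by fastforce
next
  case (2 x)
  have "\<not> e \<subseteq> {x}" if "e \<in> E" for e
    using assms(1)[OF that] card_mono[of "{x}" e] by auto
  then show ?case by auto
next
  case (3 x y zs)
  let ?ys = "y # zs"
  have IH: "distinct ?ys" "{e \<in> E. e \<subseteq> set ?ys} = path_edges ?ys" using "3.IH"(2) "3.prems" by auto
  have x: "x \<notin> set ?ys" "\<And>v. v \<in> set ?ys \<Longrightarrow> {x, v} \<in> E \<longleftrightarrow> v = y" using "3.prems" by auto
  have "{e \<in> E. e \<subseteq> set (x # ?ys)} = insert {x, y} {e \<in> E. e \<subseteq> set ?ys}"
  proof (intro equalityI subsetI)
    fix e assume e: "e \<in> {e \<in> E. e \<subseteq> set (x # ?ys)}"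
    show "e \<in> insert {x, y} {e \<in> E. e \<subseteq> set ?ys}"
    proof (cases "x \<in> e")
      case True
      obtain u v where "e = {u, v}" "u \<noteq> v" using assms(1) e by (metis (lifting) card_2_iff mem_Collect_eq)
      then obtain v where v: "e = {x, v}" "v \<noteq> x" using True by (metis insert_commute insertE singletonD)
      then have "v \<in> set ?ys" using e by auto
      then show ?thesis using x(2)[of v] e v by auto
    qed (use e in auto)
  next
    fix e assume "e \<in> insert {x, y} {e \<in> E. e \<subseteq> set ?ys}"
    then show "e \<in> {e \<in> E. e \<subseteq> set (x # ?ys)}" using x(2)[of y] by auto
  qed
  then show ?case using IH x by simp
qed

text \<open>\<open>P i a\<close> is the vertex at position \<open>a\<close> of piece
  \<open>i\<close>, and \<open>W\<close> is the reservoir of connectors. The first \<open>g\<close>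
  positions of a piece serve as its entrance, the last \<open>g\<close> as its exit;
  \<open>2 * g \<le> L\<close> puts the entrance before the exit.\<close>

locale linear_pieces =
  fixes adj :: "'a \<Rightarrow> 'a \<Rightarrow> bool" and P :: "'i \<Rightarrow> nat \<Rightarrow> 'a" and M :: "'i set" and W :: "'a set"
    and L g :: nat
  assumes adj_sym: "adj x y \<Longrightarrow> adj y x"
    and inj: "\<lbrakk>i \<in> M; j \<in> M; a < L; b < L; P i a = P j b\<rbrakk> \<Longrightarrow> i = j \<and> a = b"
    and adj_P: "\<lbrakk>i \<in> M; j \<in> M; a < L; b < L\<rbrakk> \<Longrightarrow>
      adj (P i a) (P j b) \<longleftrightarrow> i = j \<and> (a = Suc b \<or> b = Suc a)"
    and P_notin_W: "\<lbrakk>i \<in> M; a < L\<rbrakk> \<Longrightarrow> P i a \<notin> W"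
    and g: "2 * g \<le> L"
begin

definition F :: "'a set" where "F = {P i a | i a. i \<in> M \<and> a < L}"

text \<open>The connector must avoid all of \<open>F\<close>, including vertices that the final path
  skips and pieces outside the chain; so its status does not depend on the course of the search.
  Allowing \<open>g\<close> positions at either end gives about g^2 possibilities for a pair of
  pieces.\<close>

definition conn :: "'i \<Rightarrow> 'a \<Rightarrow> 'i \<Rightarrow> bool" where
  "conn i w j \<longleftrightarrow> (\<exists>a b. L - g \<le> a \<and> a < L \<and> b < g \<and>
     (\<forall>u\<in>F. adj w u \<longleftrightarrow> u = P i a \<or> u = P j b))"

text \<open>The path constructed so far stops at the entrance \<open>P (hd js) b\<close> of the
  newest piece, since the exit is known only once the next connector is. Hence only
  \<open>tl js\<close> counts towards the length, with \<open>L - 2 * g\<close> for each piece. The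
  last conclusion is needed for the induction: older connectors have no neighbours on the part of
  the newest piece that is still to be traversed.\<close>

lemma chain_to_path:
  assumes "valid_chain conn adj js ws" "js \<noteq> []" "distinct js" "set js \<subseteq> M" "set ws \<subseteq> W" "g > 0"
  shows "\<exists>vs b. induced_list adj vs \<and> vs \<noteq> [] \<and> b < g \<and> hd vs = P (hd js) b \<and>
     set vs \<subseteq> {P (hd js) b} \<union> {P i a | i a. i \<in> set (tl js) \<and> a < L} \<union> set ws \<and>
     length (tl js) * (L - 2 * g) + 1 \<le> length vs \<and>
     (\<forall>w\<in>set ws. \<forall>u\<in>F. adj w u \<longrightarrow> u \<in> {P (hd js) b} \<union> {P i a | i a. i \<in> set (tl js) \<and> a < L})"
  using assms
proof (induction js arbitrary: ws)
  case (Cons j js0 ws0)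
  show ?case
  proof (cases js0)
    case Nil
    then have "ws0 = []" using Cons.prems by (cases ws0) auto
    then show ?thesis using Nil Cons.prems by (intro exI[of _ "[P j 0]"] exI[of _ 0]) auto
  next
  case js0: (Cons i js)
  then obtain w ws where ws0: "ws0 = w # ws" using Cons.prems by (cases ws0) auto
  note prems = Cons.prems[unfolded js0 ws0]
  from Cons.IH[of ws] prems obtain vs b where vs: "induced_list adj vs" "vs \<noteq> []" "b < g" "hd vs = P i b"
     "set vs \<subseteq> {P i b} \<union> {P i a | i a. i \<in> set js \<and> a < L} \<union> set ws"
     "length js * (L - 2 * g) + 1 \<le> length vs"
    and N: "\<And>w u. w \<in> set ws \<Longrightarrow> u \<in> F \<Longrightarrow> adj w u \<Longrightarrow> u \<in> {P i b} \<union> {P i a | i a. i \<in> set js \<and> a < L}"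
    by (auto simp: js0)
  have M: "i \<in> M" "j \<in> M" "set js \<subseteq> M" "i \<noteq> j" "i \<notin> set js" "j \<notin> set js" using prems by auto
  from prems obtain a b' where ab: "L - g \<le> a" "a < L" "b' < g"
    and w: "\<And>u. u \<in> F \<Longrightarrow> adj w u \<longleftrightarrow> u = P i a \<or> u = P j b'"
    by (auto simp: conn_def)
  have wW: "w \<in> W" "w \<notin> set ws" "\<And>c. c \<in> set ws \<Longrightarrow> \<not> adj w c" "set ws \<subseteq> W" using prems by auto
  have inF: "P k t \<in> F" if "k \<in> M" "t < L" for k t using that by (auto simp: F_def)
  have wsF: "P k t \<notin> set ws" "P k t \<noteq> w" if "k \<in> M" "t < L" for k t using that P_notin_W wW by auto
  have ba: "b \<le> a" "b < L" "b' < L" using ab vs(3) g by auto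
  \<comment> \<open>\<open>vs\<close> continued along piece \<open>i\<close> up to position
    \<open>t\<close>. The list grows at its head, hence the reversal; position \<open>b\<close> is
    already the head of \<open>vs\<close>.\<close>
  define seg where "seg t = map (P i) (rev [Suc b..<Suc t]) @ vs" for t
  have seg: "induced_list adj (seg t) \<and> hd (seg t) = P i t \<and>
     set (seg t) \<subseteq> {P i a | a. b \<le> a \<and> a \<le> t} \<union> {P i a | i a. i \<in> set js \<and> a < L} \<union> set ws"
    if "b \<le> t" "t < L" for t
    using that
  proof (induction t rule: dec_induct)
    case base
    have "seg b = vs" by (simp add: seg_def)
    then show ?case using vs by auto
  next
    case (step t)
    have Cons: "seg (Suc t) = P i (Suc t) # seg t" using step.hyps by (simp add: seg_def)
    note IH = step.IH[OF Suc_lessD[OF step.prems]]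
    have new: "P i (Suc t) \<notin> set (seg t) \<and> (\<forall>v\<in>set (seg t). adj (P i (Suc t)) v \<longleftrightarrow> v = P i t)"
    proof (intro conjI ballI)
      have cases: "(\<exists>c. v = P i c \<and> c \<le> t) \<or> (\<exists>k c. v = P k c \<and> k \<in> set js \<and> c < L) \<or> v \<in> set ws"
        if "v \<in> set (seg t)" for v using IH that by auto
      show "P i (Suc t) \<notin> set (seg t)"
      proof
        assume "P i (Suc t) \<in> set (seg t)"
        from cases[OF this] show False
          using inj[of i i "Suc t"] inj[of i _ "Suc t"] wsF[of i "Suc t"] M step.prems
          by (metis Suc_n_not_le_n le_less_trans less_Suc_eq_le subsetD less_trans_Suc Suc_lessD)
      qed
      fix v assume "v \<in> set (seg t)"
      from cases[OF this] show "adj (P i (Suc t)) v \<longleftrightarrow> v = P i t"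
      proof (elim disjE exE conjE)
        fix c assume c: "v = P i c" "c \<le> t"
        have "adj (P i (Suc t)) v \<longleftrightarrow> c = t" using c adj_P[of i i "Suc t" c] M step.prems by auto
        also have "\<dots> \<longleftrightarrow> v = P i t" using c inj[of i i c t] M step.prems by auto
        finally show ?thesis .
      next
        fix k c assume c: "v = P k c" "k \<in> set js" "c < L"
        then show ?thesis using adj_P[of i k "Suc t" c] inj[of k i c t] M step.prems by auto
      next
        assume v: "v \<in> set ws"
        \<comment> \<open>Here the neighbour clause \<open>N\<close> enters: an older connector can
          meet piece \<open>i\<close> only at \<open>b\<close>, and \<open>Suc t\<close> lies beyond
          \<open>b\<close>.\<close>
        have "\<not> adj v (P i (Suc t))"
        proof
          assume "adj v (P i (Suc t))"
          from N[OF v inF this] M step.prems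
          consider "P i (Suc t) = P i b" | k c where "P i (Suc t) = P k c" "k \<in> set js" "c < L" by auto
          then show False
          proof cases
            case 1
            then show False using inj[OF M(1,1) step.prems ba(2)] step.hyps by simp
          next
            case (2 k c)
            then have "k \<in> M" using M by auto
            then show False using inj[OF M(1) _ step.prems 2(3,1)] 2(2) M by auto
          qed
        qed
        then have "\<not> adj (P i (Suc t)) v" using adj_sym by blast
        moreover have "v \<noteq> P i t" using v wsF(1)[OF M(1), of t] step.prems by auto
        ultimately show ?thesis by simp
      qed
    qed
    have "induced_list adj (seg (Suc t))" using IH new unfolding Cons by simp
    moreover have "set (seg (Suc t)) \<subseteq> {P i a | a. b \<le> a \<and> a \<le> Suc t} \<union>
      {P i a | i a. i \<in> set js \<and> a < L} \<union> set ws"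
    proof -
      have A: "{P i a | a. b \<le> a \<and> a \<le> t} \<subseteq> {P i a | a. b \<le> a \<and> a \<le> Suc t}" by auto
      have x: "P i (Suc t) \<in> {P i a | a. b \<le> a \<and> a \<le> Suc t}" using step.hyps by auto
      have "set (seg (Suc t)) = insert (P i (Suc t)) (set (seg t))" by (simp add: Cons)
      then show ?thesis
        by (simp only:) (intro insert_subsetI UnI1 x
          order_trans[OF IH[THEN conjunct2, THEN conjunct2]] Un_mono order_refl A)
    qed
    ultimately show ?case by (simp add: Cons)
  qed
  have sa: "induced_list adj (seg a)" "hd (seg a) = P i a"
     "set (seg a) \<subseteq> {P i a | a. a < L} \<union> {P i a | i a. i \<in> set js \<and> a < L} \<union> set ws"
  proof -
    have "{P i c | c. b \<le> c \<and> c \<le> a} \<subseteq> {P i c | c. c < L}" using ab by auto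
    then show "induced_list adj (seg a)" "hd (seg a) = P i a"
      "set (seg a) \<subseteq> {P i a | a. a < L} \<union> {P i a | i a. i \<in> set js \<and> a < L} \<union> set ws"
      using seg[OF ba(1) ab(2)] by (simp_all only:)
        (rule order_trans[OF seg[OF ba(1) ab(2), THEN conjunct2, THEN conjunct2]], intro Un_mono order_refl)
  qed
  have sa': "set (seg a) \<subseteq> {P k c | k c. k \<in> set (i # js) \<and> c < L} \<union> set ws" using sa(3) by fastforce
  have sa'': "(\<exists>k c. v = P k c \<and> k \<in> set (i # js) \<and> c < L) \<or> v \<in> set ws" if "v \<in> set (seg a)" for v
    using subsetD[OF sa' that] by blast
  have sw: "induced_list adj (w # seg a)"
  proof -
    have "w \<notin> set (seg a)"
    proof
      assume "w \<in> set (seg a)"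
      from sa''[OF this] consider k c where "w = P k c" "k \<in> set (i # js)" "c < L" | "w \<in> set ws" by blast
      then show False using wsF(2) wW(2) M by cases auto
    qed
    moreover have "adj w v \<longleftrightarrow> v = P i a" if "v \<in> set (seg a)" for v
    proof -
      from sa''[OF that] consider k c where "v = P k c" "k \<in> set (i # js)" "c < L" | "v \<in> set ws" by blast
      then show ?thesis
      proof cases
        case 1
        then have "v \<in> F" using inF M by auto
        moreover have "v \<noteq> P j b'" using inj[of k j c b'] 1 M ba by auto
        ultimately show ?thesis using w by auto
      next
        case 2
        then show ?thesis using wW(3) wsF(1)[of i a] M ab by auto
      qed
    qed
    ultimately show ?thesis using sa by simp
  qed
  have neq: "P j b' \<noteq> P k c" "\<not> adj (P j b') (P k c)" if "k \<in> set (i # js)" "c < L" for k c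
  proof -
    have "k \<in> M" "j \<noteq> k" using that M by auto
    then show "P j b' \<noteq> P k c" "\<not> adj (P j b') (P k c)"
      using inj[OF M(2) _ ba(3) that(2), of k] adj_P[OF M(2) _ ba(3) that(2), of k] by blast+
  qed
  \<comment> \<open>Leave piece \<open>i\<close> at its exit \<open>a\<close>, pass through
    \<open>w\<close> and stop at the entrance \<open>b'\<close> of the new piece.\<close>
  let ?vs = "P j b' # w # seg a"
  have "induced_list adj ?vs"
  proof -
    have "P j b' \<notin> set (w # seg a)"
    proof
      assume "P j b' \<in> set (w # seg a)"
      then consider "P j b' = w" | k c where "P j b' = P k c" "k \<in> set (i # js)" "c < L" | "P j b' \<in> set ws"
        using sa''[of "P j b'"] by auto
      then show False using wsF[OF M(2) ba(3)] neq(1) by cases blast+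
    qed
    moreover have "adj (P j b') v \<longleftrightarrow> v = w" if "v \<in> set (w # seg a)" for v
    proof -
      from that sa''[of v] consider "v = w" | k c where "v = P k c" "k \<in> set (i # js)" "c < L" | "v \<in> set ws"
        by auto
      then show ?thesis
      proof cases
        case 1
        then show ?thesis using w[OF inF[OF M(2) ba(3)]] adj_sym by blast
      next
        case 2
        then have "k \<in> M" using M by auto
        then have "v \<noteq> w" "\<not> adj (P j b') v" using wsF(2)[of k c] neq(2)[OF 2(2,3)] 2 by blast+
        then show ?thesis by simp
      next
        case 3
        have "\<not> adj v (P j b')"
        proof
          assume "adj v (P j b')"
          from N[OF 3 inF this] M ba
          consider "P j b' = P i b" | k c where "P j b' = P k c" "k \<in> set js" "c < L" by auto
          then show False using neq(1)[OF _ ba(2), of i] neq(1) by cases auto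
        qed
        then show ?thesis using adj_sym 3 wW(2) by blast
      qed
    qed
    ultimately show ?thesis using sw by simp
  qed
  moreover have "set ?vs \<subseteq> {P j b'} \<union> {P k a | k a. k \<in> set (i # js) \<and> a < L} \<union> set (w # ws)"
    using sa' by auto
  moreover have "length (i # js) * (L - 2 * g) + 1 \<le> length ?vs"
  proof -
    have "length (seg a) = (a - b) + length vs" using ba(1) by (auto simp: seg_def)
    moreover have "L - 2 * g \<le> a - b" using ab vs(3) by simp
    ultimately show ?thesis using vs(6) by simp
  qed
  moreover have "u \<in> {P j b'} \<union> {P k a | k a. k \<in> set (i # js) \<and> a < L}"
    if "w' \<in> set (w # ws)" "u \<in> F" "adj w' u" for w' u
  proof (cases "w' = w")
    case True
    then have "u = P i a \<or> u = P j b'" using w that by auto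
    then show ?thesis using ab by auto
  next
    case False
    then have "w' \<in> set ws" using that by auto
    from N[OF this that(2,3)] show ?thesis using ba by auto
  qed
  ultimately show ?thesis using ab(3) unfolding js0 ws0
    by (intro exI[of _ ?vs] exI[of _ b']) simp
  qed
qed auto

end

section \<open>Concentration of the number of defects\<close>

lemma pair_in_pairs: "x \<in> X \<Longrightarrow> y \<in> X \<Longrightarrow> x \<noteq> y \<Longrightarrow> {x, y} \<in> pairs X"
  by (simp add: pairs_def)

text \<open>Windows of \<open>L\<close> vertices are placed with stride \<open>Suc L\<close>. The
  vertex left out after each window prevents consecutive windows from being joined by a path
  edge.\<close>

lemma window_index:
  assumes "i < k div Suc L" "a < L"
  shows "i * Suc L + a < k"
proof -
  have "Suc i * Suc L \<le> (k div Suc L) * Suc L" using assms by (intro mult_le_mono1) simp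
  also have "\<dots> \<le> k" by (rule div_times_less_eq_dividend)
  finally show ?thesis using assms by simp
qed

text \<open>The offsets may reach \<open>L\<close>, one more than a position in a window: this is
  used to compare a position with the successor of another.\<close>

lemma window_index_inj:
  assumes "i * Suc L + a = j * Suc L + b" "a < Suc L" "b < Suc L"
  shows "i = j \<and> a = b"
proof -
  have "i = (i * Suc L + a) div Suc L" using assms(2) by (simp del: mult_Suc_right)
  also have "\<dots> = j" unfolding assms(1) using assms(3) by (simp del: mult_Suc_right)
  finally show ?thesis using assms(1) by simp
qed

context blocks
begin

text \<open>A pair with the wrong status is charged to its vertex in the higher block, so that changing
  the pairs with a given highest block affects at most one vertex of each potential path.\<close>

definition defective :: "('a set \<Rightarrow> bool) \<Rightarrow> 'a list \<Rightarrow> 'a \<Rightarrow> bool" where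
  "defective \<omega> q x \<longleftrightarrow> (\<exists>y\<in>set q. blk y < blk x \<and> (\<omega> {x, y} \<longleftrightarrow> {x, y} \<notin> path_edges q))"

definition defects :: "('a set \<Rightarrow> bool) \<Rightarrow> 'a list \<Rightarrow> nat" where
  "defects \<omega> q = card {x \<in> set q. defective \<omega> q x}"

definition min_defects :: "nat \<Rightarrow> ('a set \<Rightarrow> bool) \<Rightarrow> nat" where
  "min_defects k \<omega> = Min (defects \<omega> ` spread k)"

text \<open>These are the independent variables of McDiarmid's inequality: all pairs inside
  \<open>U\<close>, grouped by their highest block. A pair inside a single block is included as
  well; no list in \<open>spread k\<close> contains both its vertices.\<close>

definition edges_with_top :: "nat \<Rightarrow> 'a set set" where
  "edges_with_top j = {e \<in> pairs U. Max (blk ` e) = j}"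

lemma inj_on_spread: "q \<in> spread k \<Longrightarrow> inj_on blk (set q)"
  by (simp add: spread_def distinct_map)

lemma spread_subset: "q \<in> spread k \<Longrightarrow> set q \<subseteq> U"
  by (simp add: spread_def)

lemma defects_induces:
  assumes "q \<in> spread k" "induces \<omega> q"
  shows "defects \<omega> q = 0"
proof -
  have "\<not> defective \<omega> q x" if "x \<in> set q" for x
    using assms(2) that pair_in_pairs[of x "set q"] unfolding defective_def induces_def by blast
  then show ?thesis by (simp add: defects_def)
qed

lemma defects_Lipschitz:
  assumes q: "q \<in> spread k" and eq: "\<And>e. e \<notin> edges_with_top j \<Longrightarrow> \<omega> e = \<omega>' e"
  shows "defects \<omega> q \<le> defects \<omega>' q + 1"
proof -
  have "{x \<in> set q. defective \<omega> q x} \<subseteq> {x \<in> set q. defective \<omega>' q x} \<union> {x \<in> set q. blk x = j}"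
  proof
    fix x assume x: "x \<in> {x \<in> set q. defective \<omega> q x}"
    show "x \<in> {x \<in> set q. defective \<omega>' q x} \<union> {x \<in> set q. blk x = j}"
    proof (cases "blk x = j")
      case False
      \<comment> \<open>The highest block of this pair is that of \<open>x\<close>, which is not
        \<open>j\<close>.\<close>
      have "\<omega> {x, y} = \<omega>' {x, y}" if "blk y < blk x" for y
        by (rule eq) (use that False in \<open>auto simp: edges_with_top_def\<close>)
      then show ?thesis using x unfolding defective_def by auto
    qed (use x in auto)
  qed
  then have "defects \<omega> q \<le> card ({x \<in> set q. defective \<omega>' q x} \<union> {x \<in> set q. blk x = j})"
    unfolding defects_def by (intro card_mono) auto
  also have "\<dots> \<le> defects \<omega>' q + card {x \<in> set q. blk x = j}"
    unfolding defects_def by (rule card_Un_le)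
  also have "card {x \<in> set q. blk x = j} \<le> card {j}"
    by (rule card_inj_on_le[of blk]) (use inj_on_spread[OF q] in \<open>auto intro: inj_on_subset\<close>)
  finally show ?thesis by simp
qed

lemma min_defects_le: "q \<in> spread k \<Longrightarrow> min_defects k \<omega> \<le> defects \<omega> q"
  unfolding min_defects_def by (intro Min_le) auto

lemma min_defects_attained:
  assumes "k \<le> B"
  obtains q where "q \<in> spread k" "min_defects k \<omega> = defects \<omega> q"
proof -
  have "spread k \<noteq> {}" using card_spread_pos[OF assms] by auto
  then have "min_defects k \<omega> \<in> defects \<omega> ` spread k"
    unfolding min_defects_def by (intro Min_in) auto
  then show ?thesis using that by auto
qed

lemma min_defects_Lipschitz:
  assumes "k \<le> B" "\<And>e. e \<notin> edges_with_top j \<Longrightarrow> \<omega> e = \<omega>' e"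
  shows "min_defects k \<omega> \<le> min_defects k \<omega>' + 1"
proof -
  obtain q where q: "q \<in> spread k" "min_defects k \<omega>' = defects \<omega>' q"
    using min_defects_attained[OF assms(1)] by metis
  have "min_defects k \<omega> \<le> defects \<omega> q" by (rule min_defects_le) fact
  also have "\<dots> \<le> defects \<omega>' q + 1" by (rule defects_Lipschitz) (use q assms in auto)
  finally show ?thesis using q by simp
qed

lemma pairs_by_top: "(\<Union>j<B. edges_with_top j) = pairs U"
proof -
  have "Max (blk ` e) < B" if "e \<in> pairs U" for e
  proof -
    have "e \<subseteq> U" "finite e" "e \<noteq> {}" using that by (auto simp: pairs_def intro: card_ge_0_finite)
    then show ?thesis using blk_less by (subst Max_less_iff) auto
  qed
  then show ?thesis by (auto simp: edges_with_top_def)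
qed

lemma depends_on_min_defects: "depends_on (pairs U) (min_defects k)"
proof -
  have "defective \<omega> q x = defective \<omega>' q x"
    if "\<forall>e\<in>pairs U. \<omega> e = \<omega>' e" "q \<in> spread k" "x \<in> set q" for \<omega> \<omega>' :: "'a set \<Rightarrow> bool" and q x
  proof -
    have "\<omega> {x, y} = \<omega>' {x, y}" if "y \<in> set q" "blk y < blk x" for y
      using that \<open>x \<in> set q\<close> \<open>\<forall>e\<in>pairs U. \<omega> e = \<omega>' e\<close> spread_subset[OF \<open>q \<in> spread k\<close>]
      by (intro bspec[of "pairs U" "\<lambda>e. \<omega> e = \<omega>' e"] pair_in_pairs) auto
    then show ?thesis by (auto simp: defective_def)
  qed
  then have "defects \<omega> q = defects \<omega>' q"
    if "\<forall>e\<in>pairs U. \<omega> e = \<omega>' e" "q \<in> spread k" for \<omega> \<omega>' :: "'a set \<Rightarrow> bool" and q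
    using that unfolding defects_def by (metis (mono_tags, lifting))
  then have "defects \<omega> ` spread k = defects \<omega>' ` spread k"
    if "\<forall>e\<in>pairs U. \<omega> e = \<omega>' e" for \<omega> \<omega>' :: "'a set \<Rightarrow> bool"
    using that by (intro image_cong refl)
  then show ?thesis unfolding depends_on_def min_defects_def by metis
qed

text \<open>An induced potential path has no defects, so the event supplied by the second moment
  lies inside the lower tail event of \<open>McDiarmid_two_sided\<close>. Only the pairs inside
  \<open>U\<close> matter, and their highest blocks split them into \<open>B\<close> groups.\<close>

lemma min_defects_concentration:
  fixes p t :: real
  assumes I: "finite I" "pairs U \<subseteq> I" and k: "k \<le> B" "0 < B" and t: "t \<ge> 0"
  defines "Q \<equiv> Pi_pmf I False (\<lambda>_. bernoulli_pmf p)"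
  shows "measure_pmf.prob Q {\<omega>. real (min_defects k \<omega>) \<ge> t} *
    measure_pmf.prob Q {\<omega>. \<exists>q\<in>spread k. induces \<omega> q} \<le> exp (- t\<^sup>2 / B)"
proof -
  let ?R = "Pi_pmf (pairs U) False (\<lambda>_. bernoulli_pmf p)"
  have restr: "measure_pmf.prob Q {\<omega>. A (min_defects k \<omega>)} = measure_pmf.prob ?R {\<omega>. A (min_defects k \<omega>)}" for A
    unfolding Q_def
  proof (rule prob_Pi_pmf_restrict[OF I, where A = "\<lambda>\<omega>. A (min_defects k \<omega>)"])
    show "depends_on (pairs U) (\<lambda>\<omega>. A (min_defects k \<omega>))"
      using depends_on_min_defects[of k] unfolding depends_on_def by metis
  qed
  have McD: "measure_pmf.prob ?R {\<omega>. real (min_defects k \<omega>) \<ge> t} *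
    measure_pmf.prob ?R {\<omega>. real (min_defects k \<omega>) \<le> 0} \<le> exp (- t\<^sup>2 / card {..<B})"
    unfolding pairs_by_top[symmetric]
  proof (rule McDiarmid_two_sided[where f = "\<lambda>\<omega>. real (min_defects k \<omega>)" and J = "{..<B}" and K = edges_with_top])
    show "disjoint_family_on edges_with_top {..<B}"
      by (auto simp: disjoint_family_on_def edges_with_top_def)
    show "finite (\<Union>j<B. edges_with_top j)" unfolding pairs_by_top using finite_U by simp
    fix j and x y :: "'a set \<Rightarrow> bool" assume *: "\<And>e. e \<notin> edges_with_top j \<Longrightarrow> x e = y e"
    show "\<bar>real (min_defects k x) - real (min_defects k y)\<bar> \<le> 1"
    proof -
      have "min_defects k x \<le> min_defects k y + 1" "min_defects k y \<le> min_defects k x + 1"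
        by (rule min_defects_Lipschitz[OF k(1), of j]; simp add: *)+
      then show ?thesis by (simp add: abs_le_iff)
    qed
  qed (use k t in \<open>auto simp: lessThan_empty_iff\<close>)
  have "measure_pmf.prob Q {\<omega>. \<exists>q\<in>spread k. induces \<omega> q}
     \<le> measure_pmf.prob Q {\<omega>. real (min_defects k \<omega>) \<le> 0}"
  proof (rule measure_pmf.finite_measure_mono)
    show "{\<omega>. \<exists>q\<in>spread k. induces \<omega> q} \<subseteq> {\<omega>. real (min_defects k \<omega>) \<le> 0}"
    proof clarify
      fix \<omega> q assume q: "q \<in> spread k" "induces \<omega> q"
      then have "min_defects k \<omega> \<le> 0" using min_defects_le[OF q(1), of \<omega>] defects_induces[OF q] by simp
      then show "real (min_defects k \<omega>) \<le> 0" by simp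
    qed
  qed simp
  from mult_left_mono[OF this measure_nonneg]
  have "measure_pmf.prob Q {\<omega>. real (min_defects k \<omega>) \<ge> t} *
      measure_pmf.prob Q {\<omega>. \<exists>q\<in>spread k. induces \<omega> q}
    \<le> measure_pmf.prob Q {\<omega>. real (min_defects k \<omega>) \<ge> t} *
      measure_pmf.prob Q {\<omega>. real (min_defects k \<omega>) \<le> 0}" .
  also have "\<dots> \<le> exp (- t\<^sup>2 / card {..<B})"
    unfolding restr[of "\<lambda>m. real m \<ge> t"] restr[of "\<lambda>m. real m \<le> 0"] by (rule McD)
  finally show ?thesis by simp
qed

section \<open>Cutting a potential path into defect-free windows\<close>

definition window :: "nat \<Rightarrow> 'a list \<Rightarrow> nat \<Rightarrow> nat \<Rightarrow> 'a" where
  "window L q i a = q ! (i * Suc L + a)"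

definition good_windows :: "nat \<Rightarrow> ('a set \<Rightarrow> bool) \<Rightarrow> 'a list \<Rightarrow> nat set" where
  "good_windows L \<omega> q = {i. i < length q div Suc L \<and> (\<forall>a<L. \<not> defective \<omega> q (window L q i a))}"

lemma finite_good_windows [simp]: "finite (good_windows L \<omega> q)"
  by (rule finite_subset[of _ "{..<length q div Suc L}"]) (auto simp: good_windows_def)

text \<open>The windows are disjoint, so picking one defective vertex in each bad window is
  injective.\<close>

lemma card_good_windows:
  assumes q: "q \<in> spread k"
  shows "k div Suc L \<le> card (good_windows L \<omega> q) + defects \<omega> q"
proof -
  have len: "length q = k" "distinct q" using q distinct_spread by (auto simp: spread_def)
  let ?Bad = "{..<k div Suc L} - good_windows L \<omega> q"
  have "\<forall>i\<in>?Bad. \<exists>a<L. defective \<omega> q (window L q i a)" by (auto simp: good_windows_def len)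
  then obtain c where c: "\<And>i. i \<in> ?Bad \<Longrightarrow> c i < L \<and> defective \<omega> q (window L q i (c i))" by metis
  have "card ?Bad \<le> defects \<omega> q" unfolding defects_def
  proof (rule card_inj_on_le)
    show "inj_on (\<lambda>i. window L q i (c i)) ?Bad"
    proof (rule inj_onI)
      fix i j assume ij: "i \<in> ?Bad" "j \<in> ?Bad" "window L q i (c i) = window L q j (c j)"
      have "i * Suc L + c i = j * Suc L + c j"
        using ij len window_index[of i k L "c i"] window_index[of j k L "c j"] c[of i] c[of j]
        by (simp add: window_def nth_eq_iff_index_eq del: mult_Suc_right)
      then show "i = j" using window_index_inj[of i L "c i" j "c j"] c[of i] c[of j] ij by auto
    qed
    show "(\<lambda>i. window L q i (c i)) ` ?Bad \<subseteq> {x \<in> set q. defective \<omega> q x}"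
      using c window_index[of _ k L] len by (auto simp: window_def simp del: mult_Suc_right)
  qed simp
  moreover have "k div Suc L \<le> card ?Bad + card (good_windows L \<omega> q)"
    using card_Un_le[of ?Bad "good_windows L \<omega> q"] card_mono[of "?Bad \<union> good_windows L \<omega> q" "{..<k div Suc L}"]
    by simp
  ultimately show ?thesis by simp
qed

lemma window_mem:
  assumes "q \<in> spread k" "i \<in> good_windows L \<omega> q" "a < L"
  shows "window L q i a \<in> set q"
  using assms window_index[of i k L a] by (auto simp: good_windows_def window_def spread_def simp del: mult_Suc_right)

lemma window_inj:
  assumes "q \<in> spread k" "i \<in> good_windows L \<omega> q" "j \<in> good_windows L \<omega> q" "a < L" "c < L"
    "window L q i a = window L q j c"
  shows "i = j \<and> a = c"
proof (rule window_index_inj)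
  have "length q = k" "distinct q" using assms(1) distinct_spread by (auto simp: spread_def)
  then show "i * Suc L + a = j * Suc L + c"
    using assms window_index[of i k L a] window_index[of j k L c]
    by (simp add: window_def good_windows_def nth_eq_iff_index_eq del: mult_Suc_right)
qed (use assms in auto)

lemma nth_pair_in_path_edges:
  assumes "distinct q" "x < length q" "y < length q"
  shows "{q ! x, q ! y} \<in> path_edges q \<longleftrightarrow> x = Suc y \<or> y = Suc x"
proof
  assume "{q ! x, q ! y} \<in> path_edges q"
  then obtain i where i: "{q ! x, q ! y} = {q ! i, q ! Suc i}" "Suc i < length q"
    by (auto simp: path_edges_def)
  then show "x = Suc y \<or> y = Suc x"
    using assms by (auto simp: doubleton_eq_iff nth_eq_iff_index_eq)
next
  assume "x = Suc y \<or> y = Suc x"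
  then show "{q ! x, q ! y} \<in> path_edges q"
    using assms unfolding path_edges_def by (auto simp: insert_commute)
qed

text \<open>The two vertices lie in different blocks, and a wrong status of their pair would be
  charged to the one in the higher block. As neither vertex is defective, the pair is an edge
  exactly if it is an edge of \<open>q\<close>; the stride then excludes edges between different
  windows.\<close>

lemma good_windows_adj:
  assumes q: "q \<in> spread k" and ij: "i \<in> good_windows L \<omega> q" "j \<in> good_windows L \<omega> q"
    and ab: "a < L" "c < L" and ne: "(i, a) \<noteq> (j, c)"
  shows "\<omega> {window L q i a, window L q j c} \<longleftrightarrow> i = j \<and> (a = Suc c \<or> c = Suc a)"
proof -
  let ?x = "window L q i a" and ?y = "window L q j c"
  have len: "length q = k" "distinct q" using q distinct_spread by (auto simp: spread_def)
  have xy: "?x \<in> set q" "?y \<in> set q" "?x \<noteq> ?y"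
    using window_mem[OF q ij(1) ab(1)] window_mem[OF q ij(2) ab(2)] window_inj[OF q ij ab] ne by auto
  then have "blk ?x \<noteq> blk ?y" using inj_on_spread[OF q] by (auto dest: inj_onD)
  moreover have "\<not> defective \<omega> q ?x" "\<not> defective \<omega> q ?y" using ij ab by (auto simp: good_windows_def)
  ultimately have "\<omega> {?x, ?y} \<longleftrightarrow> {?x, ?y} \<in> path_edges q"
    using xy unfolding defective_def by (metis insert_commute linorder_neqE_nat)
  also have "\<dots> \<longleftrightarrow> i * Suc L + a = Suc (j * Suc L + c) \<or> j * Suc L + c = Suc (i * Suc L + a)"
    unfolding window_def using ij ab len window_index
    by (intro nth_pair_in_path_edges) (auto simp: good_windows_def simp del: mult_Suc_right)
  also have "\<dots> \<longleftrightarrow> i = j \<and> (a = Suc c \<or> c = Suc a)"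
    using window_index_inj[of i L a j "Suc c"] window_index_inj[of j L c i "Suc a"] ab
    by (auto simp del: mult_Suc_right)
  finally show ?thesis .
qed

end

section \<open>Linking the pieces\<close>

text \<open>Different patterns on the same set \<open>A\<close> exclude each other, so their
  probabilities add up.\<close>

lemma prob_some_pattern_ge:
  fixes p :: real
  assumes I: "finite I" "A \<subseteq> I" and H: "finite \<H>" "\<And>h. h \<in> \<H> \<Longrightarrow> h \<subseteq> A \<and> card h = r"
    and p: "0 \<le> p" "p \<le> 1"
  shows "real (card \<H>) * p ^ r * (1 - p) ^ card A \<le>
    measure_pmf.prob (Pi_pmf I False (\<lambda>_. bernoulli_pmf p)) {x. \<exists>h\<in>\<H>. \<forall>e\<in>A. x e \<longleftrightarrow> e \<in> h}"
proof -
  let ?Q = "Pi_pmf I False (\<lambda>_. bernoulli_pmf p)"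
  define ev where "ev h = {x. \<forall>e\<in>A. x e \<longleftrightarrow> e \<in> h}" for h
  have disj: "disjoint_family_on ev \<H>"
  proof (unfold disjoint_family_on_def, intro ballI impI)
    fix h h' assume *: "h \<in> \<H>" "h' \<in> \<H>" "h \<noteq> h'"
    then have "h \<subseteq> A" "h' \<subseteq> A" using H(2) by auto
    then show "ev h \<inter> ev h' = {}" using *(3) unfolding ev_def by blast
  qed
  have "real (card \<H>) * p ^ r * (1 - p) ^ card A = (\<Sum>h\<in>\<H>. p ^ r * (1 - p) ^ card A)" by simp
  also have "\<dots> \<le> (\<Sum>h\<in>\<H>. p ^ r * (1 - p) ^ (card A - r))"
    using p by (intro sum_mono mult_left_mono power_decreasing) auto
  also have "\<dots> = (\<Sum>h\<in>\<H>. measure_pmf.prob ?Q (ev h))"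
  proof (intro sum.cong refl)
    fix h assume "h \<in> \<H>"
    then show "p ^ r * (1 - p) ^ (card A - r) = measure_pmf.prob ?Q (ev h)"
      unfolding ev_def using H(2)[of h] prob_pattern[OF I, of h p] p by simp
  qed
  also have "\<dots> = measure_pmf.prob ?Q (\<Union>h\<in>\<H>. ev h)"
    by (rule measure_pmf.finite_measure_finite_Union[symmetric]) (use H disj in auto)
  also have "(\<Union>h\<in>\<H>. ev h) = {x. \<exists>h\<in>\<H>. \<forall>e\<in>A. x e \<longleftrightarrow> e \<in> h}" by (auto simp: ev_def)
  finally show ?thesis .
qed

text \<open>Weight a set \<open>C\<close> by D^(-|C|). Each counted set has weight at least D^(-m),
  while all subsets together have weight (1 + 1/D)^|W|. The free parameter \<open>D\<close> balances
  the two factors.\<close>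

lemma card_small_subsets_le:
  fixes D :: real
  assumes "finite W" "D \<ge> 1"
  shows "real (card {C. C \<subseteq> W \<and> card C \<le> m}) \<le> D ^ m * exp (card W / D)"
proof -
  have sum: "(\<Sum>C\<in>Pow W. (1 / D) ^ card C) = (1 + 1 / D) ^ card W"
    using assms(1)
  proof (induction W rule: finite_induct)
    case (insert x W)
    have "Pow (insert x W) = Pow W \<union> insert x ` Pow W" by (rule Pow_insert)
    moreover have "Pow W \<inter> insert x ` Pow W = {}" using insert.hyps by auto
    ultimately have "(\<Sum>C\<in>Pow (insert x W). (1 / D) ^ card C) =
      (\<Sum>C\<in>Pow W. (1 / D) ^ card C) + (\<Sum>C\<in>insert x ` Pow W. (1 / D) ^ card C)"
      using insert.hyps by (simp add: sum.union_disjoint)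
    also have "(\<Sum>C\<in>insert x ` Pow W. (1 / D) ^ card C) = (\<Sum>C\<in>Pow W. (1 / D) ^ card (insert x C))"
      using insert.hyps by (subst sum.reindex) (auto simp: inj_on_def)
    also have "\<dots> = (\<Sum>C\<in>Pow W. (1 / D) * (1 / D) ^ card C)"
    proof (intro sum.cong refl)
      fix C assume "C \<in> Pow W"
      then have "finite C" "x \<notin> C" using insert.hyps finite_subset by auto
      then show "(1 / D) ^ card (insert x C) = (1 / D) * (1 / D) ^ card C" by simp
    qed
    also have "\<dots> = (1 / D) * (\<Sum>C\<in>Pow W. (1 / D) ^ card C)" by (simp only: sum_distrib_left)
    finally show ?case unfolding insert.IH using insert.hyps by (simp add: distrib_right)
  qed simp
  have "real (card {C. C \<subseteq> W \<and> card C \<le> m}) * (1 / D) ^ m = (\<Sum>C | C \<subseteq> W \<and> card C \<le> m. (1 / D) ^ m)"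
    by simp
  also have "\<dots> \<le> (\<Sum>C | C \<subseteq> W \<and> card C \<le> m. (1 / D) ^ card C)"
    using assms(2) by (intro sum_mono power_decreasing) auto
  also have "\<dots> \<le> (\<Sum>C\<in>Pow W. (1 / D) ^ card C)"
    using assms by (intro sum_mono2) auto
  also have "\<dots> \<le> exp (1 / D) ^ card W"
    unfolding sum using assms by (intro power_mono exp_ge_add_one_self) auto
  also have "\<dots> = exp (card W / D)" by (simp add: exp_of_nat_mult[symmetric])
  finally show ?thesis using assms(2) by (simp add: power_one_over field_simps)
qed

lemma prob_Union_le:
  assumes "finite X" "\<And>x. x \<in> X \<Longrightarrow> measure_pmf.prob Q {\<omega>. A x \<omega>} \<le> c" "real (card X) \<le> N" "c \<ge> 0"
  shows "measure_pmf.prob Q {\<omega>. \<exists>x\<in>X. A x \<omega>} \<le> N * c"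
proof -
  have "{\<omega>. \<exists>x\<in>X. A x \<omega>} = (\<Union>x\<in>X. {\<omega>. A x \<omega>})" by auto
  then have "measure_pmf.prob Q {\<omega>. \<exists>x\<in>X. A x \<omega>} \<le> (\<Sum>x\<in>X. measure_pmf.prob Q {\<omega>. A x \<omega>})"
    using measure_pmf.finite_measure_subadditive_finite[OF assms(1), of "\<lambda>x. {\<omega>. A x \<omega>}" Q] by simp
  also have "\<dots> \<le> (\<Sum>x\<in>X. c)" by (intro sum_mono assms)
  also have "\<dots> \<le> N * c" using assms by (simp add: mult_right_mono)
  finally show ?thesis .
qed

text \<open>Whether \<open>w\<close> is a suitable connector depends only on the pairs joining it to
  \<open>F\<close> or \<open>C\<close>. For different \<open>w\<close> outside \<open>C\<close>
  these stars are disjoint, so the events are independent; each fails with probability at most 1 -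
  \<rho> \<le> exp(- \<rho>).\<close>

lemma prob_no_link_le:
  fixes p :: real
  assumes I: "finite I" and W: "finite W" "W \<inter> F = {}" and F: "finite F"
    and A: "A1 \<subseteq> F" "A2 \<subseteq> F" "A1 \<inter> A2 = {}" and C: "C \<subseteq> W"
    and sub: "\<And>w u. w \<in> W \<Longrightarrow> u \<in> F \<union> W \<Longrightarrow> u \<noteq> w \<Longrightarrow> {w, u} \<in> I"
    and p: "0 \<le> p" "p \<le> 1"
  shows "measure_pmf.prob (Pi_pmf I False (\<lambda>_. bernoulli_pmf p))
     {\<omega>. \<forall>w\<in>W - C. \<not> (\<exists>u\<in>A1. \<exists>v\<in>A2. (\<forall>x\<in>F. \<omega> {w, x} \<longleftrightarrow> x = u \<or> x = v) \<and> (\<forall>c\<in>C. \<not> \<omega> {w, c}))}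
   \<le> exp (- (card A1 * card A2 * p\<^sup>2 * (1 - p) ^ (card F + card C) * (real (card W) - card C)))"
proof -
  let ?Q = "Pi_pmf I False (\<lambda>_. bernoulli_pmf p)"
  define K where "K w = (\<lambda>x. {w, x}) ` (F \<union> C)" for w :: 'a
  define link where "link w \<omega> \<longleftrightarrow> (\<exists>u\<in>A1. \<exists>v\<in>A2. (\<forall>x\<in>F. \<omega> {w, x} \<longleftrightarrow> x = u \<or> x = v) \<and> (\<forall>c\<in>C. \<not> \<omega> {w, c}))"
    for w and \<omega> :: "'a set \<Rightarrow> bool"
  define \<rho> where "\<rho> = card A1 * card A2 * p\<^sup>2 * (1 - p) ^ (card F + card C)"
  have fin: "finite C" "finite A1" "finite A2" "F \<inter> C = {}"
    using W F A C finite_subset by blast+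
  have one: "\<rho> \<le> measure_pmf.prob ?Q {\<omega>. link w \<omega>}" if w: "w \<in> W - C" for w
  proof -
    have wF: "w \<notin> F \<union> C" using w W by auto
    have inj: "inj_on (\<lambda>x. {w, x}) (F \<union> C)" using wF by (auto simp: inj_on_def doubleton_eq_iff)
    have cK: "card (K w) = card F + card C"
      unfolding K_def using fin F by (simp add: card_image[OF inj] card_Un_disjoint)
    \<comment> \<open>The pattern in which \<open>w\<close> is joined to \<open>u\<close> and
      \<open>v\<close> only. Disjointness of \<open>A1\<close> and \<open>A2\<close> makes
      \<open>u\<close> and \<open>v\<close> recoverable from the pattern.\<close>
    define hh where "hh = (\<lambda>(u, v). {{w, u}, {w, v}})"
    have "inj_on hh (A1 \<times> A2)"
    proof (rule inj_onI, clarsimp simp: hh_def)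
      fix u v u' v' assume *: "u \<in> A1" "v \<in> A2" "u' \<in> A1" "v' \<in> A2" "{{w, u}, {w, v}} = {{w, u'}, {w, v'}}"
      have "{w, a} = {w, b} \<longleftrightarrow> a = b" for a b by (auto simp: doubleton_eq_iff)
      then show "u = u' \<and> v = v'" using * A(3) by (auto simp: doubleton_eq_iff)
    qed
    then have cH: "card (hh ` (A1 \<times> A2)) = card A1 * card A2"
      by (simp add: card_image card_cartesian_product)
    have "real (card (hh ` (A1 \<times> A2))) * p ^ 2 * (1 - p) ^ card (K w) \<le>
       measure_pmf.prob ?Q {x. \<exists>h\<in>hh ` (A1 \<times> A2). \<forall>e\<in>K w. x e \<longleftrightarrow> e \<in> h}"
    proof (rule prob_some_pattern_ge[OF I])
      show "K w \<subseteq> I" unfolding K_def using sub w C W by blast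
      fix h assume "h \<in> hh ` (A1 \<times> A2)"
      then obtain u v where uv: "u \<in> A1" "v \<in> A2" "h = {{w, u}, {w, v}}" by (auto simp: hh_def)
      then have "{w, u} \<noteq> {w, v}" using A(3) by (auto simp: doubleton_eq_iff)
      then show "h \<subseteq> K w \<and> card h = 2" using uv A by (auto simp: K_def)
    qed (use fin p in auto)
    also have "\<dots> \<le> measure_pmf.prob ?Q {\<omega>. link w \<omega>}"
    proof (rule measure_pmf.finite_measure_mono)
      show "{x. \<exists>h\<in>hh ` (A1 \<times> A2). \<forall>e\<in>K w. x e \<longleftrightarrow> e \<in> h} \<subseteq> {\<omega>. link w \<omega>}"
      proof clarify
        fix x h u v assume uv: "u \<in> A1" "v \<in> A2" and x: "\<forall>e\<in>K w. x e \<longleftrightarrow> e \<in> hh (u, v)"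
        have mem: "{w, y} \<in> hh (u, v) \<longleftrightarrow> y = u \<or> y = v" for y
          using uv wF A by (auto simp: hh_def doubleton_eq_iff)
        show "link w x" unfolding link_def
        proof (intro bexI conjI ballI)
          show "x {w, y} \<longleftrightarrow> y = u \<or> y = v" if "y \<in> F" for y
            using x mem that by (auto simp: K_def)
          show "\<not> x {w, c}" if "c \<in> C" for c
          proof -
            have "c \<noteq> u" "c \<noteq> v" using that fin(4) uv A by auto
            then show ?thesis using x mem[of c] that by (auto simp: K_def)
          qed
        qed (use uv in auto)
      qed
    qed simp
    finally show ?thesis by (simp add: \<rho>_def cH cK)
  qed
  have \<rho>: "0 \<le> \<rho>" using p by (simp add: \<rho>_def)
  have "measure_pmf.prob ?Q {\<omega>. \<forall>w\<in>W - C. \<not> link w \<omega>} = (\<Prod>w\<in>W - C. measure_pmf.prob ?Q {\<omega>. \<not> link w \<omega>})"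
  proof (rule prob_Pi_pmf_indep_ball[OF I, where K = K])
    show "disjoint_family_on K (W - C)"
      using W C unfolding disjoint_family_on_def K_def by (auto simp: doubleton_eq_iff)
    fix w
    show "depends_on (K w) (\<lambda>\<omega>. \<not> link w \<omega>)"
      unfolding depends_on_def link_def K_def by simp
  qed (use W in auto)
  also have "\<dots> \<le> (\<Prod>w\<in>W - C. exp (- \<rho>))"
  proof (rule prod_mono, intro conjI)
    fix w assume w: "w \<in> W - C"
    have "measure_pmf.prob ?Q {\<omega>. \<not> link w \<omega>} = 1 - measure_pmf.prob ?Q {\<omega>. link w \<omega>}"
      using measure_pmf.prob_compl[of "{\<omega>. link w \<omega>}" ?Q] by (simp add: Compl_eq_Diff_UNIV[symmetric] Collect_neg_eq)
    also have "\<dots> \<le> 1 + (- \<rho>)" using one[OF w] by simp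
    also have "\<dots> \<le> exp (- \<rho>)" by (rule exp_ge_add_one_self)
    finally show "measure_pmf.prob ?Q {\<omega>. \<not> link w \<omega>} \<le> exp (- \<rho>)" .
  qed simp
  also have "\<dots> = exp (- (\<rho> * card (W - C)))" by (simp add: exp_of_nat_mult[symmetric] mult.commute)
  also have "\<dots> = exp (- (\<rho> * (real (card W) - card C)))"
    using C W fin by (simp add: card_Diff_subset card_mono of_nat_diff)
  finally show ?thesis unfolding link_def \<rho>_def .
qed

context linear_pieces
begin

definition ends :: "'i set \<Rightarrow> 'a set" where "ends S = (\<lambda>(i, a). P i a) ` (S \<times> {L - g..<L})"
definition starts :: "'i set \<Rightarrow> 'a set" where "starts S = (\<lambda>(i, a). P i a) ` (S \<times> {..<g})"

lemma inj_P: "inj_on (\<lambda>(i, a). P i a) (M \<times> {..<L})"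
  using inj by (auto simp: inj_on_def)

lemma card_ends: "S \<subseteq> M \<Longrightarrow> card (ends S) = card S * g"
  unfolding ends_def using g
  by (subst card_image) (auto intro: inj_on_subset[OF inj_P] simp: card_cartesian_product)

lemma card_starts: "S \<subseteq> M \<Longrightarrow> card (starts S) = card S * g"
  unfolding starts_def using g
  by (subst card_image) (auto intro: inj_on_subset[OF inj_P] simp: card_cartesian_product)

lemma F_eq_image: "F = (\<lambda>(i, a). P i a) ` (M \<times> {..<L})"
  by (auto simp: F_def image_iff)

lemma ends_starts:
  assumes "S \<subseteq> M" "T \<subseteq> M" "S \<inter> T = {}"
  shows "ends S \<subseteq> F" "starts T \<subseteq> F" "ends S \<inter> starts T = {}"
proof -
  show "ends S \<subseteq> F" "starts T \<subseteq> F"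
    using assms g unfolding ends_def starts_def F_eq_image by (intro image_mono; auto)+
  show "ends S \<inter> starts T = {}"
  proof (rule ccontr)
    assume "ends S \<inter> starts T \<noteq> {}"
    then obtain i a j b where *: "i \<in> S" "L - g \<le> a" "a < L" "j \<in> T" "b < g" "P i a = P j b"
      by (auto simp: ends_def starts_def)
    then have "i = j" using inj[of i j a b] assms g by auto
    then show False using * assms by auto
  qed
qed

lemma conn_if_ends_starts:
  assumes "u \<in> ends S" "v \<in> starts T" "\<forall>x\<in>F. adj w x \<longleftrightarrow> x = u \<or> x = v"
  shows "\<exists>i\<in>S. \<exists>j\<in>T. conn i w j"
  using assms unfolding ends_def starts_def conn_def by fastforce

end

lemma vertex_pairs_eq: "vertex_pairs n = pairs {1..n}"
  by (simp add: vertex_pairs_def pairs_def)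

lemma prob_gnp:
  "measure_pmf.prob (gnp n p) {E. Q E} =
   measure_pmf.prob (Pi_pmf (pairs {1..n}) False (\<lambda>_. bernoulli_pmf p)) {\<omega>. Q {e \<in> pairs {1..n}. \<omega> e}}"
  unfolding gnp_def vertex_pairs_eq by simp

lemma is_induced_path_induces:
  assumes "induces \<omega> q" "distinct q" "q \<noteq> []" "set q \<subseteq> V"
  shows "is_induced_path V {e \<in> pairs V. \<omega> e} q"
proof -
  have pe: "path_edges q \<subseteq> pairs (set q)" by (rule path_edges_subset_pairs) fact
  have sub: "pairs (set q) \<subseteq> pairs V" using assms(4) by (auto simp: pairs_def)
  have "{e \<in> {e \<in> pairs V. \<omega> e}. e \<subseteq> set q} = {e \<in> pairs (set q). \<omega> e}"
    using sub by (auto simp: pairs_def)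
  also have "\<dots> = path_edges q" using assms(1) pe by (auto simp: induces_def)
  finally show ?thesis using assms unfolding is_induced_path_def is_path_def by auto
qed

section \<open>Two-round exposure in the random graph\<close>

locale graph_blocks = blocks U blk B b for U :: "nat set" and blk B b +
  fixes n :: nat
  assumes U_sub: "U \<subseteq> {1..n}"
begin

definition has_path :: "nat \<Rightarrow> (nat set \<Rightarrow> bool) \<Rightarrow> bool" where
  "has_path l \<omega> \<longleftrightarrow> (\<exists>vs. is_induced_path {1..n} {e \<in> pairs {1..n}. \<omega> e} vs \<and> l \<le> path_length vs)"

text \<open>With the outcome \<open>x\<close> inside \<open>U\<close> fixed, the pieces are
  deterministic and all pairs that touch \<open>W\<close> are still unexposed. Failure of the search
  is witnessed by a triple (S, T, C) without a suitable connector. There are at most 2^m choices for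
  each of \<open>S\<close> and \<open>T\<close>, and \<open>card_small_subsets_le\<close> counts the
  sets \<open>C\<close>.\<close>

lemma prob_connect_fail:
  fixes p D :: real and L g s k :: nat
  assumes q: "q \<in> spread k" and p: "0 \<le> p" "p \<le> 1" and D: "D \<ge> 1"
    and g: "0 < g" "2 * g \<le> L" and s: "2 * s < card (good_windows L x q)"
  defines "W \<equiv> {1..n} - U" and "m \<equiv> k div Suc L"
  shows "measure_pmf.prob (Pi_pmf (pairs {1..n} - pairs U) False (\<lambda>_. bernoulli_pmf p))
      {y. \<not> has_path ((card (good_windows L x q) - 2 * s - 1) * (L - 2 * g)) (glue (pairs U) x y)}
    \<le> (4 * D) ^ m * exp (card W / D) *
      exp (- ((s * g)\<^sup>2 * p\<^sup>2 * (1 - p) ^ (k + m) * (real (card W) - m)))"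
proof -
  define M where "M = good_windows L x q"
  define P where "P = window L q"
  define I where "I = pairs {1..n} - pairs U"
  let ?Q = "Pi_pmf I False (\<lambda>_. bernoulli_pmf p)"
  \<comment> \<open>Pairs inside \<open>U\<close> are read from the first round \<open>x\<close>,
    all others from the second round \<open>y\<close>.\<close>
  define adj where "adj y u v \<longleftrightarrow> {u, v} \<in> {e \<in> pairs {1..n}. glue (pairs U) x y e}" for y u v
  have len: "length q = k" using q by (simp add: spread_def)
  have M_le: "card M \<le> m"
    using card_mono[of "{..<length q div Suc L}" M] by (auto simp: M_def m_def len good_windows_def)
  have finM: "finite M" by (simp add: M_def)
  have PU: "P i a \<in> U" if "i \<in> M" "a < L" for i a
    using window_mem[OF q] that spread_subset[OF q] unfolding M_def P_def by blast
  have pieces: "linear_pieces (adj y) P M W L g" for y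
  proof
    show "adj y v u" if "adj y u v" for u v using that by (simp add: adj_def insert_commute)
    show "i = j \<and> a = c" if "i \<in> M" "j \<in> M" "a < L" "c < L" "P i a = P j c" for i j a c
      using window_inj[OF q] that unfolding M_def P_def by blast
    show "adj y (P i a) (P j c) \<longleftrightarrow> i = j \<and> (a = Suc c \<or> c = Suc a)"
      if ij: "i \<in> M" "j \<in> M" "a < L" "c < L" for i j a c
    proof (cases "(i, a) = (j, c)")
      case True
      then show ?thesis by (auto simp: adj_def pairs_def)
    next
      case False
      then have "P i a \<noteq> P j c" using window_inj[OF q] ij unfolding M_def P_def by blast
      then have "{P i a, P j c} \<in> pairs U" using PU ij by (intro pair_in_pairs) auto
      moreover have "pairs U \<subseteq> pairs {1..n}" using U_sub by (auto simp: pairs_def)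
      ultimately have "adj y (P i a) (P j c) \<longleftrightarrow> x {P i a, P j c}" by (auto simp: adj_def)
      also have "\<dots> \<longleftrightarrow> i = j \<and> (a = Suc c \<or> c = Suc a)"
        using good_windows_adj[OF q] ij False unfolding M_def P_def by blast
      finally show ?thesis .
    qed
    show "P i a \<notin> W" if "i \<in> M" "a < L" for i a using PU[OF that] by (simp add: W_def)
    show "2 * g \<le> L" by fact
  qed
  define F where "F = linear_pieces.F P M L"
  define As where "As = linear_pieces.ends P L g"
  define At where "At = linear_pieces.starts P g"
  interpret LP: linear_pieces "adj y" P M W L g for y by (rule pieces)
  have F_U: "F \<subseteq> U" using PU by (auto simp: F_def LP.F_def)
  have finF: "finite F" using F_U finite_U finite_subset by blast
  have cardF: "card F \<le> k"
  proof -
    have "P i a \<in> set q" if "i \<in> M" "a < L" for i a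
      using window_mem[OF q] that unfolding M_def P_def by blast
    then have "F \<subseteq> set q" by (auto simp: F_def LP.F_def)
    then have "card F \<le> card (set q)" by (intro card_mono) auto
    also have "\<dots> \<le> k" using card_length[of q] len by simp
    finally show ?thesis .
  qed
  have finW: "finite W" by (simp add: W_def)
  have WF: "W \<inter> F = {}" using F_U by (auto simp: W_def)
  have new: "{w, u} \<in> I" if "w \<in> W" "u \<in> F \<union> W" "u \<noteq> w" for w u
  proof -
    have "u \<in> {1..n}" "w \<in> {1..n}" "w \<notin> U" using that F_U U_sub by (auto simp: W_def)
    then show ?thesis using that by (auto simp: I_def pairs_def)
  qed
  have adj_new: "adj y w u \<longleftrightarrow> y {w, u}" if "w \<in> W" "u \<in> F \<union> W" "u \<noteq> w" for y w u
    using new[OF that] by (auto simp: adj_def I_def)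
  \<comment> \<open>The bound \<open>m\<close> on the size of \<open>C\<close> is available because
    the search never uses more connectors than there are pieces.\<close>
  define X where "X = {S. S \<subseteq> M} \<times> {T. T \<subseteq> M} \<times> {C. C \<subseteq> W \<and> card C \<le> m}"
  define ev where "ev = (\<lambda>(S, T, C) y. S \<inter> T = {} \<and> card S = s \<and> card T = s \<and>
     (\<forall>w\<in>W - C. \<not> (\<exists>u\<in>As S. \<exists>v\<in>At T. (\<forall>x\<in>F. y {w, x} \<longleftrightarrow> x = u \<or> x = v) \<and> (\<forall>c\<in>C. \<not> y {w, c}))))"
  have fail: "{y. \<not> has_path ((card M - 2 * s - 1) * (L - 2 * g)) (glue (pairs U) x y)}
    \<subseteq> {y. \<exists>z\<in>X. ev z y}"
  proof (rule subsetI, rule ccontr)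
    fix y assume y: "y \<in> {y. \<not> has_path ((card M - 2 * s - 1) * (L - 2 * g)) (glue (pairs U) x y)}"
      and "y \<notin> {y. \<exists>z\<in>X. ev z y}"
    then have no: "\<not> ev (S, T, C) y" if "S \<subseteq> M" "T \<subseteq> M" "C \<subseteq> W" "card C \<le> m" for S T C
      using that by (auto simp: X_def)
    have "\<exists>js ws. valid_chain (LP.conn y) (adj y) js ws \<and> distinct js \<and> set js \<subseteq> M \<and> set ws \<subseteq> W \<and>
      card M \<le> length js + 2 * s"
    proof (rule long_chain_exists[OF finM])
      fix S T C assume *: "S \<subseteq> M" "T \<subseteq> M" "S \<inter> T = {}" "card S = s" "card T = s" "C \<subseteq> W" "finite C" "card C \<le> card M"
      have "\<not> ev (S, T, C) y" using * M_le by (intro no) auto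
      then obtain w u v where w: "w \<in> W - C" "u \<in> As S" "v \<in> At T"
         "\<forall>x\<in>F. y {w, x} \<longleftrightarrow> x = u \<or> x = v" "\<forall>c\<in>C. \<not> y {w, c}"
        using * by (auto simp: ev_def)
      have "\<forall>x\<in>F. adj y w x \<longleftrightarrow> x = u \<or> x = v"
      proof
        fix z assume "z \<in> F"
        moreover have "z \<noteq> w" using w WF \<open>z \<in> F\<close> by auto
        ultimately show "adj y w z \<longleftrightarrow> z = u \<or> z = v" using w adj_new[of w z y] by auto
      qed
      then have "\<exists>i\<in>S. \<exists>j\<in>T. LP.conn y i w j"
        using w LP.conn_if_ends_starts[of u S v T y w] by (simp add: As_def At_def F_def)
      moreover have "\<forall>c\<in>C. \<not> adj y w c"
      proof
        fix c assume c: "c \<in> C"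
        then have "c \<in> F \<union> W" "c \<noteq> w" using * w(1) by auto
        then show "\<not> adj y w c" using w c adj_new[of w c y] by blast
      qed
      ultimately show "\<exists>i\<in>S. \<exists>j\<in>T. \<exists>w\<in>W - C. LP.conn y i w j \<and> (\<forall>c\<in>C. \<not> adj y w c)"
        using w(1) by blast
    qed
    then obtain js ws where chain: "valid_chain (LP.conn y) (adj y) js ws" "distinct js" "set js \<subseteq> M"
       "set ws \<subseteq> W" "card M \<le> length js + 2 * s" by auto
    have "js \<noteq> []" using chain(5) s by (auto simp: M_def)
    from LP.chain_to_path[OF chain(1) this chain(2-4) g(1)] obtain vs c where
      vs: "induced_list (adj y) vs" "vs \<noteq> []" "c < g" "hd vs = P (hd js) c"
        "set vs \<subseteq> {P (hd js) c} \<union> {P i a | i a. i \<in> set (tl js) \<and> a < L} \<union> set ws"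
        "length (tl js) * (L - 2 * g) + 1 \<le> length vs" by auto
    let ?E = "{e \<in> pairs {1..n}. glue (pairs U) x y e}"
    have "distinct vs \<and> {e \<in> ?E. e \<subseteq> set vs} = path_edges vs"
      by (rule induced_list_path_edges) (use vs(1) in \<open>auto simp: adj_def[abs_def] pairs_def\<close>)
    moreover have "set vs \<subseteq> {1..n}"
    proof -
      have js: "hd js \<in> M" "set (tl js) \<subseteq> M"
        using chain(3) \<open>js \<noteq> []\<close> hd_in_set[of js] by (auto dest: list.set_sel(2))
      have "P (hd js) c \<in> U" using PU js vs(3) g by auto
      moreover have "{P i a | i a. i \<in> set (tl js) \<and> a < L} \<subseteq> U" using PU js by auto
      ultimately have "set vs \<subseteq> U \<union> W" using vs(5) chain(4) by blast
      then show ?thesis using U_sub by (auto simp: W_def)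
    qed
    ultimately have "is_induced_path {1..n} ?E vs"
      using vs(2) unfolding is_induced_path_def is_path_def by auto
    moreover have "(card M - 2 * s - 1) * (L - 2 * g) \<le> path_length vs"
    proof -
      have "(card M - 2 * s - 1) * (L - 2 * g) \<le> length (tl js) * (L - 2 * g)"
        using chain(5) by (intro mult_le_mono1) simp
      then show ?thesis using vs(6) unfolding path_length_def by linarith
    qed
    ultimately have "has_path ((card M - 2 * s - 1) * (L - 2 * g)) (glue (pairs U) x y)"
      unfolding has_path_def by blast
    then show False using y by simp
  qed
  define c where "c = exp (- ((s * g)\<^sup>2 * p\<^sup>2 * (1 - p) ^ (k + m) * (real (card W) - m)))"
  have ev_le: "measure_pmf.prob ?Q {y. ev z y} \<le> c" if "z \<in> X" for z
  proof (cases "real (card W) < m")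
    case True
    \<comment> \<open>With fewer than \<open>m\<close> vertices in the reservoir the exponent is
      nonnegative, so the bound is trivial.\<close>
    then have "c \<ge> 1" using p unfolding c_def
      by (simp add: mult_nonneg_nonpos)
    then show ?thesis using measure_pmf.prob_le_1[of ?Q "{y. ev z y}"] by linarith
  next
    case False
    from that obtain S T C where z: "z = (S, T, C)" "S \<subseteq> M" "T \<subseteq> M" "C \<subseteq> W" "card C \<le> m"
      by (auto simp: X_def)
    show ?thesis
    proof (cases "S \<inter> T = {} \<and> card S = s \<and> card T = s")
      case ST: True
      have "measure_pmf.prob ?Q {y. ev z y} \<le>
        exp (- (card (As S) * card (At T) * p\<^sup>2 * (1 - p) ^ (card F + card C) * (real (card W) - card C)))"
        using ST unfolding z(1) ev_def prod.case
        using prob_no_link_le[OF _ finW WF finF _ _ _ z(4) new p, of "As S" "At T"]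
          LP.ends_starts[OF z(2,3)] by (simp add: I_def As_def At_def F_def)
      also have "\<dots> \<le> c"
      proof -
        have eq: "card (As S) = s * g" "card (At T) = s * g"
          using ST z(2,3) LP.card_ends[of S] LP.card_starts[of T] by (simp_all add: As_def At_def)
        have "(1 - p) ^ (k + m) * (real (card W) - m) \<le> (1 - p) ^ (card F + card C) * (real (card W) - card C)"
          using p cardF z(5) False by (intro mult_mono power_decreasing) auto
        moreover have "0 \<le> (real s * real g)\<^sup>2 * p\<^sup>2" by simp
        ultimately have "(real s * real g)\<^sup>2 * p\<^sup>2 * ((1 - p) ^ (k + m) * (real (card W) - m))
          \<le> (real s * real g)\<^sup>2 * p\<^sup>2 * ((1 - p) ^ (card F + card C) * (real (card W) - card C))"
          by (rule mult_left_mono)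
        then show ?thesis
          unfolding c_def eq exp_le_cancel_iff neg_le_iff_le by (simp add: power2_eq_square mult_ac)
      qed
      finally show ?thesis .
    next
      case False
      then have "{y. ev z y} = {}" by (auto simp: z(1) ev_def)
      then show ?thesis by (simp add: c_def)
    qed
  qed
  have finX: "finite X" using finM finW by (auto simp: X_def)
  have cardX: "real (card X) \<le> (4 * D) ^ m * exp (card W / D)"
  proof -
    have "real (card X) = 2 ^ card M * 2 ^ card M * real (card {C. C \<subseteq> W \<and> card C \<le> m})"
      using finM by (simp add: X_def card_cartesian_product card_Pow flip: Pow_def)
    also have "\<dots> \<le> 2 ^ m * 2 ^ m * (D ^ m * exp (card W / D))"
      using M_le by (intro mult_mono card_small_subsets_le finW D power_increasing) auto
    also have "\<dots> = (4 * D) ^ m * exp (card W / D)"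
      by (simp add: power_mult_distrib flip: power_mult_distrib[of 2 2])
    finally show ?thesis .
  qed
  have "measure_pmf.prob ?Q {y. \<not> has_path ((card M - 2 * s - 1) * (L - 2 * g)) (glue (pairs U) x y)}
    \<le> measure_pmf.prob ?Q {y. \<exists>z\<in>X. ev z y}"
    by (rule measure_pmf.finite_measure_mono[OF fail]) simp
  also have "\<dots> \<le> ((4 * D) ^ m * exp (card W / D)) * c"
    by (rule prob_Union_le[OF finX ev_le cardX]) (simp_all add: c_def)
  finally show ?thesis by (simp add: M_def I_def c_def)
qed

text \<open>The pairs inside \<open>U\<close> are exposed first; the remaining ones are then used to link the pieces.\<close>

lemma prob_no_path_le:
  fixes p D :: real and L g s k t :: nat
  assumes k: "k \<le> B" and p: "0 \<le> p" "p \<le> 1" and D: "D \<ge> 1"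
    and g: "0 < g" "2 * g \<le> L" and s: "2 * s + t \<le> k div Suc L"
  defines "W \<equiv> {1..n} - U" and "m \<equiv> k div Suc L"
    and "Q \<equiv> Pi_pmf (pairs {1..n}) False (\<lambda>_. bernoulli_pmf p)"
  shows "measure_pmf.prob Q {\<omega>. \<not> has_path ((m - t - 2 * s) * (L - 2 * g)) \<omega>} \<le>
    measure_pmf.prob Q {\<omega>. real (min_defects k \<omega>) \<ge> t} +
    (4 * D) ^ m * exp (card W / D) *
      exp (- ((s * g)\<^sup>2 * p\<^sup>2 * (1 - p) ^ (k + m) * (real (card W) - m)))"
proof -
  let ?l = "(m - t - 2 * s) * (L - 2 * g)"
  let ?Q' = "Pi_pmf (pairs {1..n} - pairs U) False (\<lambda>_. bernoulli_pmf p)"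
  define \<eta> where "\<eta> = (4 * D) ^ m * exp (card W / D) *
      exp (- ((s * g)\<^sup>2 * p\<^sup>2 * (1 - p) ^ (k + m) * (real (card W) - m)))"
  have sub: "pairs U \<subseteq> pairs {1..n}" using U_sub by (auto simp: pairs_def)
  have mono: "has_path l \<omega>" if "has_path l' \<omega>" "l \<le> l'" for l l' \<omega>
    using that order_trans unfolding has_path_def by blast
  have "measure_pmf.prob Q {\<omega>. min_defects k \<omega> < t \<and> \<not> has_path ?l \<omega>} \<le> \<eta>"
    unfolding Q_def
  proof (rule prob_Pi_pmf_split_le[OF _ sub])
    fix x :: "nat set \<Rightarrow> bool"
    \<comment> \<open>The second round cannot change the number of defects.\<close>
    have eq: "min_defects k (glue (pairs U) x y) = min_defects k x" for y
      by (rule depends_onD[OF depends_on_min_defects]) simp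
    show "measure_pmf.prob ?Q' {y. min_defects k (glue (pairs U) x y) < t \<and> \<not> has_path ?l (glue (pairs U) x y)} \<le> \<eta>"
    proof (cases "min_defects k x < t")
      case True
      obtain q where q: "q \<in> spread k" "min_defects k x = defects x q"
        using min_defects_attained[OF k] by metis
      have card: "m < card (good_windows L x q) + t"
        using card_good_windows[OF q(1), of L x] True q(2) by (simp add: m_def)
      have "measure_pmf.prob ?Q' {y. min_defects k (glue (pairs U) x y) < t \<and> \<not> has_path ?l (glue (pairs U) x y)}
        \<le> measure_pmf.prob ?Q' {y. \<not> has_path ((card (good_windows L x q) - 2 * s - 1) * (L - 2 * g)) (glue (pairs U) x y)}"
      proof (rule measure_pmf.finite_measure_mono)
        \<comment> \<open>Strictly fewer than \<open>t\<close> defects leave one window more than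
          \<open>m - t\<close>, which pays for the untraversed last piece.\<close>
        have "?l \<le> (card (good_windows L x q) - 2 * s - 1) * (L - 2 * g)"
          using card by (intro mult_le_mono1) simp
        then show "{y. min_defects k (glue (pairs U) x y) < t \<and> \<not> has_path ?l (glue (pairs U) x y)} \<subseteq>
          {y. \<not> has_path ((card (good_windows L x q) - 2 * s - 1) * (L - 2 * g)) (glue (pairs U) x y)}"
          using mono by blast
      qed simp
      also have "\<dots> \<le> \<eta>" unfolding \<eta>_def W_def m_def
        by (rule prob_connect_fail) (use q p D g s card in \<open>auto simp: m_def\<close>)
      finally show ?thesis .
    next
      case False
      then show ?thesis using D by (simp add: eq \<eta>_def)
    qed
  qed simp
  moreover have "measure_pmf.prob Q {\<omega>. \<not> has_path ?l \<omega>} \<le>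
    measure_pmf.prob Q ({\<omega>. real (min_defects k \<omega>) \<ge> t} \<union> {\<omega>. min_defects k \<omega> < t \<and> \<not> has_path ?l \<omega>})"
    by (rule measure_pmf.finite_measure_mono) auto
  moreover have "\<dots> \<le> measure_pmf.prob Q {\<omega>. real (min_defects k \<omega>) \<ge> t} +
     measure_pmf.prob Q {\<omega>. min_defects k \<omega> < t \<and> \<not> has_path ?l \<omega>}"
    by (rule measure_Un_le) simp_all
  ultimately show ?thesis unfolding \<eta>_def by linarith
qed

end

section \<open>Choice of the parameters\<close>

lemma sum_power_le_geometric:
  fixes y :: real
  assumes "0 \<le> y" "y \<le> 1 / 2"
  shows "(\<Sum>l\<in>{m<..k}. y ^ l) \<le> 2 * y"
proof -
  have "(\<Sum>l\<in>{1..k}. y ^ l) \<le> 2 * y - 2 * y * y ^ k"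
  proof (induction k)
    case (Suc k)
    have "2 * y * y ^ Suc k \<le> y ^ Suc k"
      using mult_right_mono[of "2 * y" 1 "y ^ Suc k"] assms by simp
    then show ?case using Suc by simp
  qed simp
  also have "\<dots> \<le> 2 * y" using assms by simp
  finally have "(\<Sum>l\<in>{1..k}. y ^ l) \<le> 2 * y" .
  moreover have "(\<Sum>l\<in>{m<..k}. y ^ l) \<le> (\<Sum>l\<in>{1..k}. y ^ l)"
    using assms by (intro sum_mono2) auto
  ultimately show ?thesis by linarith
qed

text \<open>On the interval from 0 to \<open>u\<close> the convex exponential lies below its chord;
  the term \<open>- t\<close> of the chord is dropped.\<close>

lemma exp_le_chord:
  fixes u t :: real
  assumes "0 \<le> t" "t \<le> 1" "0 \<le> u"
  shows "exp (t * u) \<le> 1 + t * exp u"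
proof -
  have "exp (u * ((1 - t) * 0 + t * 1)) \<le> (1 - t) * exp (u * 0) + t * exp (u * 1)"
    using convex_onD[OF convex_on_exp[OF assms(3)], of t 0 1] assms by simp
  then show ?thesis using assms by (simp add: mult.commute)
qed

lemma graph_blocks_interval:
  assumes "b > 0" "B * b \<le> n"
  shows "graph_blocks {1..B * b} (\<lambda>v. (v - 1) div b) B b n"
proof
  show "(v - 1) div b < B" if "v \<in> {1..B * b}" for v
    using that assms by (auto simp: less_mult_imp_div_less)
  show "card {v \<in> {1..B * b}. (v - 1) div b = j} = b" if "j < B" for j
  proof -
    have "{v \<in> {1..B * b}. (v - 1) div b = j} = {j * b + 1..j * b + b}"
    proof (intro equalityI subsetI)
      fix v assume v: "v \<in> {v \<in> {1..B * b}. (v - 1) div b = j}"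
      then have "j * b \<le> v - 1" "v - 1 < j * b + b"
        using div_times_less_eq_dividend[of "v - 1" b] dividend_less_div_times[of b "v - 1"] assms by auto
      moreover have "1 \<le> v" using v by simp
      ultimately show "v \<in> {j * b + 1..j * b + b}" unfolding atLeastAtMost_iff by linarith
    next
      fix v assume v: "v \<in> {j * b + 1..j * b + b}"
      have "Suc j * b \<le> B * b" using that by (intro mult_le_mono1) simp
      moreover have "(v - 1) div b = j"
        using v assms by (intro div_nat_eqI) (auto simp: mult.commute[of b])
      ultimately show "v \<in> {v \<in> {1..B * b}. (v - 1) div b = j}" using v by auto
    qed
    then show ?thesis by simp
  qed
qed (use assms in auto)

text \<open>Here \<open>\<gamma> = \<epsilon>/32\<close>. All factors \<open>d\<close> to the power \<open>O(\<gamma>)\<close> are expressed as powers of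
  \<open>x = d powr \<gamma>\<close>, which dominates all powers of \<open>ln d\<close> that occur.\<close>

locale regime =
  fixes \<gamma> d :: real and n :: nat
  assumes \<gamma>: "0 < \<gamma>" "\<gamma> \<le> 1 / 32" and d1: "1 < d" and ln_d: "1 \<le> ln d"
    and x_large: "20000 / \<gamma>\<^sup>2 * ln d ^ 4 \<le> d powr \<gamma>" and r_large: "600 / \<gamma> \<le> n / d"
begin

definition \<Lambda> :: real where "\<Lambda> = ln d"
definition x :: real where "x = d powr \<gamma>"
definition r :: real where "r = n / d"
definition p :: real where "p = d / n"
text \<open>The target 2 (n/d) log d lowered by a fraction 8 \<gamma>. This margin drives both the
  second moment and the linking. The divisor 4 in \<open>b\<close> below restricts the 2k blocks to
  at most half of the vertices.\<close>

definition k :: nat where "k = nat \<lfloor>(2 - 16 * \<gamma>) * (r * \<Lambda>)\<rfloor>"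
definition b :: nat where "b = n div (4 * k)"

lemma \<Lambda>: "1 \<le> \<Lambda>" using ln_d by (simp add: \<Lambda>_def)
lemma \<Lambda>4: "\<Lambda> \<le> \<Lambda> ^ 4" "\<Lambda>\<^sup>2 \<le> \<Lambda> ^ 4" using \<Lambda> by (auto intro: power_increasing simp: self_le_power)
lemma r_ge: "600 / \<gamma> \<le> r" using r_large by (simp add: r_def)
lemma r600: "19200 \<le> r"
proof -
  have "19200 \<le> 600 / \<gamma>" using \<gamma> by (simp add: field_simps)
  then show ?thesis using r_ge by linarith
qed
lemma n_pos: "0 < real n" using r600 d1 unfolding r_def by (cases "n = 0") auto
lemma n_eq: "real n = r * d" using d1 by (simp add: r_def)
lemma p_eq: "p = 1 / r" by (simp add: p_def r_def)

lemma x_ge: "20000 / \<gamma>\<^sup>2 * \<Lambda> ^ 4 \<le> x" using x_large by (simp add: \<Lambda>_def x_def)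
lemma x_ge': "20000 * \<Lambda> ^ 4 \<le> x"
proof -
  have "1 \<le> 1 / \<gamma>\<^sup>2" using \<gamma> power_mono[of \<gamma> 1 2] by (simp add: field_simps)
  then have "20000 * \<Lambda> ^ 4 * 1 \<le> 20000 * \<Lambda> ^ 4 * (1 / \<gamma>\<^sup>2)" using \<Lambda> by (intro mult_left_mono) auto
  then show ?thesis using x_ge by simp
qed
lemma x_\<Lambda>: "20000 * \<Lambda> \<le> x" "20000 * \<Lambda>\<^sup>2 \<le> x" using x_ge' \<Lambda>4 by linarith+
lemma x20000: "20000 \<le> x" using x_\<Lambda> \<Lambda> by linarith

lemma x32: "x ^ 32 \<le> d"
proof -
  have "x ^ 32 = d powr (32 * \<gamma>)"
    using d1 by (simp add: x_def powr_power mult.commute)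
  also have "\<dots> \<le> d powr 1" using d1 \<gamma> by (intro powr_mono) auto
  finally show ?thesis using d1 by simp
qed

lemma x_pow_le_d: "i \<le> 32 \<Longrightarrow> x ^ i \<le> d"
  using power_increasing[of i 32 x] x20000 x32 by linarith

text \<open>The scale of both main estimates: it bounds exp(h k) in the second moment, and the
  inverse of its square is the order of (1-p)^k in the linking.\<close>

lemma exp_eq: "exp ((1 - 4 * \<gamma>) * \<Lambda>) = d / x ^ 4"
proof -
  have "exp ((1 - 4 * \<gamma>) * \<Lambda>) = d powr (1 - 4 * \<gamma>)" using d1 by (simp add: powr_def \<Lambda>_def)
  also have "\<dots> = d powr 1 / d powr (4 * \<gamma>)" by (rule powr_diff)
  also have "d powr (4 * \<gamma>) = x ^ 4" using d1 by (simp add: x_def powr_power mult.commute)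
  finally show ?thesis using d1 by simp
qed

lemma Y600: "19200 \<le> r * \<Lambda>" using mult_mono[OF r600 \<Lambda>] r600 by simp

lemma k_le: "real k \<le> (2 - 16 * \<gamma>) * (r * \<Lambda>)"
  unfolding k_def using \<gamma> r600 \<Lambda> by (intro of_nat_floor mult_nonneg_nonneg) auto
lemma k_ge: "(2 - 16 * \<gamma>) * (r * \<Lambda>) - 1 \<le> real k"
  unfolding k_def by linarith
lemma k_le': "real k \<le> 2 * (r * \<Lambda>)"
proof -
  have "(2 - 16 * \<gamma>) * (r * \<Lambda>) \<le> 2 * (r * \<Lambda>)" using \<gamma> Y600 by (intro mult_right_mono) auto
  then show ?thesis using k_le by linarith
qed
lemma k_ge': "r * \<Lambda> \<le> real k"
proof -
  have "(3 / 2) * (r * \<Lambda>) \<le> (2 - 16 * \<gamma>) * (r * \<Lambda>)" using \<gamma> Y600 by (intro mult_right_mono) auto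
  then show ?thesis using k_ge Y600 by linarith
qed
lemma k_pos: "0 < k" using k_ge' Y600 by (cases k) auto

lemma kb_le: "4 * k * b \<le> n" by (simp add: b_def)
lemma b_pos': "0 < b"
proof -
  have "8 * \<Lambda> \<le> d" using x_\<Lambda> \<Lambda> x_pow_le_d[of 1] by simp
  then have "r * (8 * \<Lambda>) \<le> r * d" using r600 by (intro mult_left_mono) auto
  then have "real (4 * k) \<le> real n" using k_le' n_eq by simp
  then show ?thesis unfolding b_def using k_pos by (simp add: div_greater_zero_iff)
qed
lemma kb_ge: "n \<le> 8 * k * b"
proof -
  have "n < (n div (4 * k)) * (4 * k) + 4 * k"
    using dividend_less_div_times[of "4 * k" n] k_pos by (simp add: add.commute)
  moreover have "4 * k \<le> b * (4 * k)" using b_pos' by simp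
  ultimately have "n \<le> b * (4 * k) + b * (4 * k)" unfolding b_def by linarith
  also have "\<dots> = 8 * k * b" by simp
  finally show ?thesis .
qed

text \<open>With twice as many blocks as path vertices, at least \<open>k\<close> blocks stay free
  throughout. So there are always at least k b \<ge> n/8 choices for the next vertex.\<close>

sublocale graph_blocks "{1..2 * k * b}" "\<lambda>v. (v - 1) div b" "2 * k" b n
  by (rule graph_blocks_interval) (use b_pos' kb_le in auto)

abbreviation Q :: "(nat set \<Rightarrow> bool) pmf" where
  "Q \<equiv> Pi_pmf (pairs {1..n}) False (\<lambda>_. bernoulli_pmf p)"

lemma p_bounds: "0 < p" "p < 1" "p \<le> 2 * \<gamma>"
proof -
  show "0 < p" using r600 by (simp add: p_eq)
  show "p < 1" using r600 by (simp add: p_eq)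
  have "1 / (2 * \<gamma>) \<le> 600 / \<gamma>" using \<gamma> by (simp add: field_simps)
  then have "1 / (2 * \<gamma>) \<le> r" using r_ge by linarith
  then show "p \<le> 2 * \<gamma>" using \<gamma> r600 by (simp add: p_eq field_simps)
qed

lemma inverse_1_minus_p: "1 / (1 - p) \<le> exp (p * (1 + 4 * \<gamma>))"
proof -
  have "p * (1 + 4 * \<gamma>) * (1 - p) - p = p * (4 * \<gamma> * (1 - p) - p)" by (simp add: algebra_simps)
  moreover have "p \<le> 4 * \<gamma> * (1 - p)"
  proof -
    have "4 * \<gamma> * (1 / 2) \<le> 4 * \<gamma> * (1 - p)" using p_bounds \<gamma> by (intro mult_left_mono) auto
    then show ?thesis using p_bounds by linarith
  qed
  ultimately have "p \<le> p * (1 + 4 * \<gamma>) * (1 - p)" using p_bounds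
    by (metis diff_ge_0_iff_ge less_imp_le mult_nonneg_nonneg)
  then have "1 / (1 - p) \<le> 1 + p * (1 + 4 * \<gamma>)"
    using p_bounds by (simp add: field_simps)
  also have "\<dots> \<le> exp (p * (1 + 4 * \<gamma>))" by (rule exp_ge_add_one_self)
  finally show ?thesis .
qed

text \<open>The margin in \<open>k\<close> is spent here: (1 + 4 \<gamma>)(1 - 8 \<gamma>) \<le> 1 -
  4 \<gamma>, where the first factor is the cost of replacing - ln (1 - p) by a multiple of
  \<open>p\<close>.\<close>

lemma pk_le: "p * (1 + 4 * \<gamma>) * k \<le> 2 * (1 - 4 * \<gamma>) * \<Lambda>"
proof -
  have "p * (1 + 4 * \<gamma>) * k \<le> p * (1 + 4 * \<gamma>) * ((2 - 16 * \<gamma>) * (r * \<Lambda>))"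
    using k_le p_bounds \<gamma> by (intro mult_left_mono) auto
  also have "\<dots> = 2 * ((1 + 4 * \<gamma>) * (1 - 8 * \<gamma>)) * \<Lambda>"
    using r600 by (simp add: p_eq field_simps)
  also have "\<dots> \<le> 2 * (1 - 4 * \<gamma>) * \<Lambda>"
    using \<Lambda> by (intro mult_right_mono) (auto simp: algebra_simps)
  finally show ?thesis .
qed

text \<open>An upper bound for k/b, which is twice the expected number of common vertices of two
  random potential paths.\<close>

definition A :: real where "A = 32 * r * \<Lambda>\<^sup>2 / d"

lemma A_pos: "0 < A" using r600 \<Lambda> d1 by (simp add: A_def)

lemma k_over_b: "k / b \<le> A"
proof -
  have n8: "real n \<le> 8 * k * b" using kb_ge by (metis of_nat_le_iff of_nat_mult of_nat_numeral)
  have "k / b \<le> 8 * real k * real k / n"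
    using n8 b_pos' n_pos mult_left_mono[OF n8, of "real k"] by (simp add: field_simps)
  also have "\<dots> \<le> 8 * (2 * (r * \<Lambda>)) * (2 * (r * \<Lambda>)) / n"
    using k_le' n_pos \<Lambda> r600 by (intro divide_right_mono mult_mono) auto
  also have "\<dots> = A" using r600 d1 by (simp add: A_def n_eq power2_eq_square field_simps)
  finally show ?thesis .
qed

lemma A_over_k: "A \<le> 32 * \<Lambda> / d * k"
proof -
  have "A = 32 * \<Lambda> / d * (r * \<Lambda>)" by (simp add: A_def power2_eq_square)
  also have "\<dots> \<le> 32 * \<Lambda> / d * k" using k_ge' \<Lambda> d1 by (intro mult_left_mono) auto
  finally show ?thesis .
qed

text \<open>The exponential accounts for the typical small overlaps. Larger overlaps form a
  geometric series of ratio e/x, which gives the term 6/x.\<close>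

lemma prob_induced_ge:
  "1 \<le> (exp (r * x ^ 3 / d\<^sup>2) + 6 / x) * measure_pmf.prob Q {\<omega>. \<exists>q\<in>spread k. induces \<omega> q}"
proof -
  \<comment> \<open>With this \<open>h\<close>, an overlap of \<open>l\<close> vertices costs at
    most exp(h l^2). The factor exp(h l) of \<open>z l\<close> cancels this cost in (1/z)^l, and the
    factor \<open>x\<close> leaves the decay x^(-l).\<close>
  define h where "h = p * (1 + 4 * \<gamma>) / 2"
  define z where "z l = (if l = 0 then 1 else x * exp (h * real l))" for l :: nat
  \<comment> \<open>Given \<theta> \<le> 2 and n \<le> 8 k b, the condition 2 z \<theta> / p \<le>
    (\<theta> - 1) k b follows from 4 z r \<le> (32 z / d) (n / 8), which holds with
    equality.\<close>
  define \<theta> where "\<theta> l = 1 + 32 * z l / d" for l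
  \<comment> \<open>Above 4 A x, the part \<open>x\<close> of \<open>z l\<close> contributes at most
    l/2 to the exponent 2 A z. Up to there, even the worst cost exp(h m^2) stays within exp(r x^3 /
    d^2), with room for the factor coming from \<theta>.\<close>
  define m where "m = nat \<lfloor>4 * A * x\<rfloor>"
  let ?c = "\<lambda>l. (1 / (1 - p)) ^ (l choose 2)"
  define R where "R = ?c m * exp (k * (\<theta> 0 - 1) / b) +
      (\<Sum>l\<in>{m<..k}. ?c l * (1 / z l) ^ l * exp (k * (z l * \<theta> l - 1) / b))"
  have x0: "0 < x" "1 \<le> x" using x20000 by auto
  have h0: "0 \<le> h" using p_bounds \<gamma> by (simp add: h_def)
  have hp: "h \<le> p"
  proof -
    have "p * (1 + 4 * \<gamma>) \<le> p * 2" using p_bounds \<gamma> by (intro mult_left_mono) auto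
    then show ?thesis by (simp add: h_def)
  qed
  have hk: "exp (h * k) \<le> d / x ^ 4"
  proof -
    have "h * k = p * (1 + 4 * \<gamma>) * k / 2" by (simp add: h_def)
    then have "h * k \<le> (1 - 4 * \<gamma>) * \<Lambda>" using pk_le by linarith
    then show ?thesis unfolding exp_eq[symmetric] by simp
  qed
  have z1: "1 \<le> z l" for l
    using mult_mono[of 1 x 1 "exp (h * real l)"] x0 h0 by (auto simp: z_def)
  have zx: "z l \<le> x * exp (h * l)" for l
    using x0 by (auto simp: z_def)
  have zd: "z l \<le> d / x ^ 3" if "l \<le> k" for l
  proof -
    have "exp (h * l) \<le> exp (h * k)" using that h0 by (simp add: mult_left_mono)
    also note hk
    finally have "x * exp (h * l) \<le> x * (d / x ^ 4)" using x0 by (intro mult_left_mono) auto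
    then show ?thesis using zx[of l] x0 by (simp add: power_numeral_reduce)
  qed
  have z32: "32 * z l / d \<le> 1" if "l \<le> k" for l
  proof -
    have "32 * z l / d \<le> 32 * (d / x ^ 3) / d" using zd[OF that] d1 by (intro divide_right_mono mult_left_mono) auto
    also have "\<dots> = 32 / x ^ 3" using d1 by simp
    also have "\<dots> \<le> 1" using x20000 self_le_power[of x 3] by simp
    finally show ?thesis .
  qed
  have \<theta>1: "1 \<le> \<theta> l" for l using z1[of l] d1 by (simp add: \<theta>_def)
  have \<theta>2: "\<theta> l \<le> 2" if "l \<le> k" for l using z32[OF that] by (simp add: \<theta>_def)
  have fst: "1 \<le> R * measure_pmf.prob Q {\<omega>. \<exists>q\<in>spread k. induces \<omega> q}"
    unfolding R_def
  proof (rule second_moment_paths)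
    fix l assume l: "l \<le> k"
    have n8: "real n \<le> 8 * k * b" using kb_ge by (metis of_nat_le_iff of_nat_mult of_nat_numeral)
    have "2 * z l * \<theta> l / p = 2 * z l * \<theta> l * r" by (simp add: p_eq)
    also have "\<dots> \<le> 2 * z l * 2 * r" using z1[of l] \<theta>2[OF l] r600 by (intro mult_right_mono mult_left_mono) auto
    also have "\<dots> = 32 * z l / d * (n / 8)" using d1 by (simp add: n_eq)
    also have "\<dots> \<le> 32 * z l / d * (k * b)" using n8 z1[of l] d1 by (intro mult_left_mono) auto
    finally show "2 * z l * \<theta> l / p \<le> (\<theta> l - 1) * real ((2 * k - k) * b)" by (simp add: \<theta>_def)
  qed (use z1 \<theta>1 p_bounds U_sub in \<open>auto simp: z_def pairs_def\<close>)
  have R: "R \<le> exp (r * x ^ 3 / d\<^sup>2) + 6 / x"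
  proof -
    have c_le: "?c l \<le> exp (h * (real l)\<^sup>2)" for l
    proof -
      have "?c l \<le> exp (p * (1 + 4 * \<gamma>)) ^ (l choose 2)"
        using inverse_1_minus_p p_bounds by (intro power_mono) auto
      also have "\<dots> = exp (h * real (2 * (l choose 2)))" by (simp add: exp_of_nat_mult[symmetric] h_def mult_ac)
      also have "\<dots> \<le> exp (h * (real l)\<^sup>2)"
      proof -
        have "2 * (l choose 2) \<le> l * (l - 1)" unfolding choose_two by (rule times_div_less_eq_dividend)
        also have "\<dots> \<le> l * l" by (intro mult_le_mono2) simp
        finally have "2 * (l choose 2) \<le> l * l" .
        then have "real (2 * (l choose 2)) \<le> (real l)\<^sup>2"
          unfolding power2_eq_square of_nat_mult[symmetric] by (simp only: of_nat_le_iff)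
        then show ?thesis using h0 by (simp add: mult_left_mono)
      qed
      finally show ?thesis .
    qed
    have "?c m * exp (k * (\<theta> 0 - 1) / b) \<le> exp (r * x ^ 3 / d\<^sup>2)"
    proof -
      have m: "real m \<le> 4 * A * x" unfolding m_def using A_pos x0 by (intro of_nat_floor) auto
      have "h * (real m)\<^sup>2 \<le> p * (4 * A * x)\<^sup>2" using hp m h0 p_bounds by (intro mult_mono power_mono) auto
      also have "\<dots> = 16384 * r * \<Lambda> ^ 4 * x\<^sup>2 / d\<^sup>2"
        using r600 by (simp add: A_def p_eq power2_eq_square power4_eq_xxxx field_simps)
      finally have 1: "?c m \<le> exp (16384 * r * \<Lambda> ^ 4 * x\<^sup>2 / d\<^sup>2)" using c_le[of m] by (meson exp_le_cancel_iff order_trans)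
      have "k * (\<theta> 0 - 1) / b = 32 / d * (k / b)" by (simp add: \<theta>_def z_def)
      also have "\<dots> \<le> 32 / d * A" using k_over_b d1 by (intro mult_left_mono) auto
      also have "\<dots> = 1024 * r * \<Lambda>\<^sup>2 / d\<^sup>2" by (simp add: A_def power2_eq_square)
      finally have 2: "exp (k * (\<theta> 0 - 1) / b) \<le> exp (1024 * r * \<Lambda>\<^sup>2 / d\<^sup>2)" by simp
      have "?c m * exp (k * (\<theta> 0 - 1) / b) \<le> exp (16384 * r * \<Lambda> ^ 4 * x\<^sup>2 / d\<^sup>2) * exp (1024 * r * \<Lambda>\<^sup>2 / d\<^sup>2)"
        using 1 2 by (intro mult_mono) auto
      also have "\<dots> = exp (r / d\<^sup>2 * (16384 * \<Lambda> ^ 4 * x\<^sup>2 + 1024 * \<Lambda>\<^sup>2))"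
        by (simp add: exp_add[symmetric] add_divide_distrib distrib_left mult_ac)
      also have "\<dots> \<le> exp (r / d\<^sup>2 * x ^ 3)"
      proof -
        have "\<Lambda>\<^sup>2 * 1 \<le> \<Lambda> ^ 4 * x\<^sup>2" using \<Lambda>4(2) x0 \<Lambda> by (intro mult_mono) auto
        moreover have "0 \<le> \<Lambda> ^ 4 * x\<^sup>2" by simp
        ultimately have "16384 * \<Lambda> ^ 4 * x\<^sup>2 + 1024 * \<Lambda>\<^sup>2 \<le> 20000 * \<Lambda> ^ 4 * x\<^sup>2"
          by linarith
        also have "\<dots> \<le> x * x\<^sup>2" using x_ge' by (intro mult_right_mono) auto
        also have "\<dots> = x ^ 3" by (simp add: power2_eq_square power3_eq_cube)
        finally have "r / d\<^sup>2 * (16384 * \<Lambda> ^ 4 * x\<^sup>2 + 1024 * \<Lambda>\<^sup>2) \<le> r / d\<^sup>2 * x ^ 3"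
          using r600 by (intro mult_left_mono) auto
        then show ?thesis by (simp only: exp_le_cancel_iff)
      qed
      finally show ?thesis by simp
    qed
    moreover have "(\<Sum>l\<in>{m<..k}. ?c l * (1 / z l) ^ l * exp (k * (z l * \<theta> l - 1) / b)) \<le> 6 / x"
    proof -
      have "?c l * (1 / z l) ^ l * exp (k * (z l * \<theta> l - 1) / b) \<le> (exp 1 / x) ^ l"
        if l: "l \<in> {m<..k}" for l
      proof -
        have l0: "l > 0" "l \<le> k" using l by auto
        have "?c l * (1 / z l) ^ l \<le> exp (h * (real l)\<^sup>2) * (1 / z l) ^ l"
          using c_le[of l] z1[of l] by (intro mult_right_mono) auto
        also have "\<dots> = exp (h * real l) ^ l * (1 / (x * exp (h * real l))) ^ l"
          using l0 by (simp add: z_def exp_of_nat_mult[symmetric] power2_eq_square mult_ac)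
        also have "\<dots> = (1 / x) ^ l"
          by (simp add: power_mult_distrib[symmetric])
        finally have 1: "?c l * (1 / z l) ^ l \<le> (1 / x) ^ l" .
        have "k * (z l * \<theta> l - 1) / b = (z l * \<theta> l - 1) * (k / b)" by simp
        also have "\<dots> \<le> (z l * 2) * A"
        proof (intro mult_mono k_over_b)
          have "z l * \<theta> l \<le> z l * 2" using z1[of l] \<theta>2[OF l0(2)] by (intro mult_left_mono) auto
          then show "z l * \<theta> l - 1 \<le> z l * 2" by linarith
        qed (use z1[of l] in auto)
        also have "\<dots> \<le> l" \<comment> \<open>by convexity of \<open>exp\<close>, it suffices to check both ends of the range of \<open>l\<close>\<close>
        proof -
          have "exp (h * l) = exp (real l / k * (h * k))" using k_pos by simp
          also have "\<dots> \<le> 1 + real l / k * exp (h * k)"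
            by (rule exp_le_chord) (use l0 k_pos h0 in auto)
          also have "\<dots> \<le> 1 + real l / k * (d / x ^ 4)" by (intro add_left_mono mult_left_mono hk) simp
          finally have "x * exp (h * l) \<le> x * (1 + real l / k * (d / x ^ 4))" using x0 by (intro mult_left_mono) auto
          also have "\<dots> = x + real l / k * (d / x ^ 3)"
            using x0 by (simp add: distrib_left power_numeral_reduce)
          finally have "z l \<le> x + real l / k * (d / x ^ 3)" using zx[of l] by linarith
          then have "(z l * 2) * A \<le> ((x + real l / k * (d / x ^ 3)) * 2) * A"
            using A_pos by (intro mult_right_mono) auto
          also have "\<dots> = 2 * A * x + 2 * real l / k * (d / x ^ 3) * A" by (simp add: algebra_simps)
          also have "2 * A * x \<le> l / 2"
          proof -
            have "4 * A * x < m + 1" unfolding m_def by linarith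
            moreover have "real m + 1 \<le> l" using l by simp
            ultimately show ?thesis by simp
          qed
          also have "2 * real l / k * (d / x ^ 3) * A \<le> 2 * real l / k * (d / x ^ 3) * (32 * \<Lambda> / d * k)"
            using A_over_k d1 x0 by (intro mult_left_mono) auto
          also have "\<dots> = l * (64 * \<Lambda> / x ^ 3)" using k_pos d1 by (simp add: field_simps)
          also have "\<dots> \<le> l * (1 / 2)"
          proof -
            have "64 * \<Lambda> * 2 \<le> x" using x_\<Lambda> \<Lambda> by linarith
            also have "x \<le> x ^ 3" using x0 by (intro self_le_power) auto
            finally show ?thesis using x0 by (intro mult_left_mono) (auto simp: field_simps)
          qed
          finally show ?thesis by simp
        qed
        finally have "exp (k * (z l * \<theta> l - 1) / b) \<le> exp (real l)" by simp
        with 1 have "?c l * (1 / z l) ^ l * exp (k * (z l * \<theta> l - 1) / b) \<le> (1 / x) ^ l * exp (real l)"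
          using x0 by (intro mult_mono) auto
        also have "exp (real l) = exp 1 ^ l" by (simp add: exp_of_nat_mult[symmetric])
        finally show ?thesis by (simp add: power_mult_distrib[symmetric] power_divide)
      qed
      then have "(\<Sum>l\<in>{m<..k}. ?c l * (1 / z l) ^ l * exp (k * (z l * \<theta> l - 1) / b)) \<le> (\<Sum>l\<in>{m<..k}. (exp 1 / x) ^ l)"
        by (rule sum_mono)
      also have "\<dots> \<le> 2 * (exp 1 / x)"
      proof (rule sum_power_le_geometric)
        show "exp 1 / x \<le> 1 / 2" using x20000 exp_le by (simp add: field_simps)
      qed (use x0 in simp)
      also have "\<dots> \<le> 6 / x" using x0 exp_le by (simp add: divide_right_mono)
      finally show ?thesis .
    qed
    ultimately show ?thesis unfolding R_def by (rule add_mono)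
  qed
  note fst
  also from R have "R * measure_pmf.prob Q {\<omega>. \<exists>q\<in>spread k. induces \<omega> q} \<le>
    (exp (r * x ^ 3 / d\<^sup>2) + 6 / x) * measure_pmf.prob Q {\<omega>. \<exists>q\<in>spread k. induces \<omega> q}"
    by (rule mult_right_mono) simp
  finally show ?thesis .
qed

end

section \<open>The dense and the sparse case\<close>

context regime
begin

definition long_path :: "(nat set \<Rightarrow> bool) \<Rightarrow> bool" where
  "long_path \<omega> \<longleftrightarrow> (\<exists>vs. is_induced_path {1..n} {e \<in> pairs {1..n}. \<omega> e} vs \<and>
     (2 - 32 * \<gamma>) * (r * \<Lambda>) \<le> real (path_length vs))"

lemma \<gamma>Y: "600 \<le> \<gamma> * (r * \<Lambda>)"
proof -
  have "600 \<le> \<gamma> * r" using r_ge \<gamma> by (simp add: field_simps)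
  also have "\<dots> \<le> \<gamma> * (r * \<Lambda>)" using r600 \<Lambda> \<gamma> by (intro mult_left_mono) auto
  finally show ?thesis .
qed

text \<open>Here the exponent r x^3 / d^2 is at most 1/x, so the second moment needs no boosting; a
  single induced potential path is already long enough.\<close>

lemma prob_long_path_dense:
  assumes "r * x ^ 4 \<le> d\<^sup>2"
  shows "1 \<le> (exp (1 / x) + 6 / x) * measure_pmf.prob Q {\<omega>. long_path \<omega>}"
proof -
  have x0: "0 < x" using x20000 by simp
  have "r * x ^ 3 / d\<^sup>2 \<le> 1 / x"
    using assms x0 d1 by (simp add: field_simps power_numeral_reduce)
  then have "exp (r * x ^ 3 / d\<^sup>2) + 6 / x \<le> exp (1 / x) + 6 / x" by simp
  moreover have "measure_pmf.prob Q {\<omega>. \<exists>q\<in>spread k. induces \<omega> q} \<le> measure_pmf.prob Q {\<omega>. long_path \<omega>}"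
  proof (rule measure_pmf.finite_measure_mono)
    show "{\<omega>. \<exists>q\<in>spread k. induces \<omega> q} \<subseteq> {\<omega>. long_path \<omega>}"
    proof clarify
      fix \<omega> q assume q: "q \<in> spread k" "induces \<omega> q"
      have "length q = k" using q(1) unfolding spread_def by blast
      then have "is_induced_path {1..n} {e \<in> pairs {1..n}. \<omega> e} q"
        using q distinct_spread[OF q(1)] spread_subset[OF q(1)] U_sub k_pos
        by (intro is_induced_path_induces) auto
      moreover have "(2 - 32 * \<gamma>) * (r * \<Lambda>) \<le> real (path_length q)"
      proof -
        have "(2 - 32 * \<gamma>) * (r * \<Lambda>) = (2 - 16 * \<gamma>) * (r * \<Lambda>) - 16 * (\<gamma> * (r * \<Lambda>))"
          by (simp add: algebra_simps)
        also have "\<dots> \<le> real k - 1" using \<gamma>Y k_ge by linarith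
        finally show ?thesis using \<open>length q = k\<close> k_pos by (simp add: path_length_def of_nat_diff)
      qed
      ultimately show "long_path \<omega>" unfolding long_path_def by blast
    qed
  qed simp
  ultimately have "(exp (r * x ^ 3 / d\<^sup>2) + 6 / x) * measure_pmf.prob Q {\<omega>. \<exists>q\<in>spread k. induces \<omega> q}
    \<le> (exp (1 / x) + 6 / x) * measure_pmf.prob Q {\<omega>. long_path \<omega>}"
    using x0 by (intro mult_mono) auto
  with prob_induced_ge show ?thesis by linarith
qed

lemma card_outside: "n / 2 \<le> card ({1..n} - {1..2 * k * b})" "card ({1..n} - {1..2 * k * b}) \<le> n"
proof -
  have "card ({1..n} - {1..2 * k * b}) = n - 2 * k * b"
    using U_sub by (subst card_Diff_subset) auto
  moreover have "real (2 * (2 * k * b)) \<le> real n" using kb_le by (intro of_nat_mono) simp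
  moreover have "2 * k * b \<le> n" using kb_le by simp
  ultimately show "n / 2 \<le> card ({1..n} - {1..2 * k * b})" "card ({1..n} - {1..2 * k * b}) \<le> n"
    by (simp_all add: of_nat_diff)
qed

lemma x_\<gamma>: "20000 / \<gamma>\<^sup>2 \<le> x"
proof -
  have "20000 / \<gamma>\<^sup>2 * 1 \<le> 20000 / \<gamma>\<^sup>2 * \<Lambda> ^ 4" using \<Lambda> by (intro mult_left_mono) auto
  then show ?thesis using x_ge by linarith
qed

lemma \<gamma>x: "20000 \<le> \<gamma>\<^sup>2 * x" "20000 \<le> \<gamma> * x"
proof -
  show 1: "20000 \<le> \<gamma>\<^sup>2 * x" using x_\<gamma> \<gamma> by (simp add: field_simps)
  have "\<gamma>\<^sup>2 * x \<le> \<gamma> * x" using \<gamma> x20000 by (intro mult_right_mono) (auto simp: power2_eq_square mult_left_le)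
  then show "20000 \<le> \<gamma> * x" using 1 by linarith
qed

text \<open>Too many defects contribute 2 exp(- v) to the failure probability and unsuccessful
  linking contributes exp(- v).\<close>

lemma prob_long_path_sparse:
  assumes sparse: "d\<^sup>2 \<le> r * x ^ 4"
  shows "measure_pmf.prob Q {\<omega>. \<not> long_path \<omega>} \<le> 3 * exp (- (r * x ^ 5 / d\<^sup>2))"
proof -
  \<comment> \<open>The powers of \<open>x\<close> are separated so that each comparison gains at
    least one factor \<open>x\<close> over powers of \<Lambda>. The square of \<tau> over k is about
    r x^6 / d^2, above both v and the second moment loss r x^3 / d^2. The number m of windows is
    about r \<Lambda> x^4 / d, above the number \<tau> = r x^3 / d of tolerated defects. The
    fraction \<gamma> is given up at each end of a window and for the pieces that the search may
    miss.\<close>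
  define v where "v = r * x ^ 5 / d\<^sup>2"
  define \<tau> where "\<tau> = r * x ^ 3 / d"
  define t where "t = nat \<lceil>\<tau>\<rceil>"
  define y where "y = d / x ^ 4"
  define L where "L = nat \<lfloor>y\<rfloor>"
  define m where "m = k div Suc L"
  define g where "g = nat \<lfloor>\<gamma> * L\<rfloor>"
  define s where "s = nat \<lfloor>\<gamma> * m\<rfloor>"
  define w where "w = card ({1..n} - {1..2 * k * b})"
  have x0: "0 < x" "1 \<le> x" using x20000 by auto
  have r0: "0 < r" using r600 by simp
  have yx: "x \<le> y"
    using x_pow_le_d[of 5] x0 by (simp add: y_def field_simps power_numeral_reduce)
  have y_le: "y \<le> d" using x0 d1 by (simp add: y_def field_simps self_le_power one_le_power)
  have L: "real L \<le> y" "y \<le> real L + 1" "y / 2 \<le> real L"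
    unfolding L_def using yx x20000 by linarith+
  have \<gamma>L: "10000 \<le> \<gamma> * L"
  proof -
    have "\<gamma> * (x / 2) \<le> \<gamma> * L" using \<gamma> yx L(3) by (intro mult_left_mono) auto
    then show ?thesis using \<gamma>x(2) by simp
  qed
  have g: "real g \<le> \<gamma> * L" "\<gamma> * L / 2 \<le> real g"
    unfolding g_def using \<gamma>L by linarith+
  have ry: "r / y \<ge> d" using sparse x0 d1 by (simp add: y_def field_simps power2_eq_square)
  have ry_\<Lambda>: "d \<le> r * \<Lambda> / y"
  proof -
    have "r / y * 1 \<le> r / y * \<Lambda>" using \<Lambda> r0 yx x0 by (intro mult_left_mono) auto
    then show ?thesis using ry by simp
  qed
  have m_le': "real m \<le> k / (real L + 1)"
    unfolding m_def using of_nat_div_le_of_nat[of k "Suc L", where 'a = real] by (simp add: add.commute)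
  have m_ge': "k / (real L + 1) - 1 \<le> real m"
  proof -
    have "k < m * Suc L + Suc L" using dividend_less_div_times[of "Suc L" k] by (simp add: m_def add.commute)
    then have "real k < real (m * Suc L + Suc L)" by (simp only: of_nat_less_iff)
    then have "real k \<le> (real m + 1) * (real L + 1)" by (simp add: algebra_simps)
    then show ?thesis by (simp add: field_simps)
  qed
  have m_le: "real m \<le> 2 * (r * \<Lambda> / y)"
  proof -
    have "k / (real L + 1) \<le> 2 * (r * \<Lambda>) / y"
      using k_le' L(2) yx x0 \<Lambda> r0 by (intro frac_le) auto
    then show ?thesis using m_le' by simp
  qed
  have d_big: "20000 \<le> d" using x_pow_le_d[of 1] x20000 by simp
  have m_ge: "r * \<Lambda> / y / 4 \<le> real m"
  proof -
    have "r * \<Lambda> / (2 * y) \<le> k / (real L + 1)"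
      using k_ge' L(1) yx x20000 \<Lambda> r0 by (intro frac_le) auto
    then show ?thesis using m_ge' ry_\<Lambda> d_big by simp
  qed
  have \<gamma>m: "5000 \<le> \<gamma> * m"
  proof -
    have "\<gamma> * (x / 4) \<le> \<gamma> * m" using \<gamma> m_ge ry_\<Lambda> x_pow_le_d[of 1] by (intro mult_left_mono) auto
    then show ?thesis using \<gamma>x(2) by simp
  qed
  have s: "real s \<le> \<gamma> * m" "\<gamma> * m / 2 \<le> real s"
    unfolding s_def using \<gamma>m by linarith+
  have \<tau>_le: "\<tau> \<le> \<gamma> * m / 2"
  proof -
    have "\<tau> * x = r / y" using x0 d1 by (simp add: \<tau>_def y_def power_numeral_reduce)
    also have "\<dots> \<le> r * \<Lambda> / y" using \<Lambda> r0 yx x0 by (intro divide_right_mono) auto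
    also have "\<dots> \<le> 4 * m" using m_ge by simp
    finally have "\<gamma> * (\<tau> * x) \<le> \<gamma> * (4 * m)" using \<gamma> by (intro mult_left_mono) auto
    moreover have "20000 * \<tau> \<le> \<gamma> * x * \<tau>"
      using \<gamma>x(2) r0 x0 d1 by (intro mult_right_mono) (auto simp: \<tau>_def)
    ultimately have "20000 * \<tau> \<le> 4 * (\<gamma> * m)" by (simp add: mult_ac)
    then show ?thesis using \<gamma>m by simp
  qed
  have \<tau>0: "0 \<le> \<tau>" using r0 x0 d1 by (simp add: \<tau>_def)
  have t: "\<tau> \<le> real t" "real t \<le> \<gamma> * m" unfolding t_def using \<tau>_le \<tau>0 \<gamma>m by linarith+
  have \<gamma>m_le: "\<gamma> * m \<le> m / 32" using mult_right_mono[OF \<gamma>(2), of "real m"] by simp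
  have \<gamma>L_le: "\<gamma> * L \<le> L / 32" using mult_right_mono[OF \<gamma>(2), of "real L"] by simp
  have st: "2 * s + t \<le> m"
  proof -
    have "real (2 * s + t) \<le> real m" using s t \<gamma>m_le by simp
    then show ?thesis by (simp only: of_nat_le_iff)
  qed
  have g': "0 < g" "2 * g \<le> L"
  proof -
    have "0 < real g" using g \<gamma>L by linarith
    then show "0 < g" by simp
    have "real (2 * g) \<le> real L" using g \<gamma>L_le by simp
    then show "2 * g \<le> L" by (simp only: of_nat_le_iff)
  qed
  have mL: "(1 - 2 * \<gamma>) * k \<le> real m * L"
  proof -
    have "k / (real L + 1) \<le> \<gamma> * k"
    proof -
      have "real k * 1 \<le> real k * (\<gamma> * (real L + 1))" using \<gamma>L \<gamma> by (intro mult_left_mono) (auto simp: distrib_left)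
      then show ?thesis by (simp add: field_simps)
    qed
    moreover have "real L \<le> \<gamma> * k"
    proof -
      have "1 * d \<le> \<gamma> * x * d" using \<gamma>x(2) d1 by (intro mult_right_mono) auto
      also have "\<dots> = \<gamma> * (x * d)" by simp
      also have "\<dots> \<le> \<gamma> * k"
      proof (intro mult_left_mono)
        have "x * d \<le> y * (r / y)" using yx ry x0 d1 by (intro mult_mono) auto
        also have "\<dots> = r" using yx x0 by simp
        also have "r * 1 \<le> r * \<Lambda>" using r0 \<Lambda> by (intro mult_left_mono) auto
        finally show "x * d \<le> k" using k_ge' by simp
      qed (use \<gamma> in auto)
      finally show ?thesis using L(1) y_le by linarith
    qed
    moreover have "(k / (real L + 1) - 1) * L \<le> real m * L" using m_ge' by (intro mult_right_mono) auto
    moreover have "(k / (real L + 1) - 1) * L = k - k / (real L + 1) - L" by (simp add: field_simps)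
    ultimately show ?thesis by (simp add: algebra_simps)
  qed
  have len: "(2 - 32 * \<gamma>) * (r * \<Lambda>) \<le> real ((m - t - 2 * s) * (L - 2 * g))"
  proof -
    \<comment> \<open>The loss 7 \<gamma> consists of 3 \<gamma> for defects and missed pieces, 2
      \<gamma> for the ends of the windows and 2 \<gamma> for cutting \<open>k\<close> into windows.
      Together with the margin 16 \<gamma> in \<open>k\<close> this totals at most 30 \<gamma>; the
      rest absorbs the rounding of \<open>k\<close>.\<close>
    have "(2 - 32 * \<gamma>) * (r * \<Lambda>) \<le> (1 - 7 * \<gamma>) * ((2 - 16 * \<gamma>) * (r * \<Lambda>) - 1)"
    proof -
      have "(1 - 7 * \<gamma>) * ((2 - 16 * \<gamma>) * (r * \<Lambda>) - 1) - (2 - 32 * \<gamma>) * (r * \<Lambda>)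
        = 2 * (\<gamma> * (r * \<Lambda>)) + 112 * (\<gamma> * (\<gamma> * (r * \<Lambda>))) - 1 + 7 * \<gamma>" by (simp add: algebra_simps)
      moreover have "0 \<le> \<gamma> * (\<gamma> * (r * \<Lambda>))" using \<gamma> r0 \<Lambda> by simp
      ultimately show ?thesis using \<gamma>Y \<gamma> by linarith
    qed
    also have "\<dots> \<le> (1 - 7 * \<gamma>) * k" using k_ge \<gamma> by (intro mult_left_mono) auto
    also have "\<dots> \<le> ((1 - 3 * \<gamma>) * (1 - 2 * \<gamma>)) * ((1 - 2 * \<gamma>) * k)"
    proof -
      have "((1 - 3 * \<gamma>) * (1 - 2 * \<gamma>)) * (1 - 2 * \<gamma>) - (1 - 7 * \<gamma>) = \<gamma> * \<gamma> * (16 - 12 * \<gamma>)"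
        by (simp add: algebra_simps)
      moreover have "0 \<le> \<gamma> * \<gamma> * (16 - 12 * \<gamma>)" using \<gamma> by simp
      ultimately have "(1 - 7 * \<gamma>) \<le> ((1 - 3 * \<gamma>) * (1 - 2 * \<gamma>)) * (1 - 2 * \<gamma>)" by linarith
      from mult_right_mono[OF this, of "real k"] show ?thesis by (simp only: mult.assoc)
    qed
    also have "\<dots> \<le> ((1 - 3 * \<gamma>) * (1 - 2 * \<gamma>)) * (real m * L)" using mL \<gamma> by (intro mult_left_mono) auto
    also have "\<dots> = ((1 - 3 * \<gamma>) * m) * ((1 - 2 * \<gamma>) * L)" by simp
    also have "\<dots> \<le> real (m - t - 2 * s) * real (L - 2 * g)"
    proof (intro mult_mono)
      show "(1 - 3 * \<gamma>) * m \<le> real (m - t - 2 * s)" using s t st by (simp add: of_nat_diff algebra_simps)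
      show "(1 - 2 * \<gamma>) * L \<le> real (L - 2 * g)" using g g' by (simp add: of_nat_diff algebra_simps)
    qed (use \<gamma> in auto)
    finally show ?thesis by simp
  qed
  have step1: "measure_pmf.prob Q {\<omega>. \<not> long_path \<omega>} \<le>
    measure_pmf.prob Q {\<omega>. \<not> has_path ((m - t - 2 * s) * (L - 2 * g)) \<omega>}"
  proof (rule measure_pmf.finite_measure_mono)
    show "{\<omega>. \<not> long_path \<omega>} \<subseteq> {\<omega>. \<not> has_path ((m - t - 2 * s) * (L - 2 * g)) \<omega>}"
    proof clarify
      fix \<omega> assume "\<not> long_path \<omega>" "has_path ((m - t - 2 * s) * (L - 2 * g)) \<omega>"
      then obtain vs where vs: "is_induced_path {1..n} {e \<in> pairs {1..n}. \<omega> e} vs"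
        "(m - t - 2 * s) * (L - 2 * g) \<le> path_length vs" by (auto simp: has_path_def)
      have "(2 - 32 * \<gamma>) * (r * \<Lambda>) \<le> real (path_length vs)"
        using len vs(2) by (meson of_nat_le_iff order_trans)
      then show False using vs(1) \<open>\<not> long_path \<omega>\<close> unfolding long_path_def by blast
    qed
  qed simp
  have d2: "1 \<le> d\<^sup>2" using d1 by (simp add: one_le_power)
  \<comment> \<open>The choice D = d^2 keeps exp(w/D) below exp(r/d), while ln (4 D) is still of
    order \<Lambda>.\<close>
  define \<eta> where "\<eta> = (4 * d\<^sup>2) ^ m * exp (w / d\<^sup>2) *
      exp (- ((s * g)\<^sup>2 * p\<^sup>2 * (1 - p) ^ (k + m) * (real w - m)))"
  have step2: "measure_pmf.prob Q {\<omega>. \<not> has_path ((m - t - 2 * s) * (L - 2 * g)) \<omega>} \<le>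
    measure_pmf.prob Q {\<omega>. real (min_defects k \<omega>) \<ge> t} + \<eta>"
    unfolding m_def w_def \<eta>_def
    by (rule prob_no_path_le) (use p_bounds d2 g' st in \<open>auto simp: m_def\<close>)
  have step3: "measure_pmf.prob Q {\<omega>. real (min_defects k \<omega>) \<ge> t} \<le> 2 * exp (- v)"
  proof -
    let ?S = "r * x ^ 3 / d\<^sup>2"
    let ?P = "measure_pmf.prob Q {\<omega>. \<exists>q\<in>spread k. induces \<omega> q}"
    let ?N = "measure_pmf.prob Q {\<omega>. real (min_defects k \<omega>) \<ge> t}"
    have "exp ?S + 6 / x \<le> 2 * exp ?S"
    proof -
      have "6 / x \<le> 1" using x20000 by simp
      also have "1 \<le> exp ?S" using r0 x0 by simp
      finally show ?thesis by simp
    qed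
    then have "(exp ?S + 6 / x) * ?P \<le> 2 * exp ?S * ?P" by (rule mult_right_mono) simp
    then have 1: "1 \<le> 2 * exp ?S * ?P" using prob_induced_ge by linarith
    have sub: "pairs {1..2 * k * b} \<subseteq> pairs {1..n}" using U_sub unfolding pairs_def by blast
    have "?N * ?P \<le> exp (- (real t)\<^sup>2 / real (2 * k))"
      by (rule min_defects_concentration[OF _ sub]) (use k_pos in simp_all)
    then have 2: "?N * ?P \<le> exp (- (real t)\<^sup>2 / (2 * real k))" by (simp only: of_nat_mult of_nat_numeral)
    \<comment> \<open>Dividing the concentration bound by the second moment bound costs only the
      factor 2 exp(r x^3 / d^2).\<close>
    have "?N * 1 \<le> ?N * (2 * exp ?S * ?P)" using 1 by (intro mult_left_mono) auto
    also have "\<dots> = 2 * exp ?S * (?N * ?P)" by simp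
    also have "\<dots> \<le> 2 * exp ?S * exp (- (real t)\<^sup>2 / (2 * k))" using 2 by (intro mult_left_mono) auto
    also have "\<dots> = 2 * exp (?S - (real t)\<^sup>2 / (2 * k))" by (simp add: exp_add[symmetric])
    also have "\<dots> \<le> 2 * exp (- v)"
    proof -
      have "?S + v = r / d\<^sup>2 * (x ^ 3 + x ^ 5)" by (simp add: v_def distrib_left add_divide_distrib)
      also have "\<dots> \<le> r / d\<^sup>2 * (x ^ 6 / (4 * \<Lambda>))"
      proof (intro mult_left_mono)
        have "(x ^ 3 + x ^ 5) * (4 * \<Lambda>) \<le> (x ^ 5 + x ^ 5) * (4 * \<Lambda>)"
          using x0 \<Lambda> by (intro mult_right_mono add_mono power_increasing) auto
        also have "\<dots> = x ^ 5 * (8 * \<Lambda>)" by simp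
        also have "\<dots> \<le> x ^ 5 * x" using x_\<Lambda> \<Lambda> x0 by (intro mult_left_mono) auto
        finally show "x ^ 3 + x ^ 5 \<le> x ^ 6 / (4 * \<Lambda>)" using \<Lambda> by (simp add: field_simps power_numeral_reduce)
      qed (use r0 in auto)
      also have "\<dots> = \<tau>\<^sup>2 / (2 * (2 * (r * \<Lambda>)))"
        using r0 \<Lambda> d1 by (simp add: \<tau>_def power2_eq_square power_numeral_reduce field_simps)
      also have "\<dots> \<le> (real t)\<^sup>2 / (2 * k)"
        using t(1) \<tau>0 k_le' k_pos by (intro frac_le power_mono) (auto simp: mult.commute[of \<Lambda>])
      finally show ?thesis by simp
    qed
    finally show ?thesis by simp
  qed
  have step4: "\<eta> \<le> exp (- v)"
  proof -
    \<comment> \<open>The factors of \<open>E\<close> are at least \<gamma>^4 / 25, x^8 / (2 d^2)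
      and r d / 4, so \<open>E\<close> has order \<gamma>^4 x^8 r / d. The union bound costs only m
      ln (4 d^2) + w / d^2, of order \<Lambda>^2 x^4 r / d.\<close>
    define E where "E = (s * g)\<^sup>2 * p\<^sup>2 * (1 - p) ^ (k + m) * (real w - m)"
    have y1: "1 \<le> y" using yx x0 by linarith
    have sg: "\<gamma>\<^sup>2 / 5 * (r * \<Lambda>) \<le> real s * g"
    proof -
      have "\<gamma>\<^sup>2 / 5 * (r * \<Lambda>) \<le> \<gamma>\<^sup>2 / 5 * k" using k_ge' by (intro mult_left_mono) auto
      also have "\<dots> \<le> \<gamma>\<^sup>2 / 4 * ((1 - 2 * \<gamma>) * k)"
      proof -
        have "4 / 5 * real k \<le> (1 - 2 * \<gamma>) * k" using \<gamma> by (intro mult_right_mono) auto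
        then have "\<gamma>\<^sup>2 / 4 * (4 / 5 * real k) \<le> \<gamma>\<^sup>2 / 4 * ((1 - 2 * \<gamma>) * k)" by (intro mult_left_mono) auto
        then show ?thesis by simp
      qed
      also have "\<dots> \<le> \<gamma>\<^sup>2 / 4 * (real m * L)" using mL by (intro mult_left_mono) auto
      also have "\<dots> = (\<gamma> * m / 2) * (\<gamma> * L / 2)" by (simp add: power2_eq_square)
      also have "\<dots> \<le> real s * g" using s g \<gamma> by (intro mult_mono) auto
      finally show ?thesis .
    qed
    have sgp: "\<gamma> ^ 4 / 25 \<le> (s * g)\<^sup>2 * p\<^sup>2"
    proof -
      have "\<gamma>\<^sup>2 / 5 * 1 \<le> \<gamma>\<^sup>2 / 5 * \<Lambda>" using \<Lambda> by (intro mult_left_mono) auto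
      also have "\<dots> = \<gamma>\<^sup>2 / 5 * (r * \<Lambda>) * p" using r0 by (simp add: p_eq)
      also have "\<dots> \<le> real s * g * p" using sg p_bounds by (intro mult_right_mono) auto
      finally have "(\<gamma>\<^sup>2 / 5)\<^sup>2 \<le> (real s * g * p)\<^sup>2" by (intro power_mono) auto
      then show ?thesis by (simp add: power_mult_distrib power_divide flip: power_mult)
    qed
    have pw: "x ^ 8 / d\<^sup>2 / 2 \<le> (1 - p) ^ (k + m)"
    proof -
      have inv: "exp (- (p * (1 + 4 * \<gamma>))) \<le> 1 - p"
      proof -
        define a where "a = p * (1 + 4 * \<gamma>)"
        have "1 \<le> exp a * (1 - p)"
          using inverse_1_minus_p p_bounds by (simp add: pos_divide_le_eq a_def)
        from mult_left_mono[OF this, of "exp (- a)"] have "exp (- a) \<le> exp (- a) * exp a * (1 - p)" by simp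
        also have "exp (- a) * exp a = 1" by (simp add: exp_minus)
        finally show ?thesis by (simp add: a_def)
      qed
      have "p * (1 + 4 * \<gamma>) * m \<le> 1 / 2"
      proof -
        have "p * (1 + 4 * \<gamma>) * m \<le> p * 2 * (2 * (r * \<Lambda> / y))" using m_le p_bounds \<gamma> \<Lambda> by (intro mult_mono) auto
        also have "\<dots> = 4 * \<Lambda> / y" using r0 by (simp add: p_eq)
        also have "\<dots> \<le> 4 * \<Lambda> / x" using yx x0 \<Lambda> by (intro divide_left_mono) auto
        also have "\<dots> \<le> 1 / 2" using x_\<Lambda> \<Lambda> x0 by (simp add: field_simps)
        finally show ?thesis .
      qed
      then have "exp (- (2 * ((1 - 4 * \<gamma>) * \<Lambda>)) + (- (1 / 2))) \<le> exp (- (p * (1 + 4 * \<gamma>)) * real (k + m))"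
        using pk_le by (simp add: algebra_simps)
      also have "\<dots> = exp (- (p * (1 + 4 * \<gamma>))) ^ (k + m)" by (simp add: exp_of_nat_mult[symmetric] mult.commute)
      also have "\<dots> \<le> (1 - p) ^ (k + m)" using inv by (intro power_mono) auto
      finally have low: "exp (- (2 * ((1 - 4 * \<gamma>) * \<Lambda>))) * exp (- (1 / 2)) \<le> (1 - p) ^ (k + m)" by (simp only: exp_add)
      have half: "1 / 2 \<le> exp (- (1 / 2 :: real))" using exp_ge_add_one_self[of "- (1 / 2) :: real"] by simp
      have eq: "exp (- (2 * ((1 - 4 * \<gamma>) * \<Lambda>))) = x ^ 8 / d\<^sup>2"
      proof -
        have "exp (- (2 * ((1 - 4 * \<gamma>) * \<Lambda>))) = 1 / (exp ((1 - 4 * \<gamma>) * \<Lambda>))\<^sup>2"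
          by (simp add: exp_minus exp_double inverse_eq_divide)
        also have "\<dots> = x ^ 8 / d\<^sup>2" unfolding exp_eq by (simp add: power_divide flip: power_mult)
        finally show ?thesis .
      qed
      have "x ^ 8 / d\<^sup>2 * (1 / 2) \<le> x ^ 8 / d\<^sup>2 * exp (- (1 / 2))"
        using half by (intro mult_left_mono) auto
      also have "\<dots> \<le> (1 - p) ^ (k + m)" using low unfolding eq .
      finally show ?thesis by simp
    qed
    have m_r: "real m \<le> r / 4"
    proof -
      have "2 * (r * \<Lambda> / y) \<le> 2 * (r * \<Lambda> / x)" using yx x0 r0 \<Lambda> by (intro mult_left_mono divide_left_mono) auto
      also have "\<dots> = r * (2 * \<Lambda> / x)" by simp
      also have "\<dots> \<le> r * (1 / 4)" using x_\<Lambda> \<Lambda> x0 r0 by (intro mult_left_mono) (auto simp: field_simps)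
      finally show ?thesis using m_le by simp
    qed
    have wm: "r * d / 4 \<le> real w - m"
    proof -
      have "r * 1 \<le> r * d" using r0 d1 by (intro mult_left_mono) auto
      then show ?thesis using card_outside(1) m_r by (simp add: w_def n_eq)
    qed
    have E: "2 * (r / d * x ^ 5) \<le> E"
    proof -
      have "400 \<le> \<gamma> ^ 4 * x ^ 3"
      proof -
        have "400 * 1 \<le> (\<gamma>\<^sup>2 * x)\<^sup>2 * x" using \<gamma>x(1) x0 power_mono[OF \<gamma>x(1), of 2] by (intro mult_mono) auto
        also have "\<dots> = \<gamma> ^ 4 * x ^ 3" by (simp add: power2_eq_square power_numeral_reduce)
        finally show ?thesis by simp
      qed
      then have "400 * (r / d * x ^ 5 / 200) \<le> \<gamma> ^ 4 * x ^ 3 * (r / d * x ^ 5 / 200)"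
        using r0 d1 x0 by (intro mult_right_mono) auto
      also have "\<dots> = \<gamma> ^ 4 / 25 * (x ^ 8 / d\<^sup>2 / 2) * (r * d / 4)"
        using d1 by (simp add: field_simps power2_eq_square power_numeral_reduce)
      also have "\<dots> \<le> E" unfolding E_def
        using sgp pw wm r0 d1 \<gamma> x0 p_bounds by (intro mult_mono[OF mult_mono]) auto
      finally show ?thesis by simp
    qed
    have "\<eta> = (4 * d\<^sup>2) ^ m * exp (w / d\<^sup>2) * exp (- E)" by (simp add: \<eta>_def E_def)
    also have "(4 * d\<^sup>2) ^ m = exp (m * ln (4 * d\<^sup>2))" using d1 by (simp add: exp_of_nat_mult)
    also have "\<dots> * exp (w / d\<^sup>2) * exp (- E) = exp (m * ln (4 * d\<^sup>2) + w / d\<^sup>2 - E)"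
      by (simp add: exp_add exp_diff exp_minus field_simps)
    also have "\<dots> \<le> exp (- v)"
    proof -
      have "m * ln (4 * d\<^sup>2) \<le> 2 * (r * \<Lambda> / y) * (4 * \<Lambda>)"
      proof (intro mult_mono m_le)
        have "ln (4 * d\<^sup>2) = ln 4 + 2 * \<Lambda>" using d1 by (simp add: ln_mult ln_realpow \<Lambda>_def)
        moreover have "ln (4::real) \<le> 2"
        proof -
          have "ln (4::real) = 2 * ln 2" using ln_realpow[of "2 :: real" 2] by simp
          then show ?thesis using ln_le_minus_one[of "2 :: real"] by simp
        qed
        ultimately show "ln (4 * d\<^sup>2) \<le> 4 * \<Lambda>" using \<Lambda> by simp
        show "0 \<le> ln (4 * d\<^sup>2)" using d2 by (intro ln_ge_zero) linarith
      qed (use r0 \<Lambda> y1 in auto)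
      also have "\<dots> = r / d * (8 * \<Lambda>\<^sup>2 * x ^ 4)" by (simp add: y_def power2_eq_square)
      finally have 1: "m * ln (4 * d\<^sup>2) \<le> r / d * (8 * \<Lambda>\<^sup>2 * x ^ 4)" .
      have "w / d\<^sup>2 \<le> n / d\<^sup>2" using card_outside(2) by (intro divide_right_mono) (auto simp: w_def)
      also have "\<dots> = r / d" using d1 by (simp add: n_eq power2_eq_square)
      finally have 2: "w / d\<^sup>2 \<le> r / d * 1" by simp
      have "x ^ 5 / d\<^sup>2 \<le> x ^ 5 / d" using x0 d1 by (intro divide_left_mono) (auto simp: power2_eq_square)
      from mult_left_mono[OF this, of r] have 3: "v \<le> r / d * x ^ 5" using r0 by (simp add: v_def)
      have "m * ln (4 * d\<^sup>2) + w / d\<^sup>2 + v \<le> r / d * (8 * \<Lambda>\<^sup>2 * x ^ 4 + 1 + x ^ 5)"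
        using 1 2 3 by (simp only: distrib_left)
      also have "\<dots> \<le> r / d * (2 * x ^ 5)"
      proof (intro mult_left_mono)
        have "1 * 1 \<le> \<Lambda>\<^sup>2 * x ^ 4" using \<Lambda> x0 by (intro mult_mono one_le_power) auto
        then have "8 * \<Lambda>\<^sup>2 * x ^ 4 + 1 \<le> 20000 * \<Lambda>\<^sup>2 * x ^ 4" by simp
        also have "\<dots> \<le> x * x ^ 4" using x_\<Lambda>(2) by (intro mult_right_mono) auto
        also have "\<dots> = x ^ 5" by (simp add: power_numeral_reduce)
        finally show "8 * \<Lambda>\<^sup>2 * x ^ 4 + 1 + x ^ 5 \<le> 2 * x ^ 5" by simp
      qed (use r0 d1 in auto)
      also have "\<dots> \<le> E" using E by (simp add: mult.left_commute)
      finally show ?thesis by simp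
    qed
    finally show ?thesis .
  qed
  show ?thesis using step1 step2 step3 step4 unfolding v_def[symmetric] by linarith
qed

end

section \<open>Uniformity in the average degree and the limit\<close>

context regime
begin

text \<open>If \<open>d\<close> stays bounded, so does \<open>x\<close>, so the bound has to be
  expressed in \<open>n\<close> alone. For d \<ge> n^(1/4), \<open>x\<close> itself is at least
  \<open>u\<close>. For smaller \<open>d\<close>, the quotient r / d^2 = n / d^3 is at least
  n^(1/4), which suffices in the sparse case; the dense case does not occur there.\<close>

lemma prob_long_path_ge:
  defines "u \<equiv> real n powr (\<gamma> / 4)"
  shows "min (1 - 3 * exp (- u)) (1 / (exp (1 / u) + 6 / u)) \<le> measure_pmf.prob Q {\<omega>. long_path \<omega>}"
proof -
  let ?P = "measure_pmf.prob Q {\<omega>. long_path \<omega>}"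
  have n1: "1 \<le> real n" using n_pos by simp
  have u0: "0 < u" using n1 by (simp add: u_def)
  have x0: "0 < x" "1 \<le> x" using x20000 by auto
  have xu: "u \<le> x" if "real n powr (1 / 4) \<le> d"
  proof -
    have "u = (real n powr (1 / 4)) powr \<gamma>" by (simp add: u_def powr_powr)
    also have "\<dots> \<le> x" unfolding x_def using that \<gamma> by (intro powr_mono2) auto
    finally show ?thesis .
  qed
  have cube: "d ^ 3 \<le> real n powr (3 / 4)" if "d < real n powr (1 / 4)"
  proof -
    have "d ^ 3 \<le> (real n powr (1 / 4)) ^ 3" using that d1 by (intro power_mono) auto
    then show ?thesis using n1 by (simp add: powr_power)
  qed
  show ?thesis
  proof (cases "d\<^sup>2 \<le> r * x ^ 4")
    case True
    have "u \<le> r * x ^ 5 / d\<^sup>2"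
    proof (cases "real n powr (1 / 4) \<le> d")
      case large: True
      have "1 * x \<le> (r * x ^ 4 / d\<^sup>2) * x" using True d1 x0 by (intro mult_right_mono) (auto simp: field_simps)
      also have "\<dots> = r * x ^ 5 / d\<^sup>2" by (simp add: power_numeral_reduce)
      finally show ?thesis using xu[OF large] by simp
    next
      case False
      have "u \<le> real n powr (1 / 4)" unfolding u_def using n1 \<gamma> by (intro powr_mono) auto
      also have "\<dots> = real n powr 1 / real n powr (3 / 4)" using powr_diff[of "real n" 1 "3 / 4"] by simp
      also have "\<dots> \<le> real n powr 1 / d ^ 3" using cube False d1 n1 by (intro divide_left_mono) auto
      also have "\<dots> = r * 1 / d\<^sup>2" using n1 by (simp add: r_def power2_eq_square power3_eq_cube)
      also have "\<dots> \<le> r * x ^ 5 / d\<^sup>2" using x0 r600 by (intro divide_right_mono mult_left_mono one_le_power) auto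
      finally show ?thesis .
    qed
    then have "measure_pmf.prob Q {\<omega>. \<not> long_path \<omega>} \<le> 3 * exp (- u)"
      using prob_long_path_sparse[OF True] by (smt (verit) exp_le_cancel_iff)
    moreover have "measure_pmf.prob Q {\<omega>. \<not> long_path \<omega>} = 1 - ?P"
      using measure_pmf.prob_compl[of "{\<omega>. long_path \<omega>}" Q]
      by (simp add: Compl_eq_Diff_UNIV[symmetric] Collect_neg_eq)
    ultimately show ?thesis by linarith
  next
    case False
    then have dense: "r * x ^ 4 \<le> d\<^sup>2" by simp
    have "real n powr (1 / 4) \<le> d"
    proof (rule ccontr)
      assume "\<not> real n powr (1 / 4) \<le> d"
      then have "d ^ 3 \<le> real n powr (3 / 4)" using cube by simp
      also have "\<dots> \<le> real n powr 1" using n1 by (intro powr_mono) auto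
      finally have "d ^ 3 \<le> n" using n1 by simp
      moreover have "r * x ^ 4 * d \<le> d ^ 3"
        \<comment> \<open>Multiplied by \<open>d\<close>, the dense condition reads n x^4 \<le> d^3,
          which contradicts d^3 \<le> n because x > 1.\<close>
        using mult_right_mono[OF dense, of d] d1 by (simp add: power2_eq_square power3_eq_cube)
      moreover have "real n < r * x ^ 4 * d"
      proof -
        have "1 < x ^ 4" using x20000 by (intro one_less_power) auto
        then have "real n * 1 < real n * x ^ 4" using n1 by (intro mult_strict_left_mono) auto
        then show ?thesis by (simp add: n_eq mult_ac)
      qed
      ultimately show False by linarith
    qed
    then have "u \<le> x" by (rule xu)
    then have "exp (1 / x) + 6 / x \<le> exp (1 / u) + 6 / u"
      using u0 by (intro add_mono) (auto intro: divide_left_mono)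
    then have "(exp (1 / x) + 6 / x) * ?P \<le> (exp (1 / u) + 6 / u) * ?P" by (rule mult_right_mono) simp
    then have "1 \<le> (exp (1 / u) + 6 / u) * ?P" using prob_long_path_dense[OF dense] by linarith
    moreover have "0 < exp (1 / u) + 6 / u" using u0 by (intro add_pos_pos) auto
    ultimately have "1 / (exp (1 / u) + 6 / u) \<le> ?P" by (simp add: pos_divide_le_eq mult.commute)
    then show ?thesis by linarith
  qed
qed

end

theorem theorem1p1:
  fixes \<epsilon> :: real
  assumes "\<epsilon> > 0"
  shows "\<exists>d0::real. \<forall>d::nat \<Rightarrow> real.
           (\<forall>n. d0 \<le> d n) \<longrightarrow> d \<in> o(\<lambda>n. real n) \<longrightarrow>
           (\<lambda>n. measure_pmf.prob (gnp n (d n / real n))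
                  {E. \<exists>vs. is_induced_path {1..n} E vs \<and>
                           real (path_length vs) \<ge> (2 - \<epsilon>) * (real n / d n) * ln (d n)})
             \<longlonglongrightarrow> 1"
proof -
  \<comment> \<open>The minimum with 1 provides \<gamma> \<le> 1/32 for large \<epsilon>; a smaller
    \<gamma> only demands a longer path.\<close>
  define \<gamma> where "\<gamma> = min \<epsilon> 1 / 32"
  have gam: "0 < \<gamma>" "\<gamma> \<le> 1 / 32" "32 * \<gamma> \<le> \<epsilon>" using assms by (auto simp: \<gamma>_def)
  have "eventually (\<lambda>d. 20000 / \<gamma>\<^sup>2 * ln d ^ 4 \<le> d powr \<gamma>) at_top" using gam(1) by real_asymp
  moreover have "eventually (\<lambda>d::real. 1 < d) at_top" by real_asymp
  moreover have "eventually (\<lambda>d::real. 1 \<le> ln d) at_top" by real_asymp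
  ultimately have "eventually (\<lambda>d. 20000 / \<gamma>\<^sup>2 * ln d ^ 4 \<le> d powr \<gamma> \<and> 1 < d \<and> 1 \<le> ln d) at_top"
    by eventually_elim auto
  then obtain d0 where d0: "\<And>d. d \<ge> d0 \<Longrightarrow> 20000 / \<gamma>\<^sup>2 * ln d ^ 4 \<le> d powr \<gamma> \<and> 1 < d \<and> 1 \<le> ln d"
    by (auto simp: eventually_at_top_linorder)
  show ?thesis
  proof (intro exI[of _ d0] allI impI)
    fix d :: "nat \<Rightarrow> real" assume ge: "\<forall>n. d0 \<le> d n" and small: "d \<in> o(\<lambda>n. real n)"
    define Z where "Z n = measure_pmf.prob (gnp n (d n / real n))
                  {E. \<exists>vs. is_induced_path {1..n} E vs \<and>
                           real (path_length vs) \<ge> (2 - \<epsilon>) * (real n / d n) * ln (d n)}" for n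
    define f where "f u = min (1 - 3 * exp (- u)) (1 / (exp (1 / u) + 6 / u))" for u :: real
    have lower: "eventually (\<lambda>n. f (real n powr (\<gamma> / 4)) \<le> Z n) sequentially"
    proof -
      \<comment> \<open>The requirements on \<open>d\<close> alone are met by \<open>d0\<close>. The
        remaining one, n/d \<ge> 600/\<gamma>, holds only for large \<open>n\<close>, which suffices
        for the limit.\<close>
      have "eventually (\<lambda>n. norm (d n) \<le> \<gamma> / 600 * norm (real n)) sequentially"
        using landau_o.smallD[OF small, of "\<gamma> / 600"] gam by simp
      then show ?thesis
      proof eventually_elim
        case (elim n)
        have d: "20000 / \<gamma>\<^sup>2 * ln (d n) ^ 4 \<le> d n powr \<gamma>" "1 < d n" "1 \<le> ln (d n)"
          using d0 ge by auto
        interpret regime \<gamma> "d n" n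
          by standard (use gam d elim in \<open>auto simp: field_simps\<close>)
        have "measure_pmf.prob Q {\<omega>. long_path \<omega>} \<le> Z n"
          unfolding Z_def prob_gnp p_def
        proof (rule measure_pmf.finite_measure_mono)
          show "{\<omega>. long_path \<omega>} \<subseteq> {\<omega>. \<exists>vs. is_induced_path {1..n} {e \<in> pairs {1..n}. \<omega> e} vs \<and>
              real (path_length vs) \<ge> (2 - \<epsilon>) * (real n / d n) * ln (d n)}"
          proof clarify
            fix \<omega> assume "long_path \<omega>"
            then obtain vs where vs: "is_induced_path {1..n} {e \<in> pairs {1..n}. \<omega> e} vs"
              "(2 - 32 * \<gamma>) * (r * \<Lambda>) \<le> real (path_length vs)" by (auto simp: long_path_def)
            have "(2 - \<epsilon>) * (r * \<Lambda>) \<le> (2 - 32 * \<gamma>) * (r * \<Lambda>)"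
              using gam(3) Y600 by (intro mult_right_mono) auto
            then show "\<exists>vs. is_induced_path {1..n} {e \<in> pairs {1..n}. \<omega> e} vs \<and>
              real (path_length vs) \<ge> (2 - \<epsilon>) * (real n / d n) * ln (d n)"
              using vs by (intro exI[of _ vs]) (simp add: r_def \<Lambda>_def)
          qed
        qed simp
        then show "f (real n powr (\<gamma> / 4)) \<le> Z n"
          using prob_long_path_ge unfolding f_def by linarith
      qed
    qed
    have lim: "(\<lambda>n. f (real n powr (\<gamma> / 4))) \<longlonglongrightarrow> 1"
    proof (rule filterlim_compose[of f])
      have "((\<lambda>u::real. 1 - 3 * exp (- u)) \<longlongrightarrow> 1) at_top" by real_asymp
      moreover have "((\<lambda>u::real. 1 / (exp (1 / u) + 6 / u)) \<longlongrightarrow> 1) at_top" by real_asymp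
      ultimately show "(f \<longlongrightarrow> 1) at_top" unfolding f_def[abs_def] using tendsto_min by fastforce
      show "filterlim (\<lambda>n. real n powr (\<gamma> / 4)) at_top sequentially" using gam(1) by real_asymp
    qed
    have "eventually (\<lambda>n. Z n \<le> 1) sequentially" by (simp add: Z_def)
    from tendsto_sandwich[OF lower this lim tendsto_const] have "Z \<longlonglongrightarrow> 1" .
    then show "(\<lambda>n. measure_pmf.prob (gnp n (d n / real n))
                  {E. \<exists>vs. is_induced_path {1..n} E vs \<and>
                           real (path_length vs) \<ge> (2 - \<epsilon>) * (real n / d n) * ln (d n)})
             \<longlonglongrightarrow> 1" unfolding Z_def .
  qed
qed

end
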